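(* Let $w=(i_1,\dots,i_n)\in\{0,1,2\}^n$, $\alpha\in(0,2]$, $s>0$ and $H=sd_w-\frac{(\alpha-1)d_h}{\alpha}$. 1. For any $f\in L^\alpha(K_w,\mu_{|K_w})$, one has $f\circ F_w\in L^\alpha(K,\mu)$, and $3^{n/\alpha}\,W_{K_w,\alpha}(f)$ has the same distribution as $W_{K,\alpha}(f\circ F_w)$. 2. The fields $2^{nH}3^n\left(X^w_{s,\alpha}(f)\right)_{f\in H^{-s}(K_w)}$ and $\left(X_{s,\alpha}(f\circ F_w)\right)_{f\in H^{-s}(K_w)}$ have the same finite-dimensional distributions. 3. Moreover, if $s>\max\left(\frac{(\alpha-1)d_h}{\alpha d_w},0\right)$, then $2^{nH}\left(\widetilde X^w_{s,\alpha}(F_w(x))\right)_{x\in K}$ and $\left(\widetilde X_{s,\alpha}(x)\right)_{x\in K}$ have the same finite-dimensional distributions.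
   Context: Sierpiński gasket: let $q_0=0,q_1=1,q_2=e^{i\pi/3}\in\mathbb C$ and $F_i(z)=\frac12(z-q_i)+q_i$, $i\in\{0,1,2\}$; $K\subset\mathbb C$ is the unique nonempty compact set with $K=\bigcup_{i=0}^2F_i(K)$, with the unique Borel probability measure $\mu$ such that $\mu(F_{i_1}\circ\cdots\circ F_{i_n}(K))=3^{-n}$ for all $i_1,\dots,i_n$. Put $d_h=\frac{\ln3}{\ln2}$, $d_w=\frac{\ln5}{\ln2}$ (in $d_w$ the subscript is just part of the name and unrelated to the word $w$). Neumann Laplacian on $K$: let $V_0=\{q_0,q_1,q_2\}$; for $\boldsymbol i\in\{0,1,2\}^m$ let $W_{\boldsymbol i}=F_{i_1}\circ\cdots\circ F_{i_m}(V_0)$, $V_m=\bigcup_{\boldsymbol i}W_{\boldsymbol i}$, $V_*=\bigcup_mV_m$, and $\mathcal E_m(f,f)=\frac12(\frac53)^m\sum_{\boldsymbol i\in\{0,1,2\}^m}\sum_{x,y\in W_{\boldsymbol i}}(f(x)-f(y))^2$. Functions $f$ on $V_*$ with $\mathcal E(f,f)=\lim_m\mathcal E_m(f,f)<\infty$ extend uniquely to continuous functions on $K$; with $\mathcal F$ the set of these extensions, $(\mathcal E,\mathcal F)$ is a local regular Dirichlet form on $L^2(K,\mu)$. $\Delta$ is its generator (Neumann Laplacian) and $p_t(x,y)$ its jointly continuous heat kernel with respect to $\mu$. Let $L^2_0(K,\mu)=\{f\in L^2(K,\mu):\int_Kf\,d\mu=0\}$, let $0<\lambda_1\le\lambda_2\le\cdots$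 be the eigenvalues of $-\Delta$ on $L_0^2(K,\mu)$ and $(\Phi_j)_{j\ge1}$ an orthonormal basis of $L^2_0(K,\mu)$ with $\Delta\Phi_j=-\lambda_j\Phi_j$. For $f\in L^2_0(K,\mu)$, $(-\Delta)^{-s}f=\sum_{j\ge1}\lambda_j^{-s}\left(\int_K\Phi_jf\,d\mu\right)\Phi_j$. $H^{-s}(K)$ is the completion of $L_0^2(K,\mu)$ for the norm $\|(-\Delta)^{-s}f\|_{L^2(K,\mu)}$, to which $(-\Delta)^{-s}$ extends by continuity with values in $L^2_0(K,\mu)$. For $s>0$, $G_s(x,y)=\frac1{\Gamma(s)}\int_0^{+\infty}t^{s-1}(p_t(x,y)-1)\,dt$ for $x\ne y$ (and also for $x=y$ when $s>d_h/d_w$). Smaller gasket: for $w=(i_1,\dots,i_n)$, $F_w=F_{i_1}\circ\cdots\circ F_{i_n}$ and $K_w=F_w(K)$, equipped with $\mu_{|K_w}$, so $\mu(K_w)=3^{-n}$. The Neumann Laplacian $\Delta_w$ on $K_w$ satisfies $\Delta_w(f\circ F_w^{-1})=5^n(\Delta f)\circ F_w^{-1}$; with $\Phi_j^w=3^{n/2}\Phi_j\circ F_w^{-1}$ and $\lambda_{j,w}=5^n\lambda_j$, $(\Phi_j^w)_{j\ge1}$ is an orthonormal basis of $L^2_0(K_w,\mu)=\{f\in L^2(K_w,\mu_{|K_w}):\int_{K_w}f\,d\mu=0\}$ with $-\Delta_w\Phi_j^w=\lambda_{j,w}\Phi_j^w$. Its heat kernel is $p_t^w(x,y)=3^n+\sum_{j\ge1}e^{-\lambda_{j,w}t}\Phi_j^w(x)\Phi_j^w(y)$.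 Put $(-\Delta_w)^{-s}f=\sum_{j\ge1}\lambda_{j,w}^{-s}\left(\int_{K_w}\Phi_j^wf\,d\mu\right)\Phi_j^w$ for $f\in L_0^2(K_w,\mu)$; $H^{-s}(K_w)$ is the completion of $L^2_0(K_w,\mu)$ for the norm $\|(-\Delta_w)^{-s}f\|_{L^2(K_w,\mu)}$, and $(-\Delta_w)^{-s}$ and $f\mapsto f\circ F_w\in H^{-s}(K)$ are extended to $H^{-s}(K_w)$ by continuity. The Riesz kernel is $G_s^w(x,y)=\frac1{\Gamma(s)}\int_0^{+\infty}t^{s-1}(p_t^w(x,y)-3^n)\,dt$, $x,y\in K_w$, $x\neq y$ (and also for $x=y$ when $s>d_h/d_w$). Stable measures: for $E\in\{K,K_w\}$, $W_{E,\alpha}$ is a real-valued symmetric $\alpha$-stable random measure on $E$ with control measure $\mu_{|E}$: $\sigma$-additive (almost surely), independently scattered, with $\mathbb E(e^{iuW_{E,\alpha}(A)})=e^{-|u|^\alpha\mu(A)}$. For $f\in L^\alpha(E,\mu_{|E})$ the stochastic integral $W_{E,\alpha}(f)=\int_Ef\,dW_{E,\alpha}$ satisfies $\mathbb E(e^{iuW_{E,\alpha}(f)})=e^{-|u|^\alpha\int_E|f|^\alpha d\mu}$. Fields: $X_{s,\alpha}(f)=W_{K,\alpha}((-\Delta)^{-s}f)$ for $f\in H^{-s}(K)$, $X^w_{s,\alpha}(f)=W_{K_w,\alpha}((-\Delta_w)^{-s}f)$ for $f\in H^{-s}(K_w)$; and, for $s>\max\left(\frac{(\alpha-1)d_h}{\alpha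 d_w},0\right)$, $\widetilde X_{s,\alpha}(x)=\int_KG_s(x,z)\,W_{K,\alpha}(dz)$, $x\in K$, and $\widetilde X^w_{s,\alpha}(x)=\int_{K_w}G^w_s(x,y)\,W_{K_w,\alpha}(dy)$, $x\in K_w$. *)

theory Defs
  imports "HOL-Probability.Probability"
begin

(* Functions on a subset E of the plane are total functions of type complex => real; only their
   values on E matter.  The measure nu on E always satisfies space nu = E. *)

section \<open>The gasket and its self-similar measure\<close>

definition d_h :: real where "d_h = ln 3 / ln 2"

definition d_w :: real where "d_w = ln 5 / ln 2"

definition sg_q :: "nat \<Rightarrow> complex" where
  "sg_q i = (if i = 0 then 0 else if i = 1 then 1 else exp (\<i> * complex_of_real pi / 3))"

definition sg_map :: "nat \<Rightarrow> complex \<Rightarrow> complex" where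
  "sg_map i z = (z - sg_q i) / 2 + sg_q i"

definition sg_words :: "nat \<Rightarrow> nat list set" where
  "sg_words n = {w. length w = n \<and> set w \<subseteq> {0, 1, 2}}"

definition sg_word_map :: "nat list \<Rightarrow> complex \<Rightarrow> complex" where
  "sg_word_map w = foldr (\<lambda>i g. sg_map i \<circ> g) w id"

definition is_sierpinski_gasket :: "complex set \<Rightarrow> bool" where
  "is_sierpinski_gasket K \<longleftrightarrow>
     compact K \<and> K \<noteq> {} \<and> K = (\<Union>i\<in>{0, 1, 2}. sg_map i ` K)"

definition is_gasket_measure :: "complex set \<Rightarrow> complex measure \<Rightarrow> bool" where
  "is_gasket_measure K \<mu> \<longleftrightarrow>
     prob_space \<mu> \<and> sets \<mu> = sets (restrict_space borel K) \<and>
     (\<forall>n. \<forall>w\<in>sg_words n. measure \<mu> (sg_word_map w ` K) = 1 / 3 ^ n)"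

section \<open>Lebesgue spaces\<close>

definition Lp_set :: "'a measure \<Rightarrow> real \<Rightarrow> ('a \<Rightarrow> real) set" where
  "Lp_set \<nu> p = {f \<in> borel_measurable \<nu>. integrable \<nu> (\<lambda>x. \<bar>f x\<bar> powr p)}"

definition L2_zero :: "'a measure \<Rightarrow> ('a \<Rightarrow> real) set" where
  "L2_zero \<nu> = {f \<in> Lp_set \<nu> 2. (\<integral>x. f x \<partial>\<nu>) = 0}"

definition L2_norm :: "'a measure \<Rightarrow> ('a \<Rightarrow> real) \<Rightarrow> real" where
  "L2_norm \<nu> f = sqrt (\<integral>x. (f x)\<^sup>2 \<partial>\<nu>)"

(* A version of the limit in square mean; it is determined only almost everywhere. *)
definition L2_lim :: "'a measure \<Rightarrow> (nat \<Rightarrow> 'a \<Rightarrow> real) \<Rightarrow> 'a \<Rightarrow> real" where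
  "L2_lim \<nu> S = (SOME g. g \<in> Lp_set \<nu> 2 \<and> (\<lambda>n. L2_norm \<nu> (\<lambda>x. S n x - g x)) \<longlonglongrightarrow> 0)"

section \<open>Dirichlet form, Neumann Laplacian and heat kernel\<close>

definition sg_vertices :: "nat list \<Rightarrow> complex set" where
  "sg_vertices w = sg_word_map w ` {sg_q 0, sg_q 1, sg_q 2}"

definition energy_level :: "nat \<Rightarrow> (complex \<Rightarrow> real) \<Rightarrow> (complex \<Rightarrow> real) \<Rightarrow> real" where
  "energy_level m f g = 1 / 2 * (5 / 3) ^ m *
     (\<Sum>w\<in>sg_words m. \<Sum>x\<in>sg_vertices w. \<Sum>y\<in>sg_vertices w. (f x - f y) * (g x - g y))"

(* The energies of f at levels m = 0, 1, ... are nondecreasing, so that their limit is finite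
   exactly when they converge in the reals.  The elements of the domain are the continuous
   functions on K whose restriction to the vertices has finite energy. *)
definition energy_domain :: "complex set \<Rightarrow> (complex \<Rightarrow> real) set" where
  "energy_domain K = {f. continuous_on K f \<and> convergent (\<lambda>m. energy_level m f f)}"

definition energy :: "(complex \<Rightarrow> real) \<Rightarrow> (complex \<Rightarrow> real) \<Rightarrow> real" where
  "energy f g = lim (\<lambda>m. energy_level m f g)"

(* The graph of the generator of the form: u is in its domain and is mapped to g. *)
definition neumann_laplacian ::
    "complex set \<Rightarrow> complex measure \<Rightarrow> (complex \<Rightarrow> real) \<Rightarrow> (complex \<Rightarrow> real) \<Rightarrow> bool" where
  "neumann_laplacian K \<mu> u g \<longleftrightarrow>
     u \<in> energy_domain K \<and> g \<in> Lp_set \<mu> 2 \<and>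
     (\<forall>v\<in>energy_domain K. energy u v = - (\<integral>x. g x * v x \<partial>\<mu>))"

definition kernel_op ::
    "'a measure \<Rightarrow> (real \<Rightarrow> 'a \<Rightarrow> 'a \<Rightarrow> real) \<Rightarrow> real \<Rightarrow> ('a \<Rightarrow> real) \<Rightarrow> 'a \<Rightarrow> real" where
  "kernel_op \<mu> p t f x = (\<integral>y. p t x y * f y \<partial>\<mu>)"

(* The operators with kernels p t form a strongly continuous semigroup on the space of square
   integrable functions whose infinitesimal generator, domain included, is the Neumann
   Laplacian. *)
definition is_heat_kernel ::
    "complex set \<Rightarrow> complex measure \<Rightarrow> (real \<Rightarrow> complex \<Rightarrow> complex \<Rightarrow> real) \<Rightarrow> bool" where
  "is_heat_kernel K \<mu> p \<longleftrightarrow>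
     continuous_on ({0<..} \<times> K \<times> K) (\<lambda>(t, x, y). p t x y) \<and>
     (\<forall>f\<in>Lp_set \<mu> 2. \<forall>r>0. \<forall>t>0. AE x in \<mu>.
        kernel_op \<mu> p (r + t) f x = kernel_op \<mu> p r (kernel_op \<mu> p t f) x) \<and>
     (\<forall>f\<in>Lp_set \<mu> 2.
        ((\<lambda>t. L2_norm \<mu> (\<lambda>x. kernel_op \<mu> p t f x - f x)) \<longlongrightarrow> 0) (at_right 0)) \<and>
     (\<forall>f\<in>Lp_set \<mu> 2. \<forall>g\<in>Lp_set \<mu> 2.
        ((\<lambda>t. L2_norm \<mu> (\<lambda>x. (kernel_op \<mu> p t f x - f x) / t - g x)) \<longlongrightarrow> 0) (at_right 0)
        \<longleftrightarrow> (\<exists>u. (AE x in \<mu>. f x = u x) \<and> neumann_laplacian K \<mu> u g))"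

(* Eigenvalues and eigenfunctions are numbered from 0 instead of from 1. *)
definition is_neumann_eigenbasis ::
    "complex set \<Rightarrow> complex measure \<Rightarrow> (nat \<Rightarrow> real) \<Rightarrow> (nat \<Rightarrow> complex \<Rightarrow> real) \<Rightarrow> bool" where
  "is_neumann_eigenbasis K \<mu> lam \<Phi> \<longleftrightarrow>
     (\<forall>j. 0 < lam j) \<and> incseq lam \<and>
     (\<forall>j. \<Phi> j \<in> L2_zero \<mu>) \<and>
     (\<forall>j. neumann_laplacian K \<mu> (\<Phi> j) (\<lambda>x. - lam j * \<Phi> j x)) \<and>
     (\<forall>i j. (\<integral>x. \<Phi> i x * \<Phi> j x \<partial>\<mu>) = (if i = j then 1 else 0)) \<and>
     (\<forall>f\<in>L2_zero \<mu>.
        (\<lambda>N. L2_norm \<mu> (\<lambda>x. (\<Sum>j<N. (\<integral>z. \<Phi> j z * f z \<partial>\<mu>) * \<Phi> j x) - f x)) \<longlonglongrightarrow> 0)"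

section \<open>Negative powers of the Laplacian and Sobolev spaces of negative order\<close>

(* Here nu, lam, Phi are the measure and the eigendata of either the whole gasket or a cell. *)

definition neg_power ::
    "'a measure \<Rightarrow> (nat \<Rightarrow> real) \<Rightarrow> (nat \<Rightarrow> 'a \<Rightarrow> real) \<Rightarrow> real \<Rightarrow> ('a \<Rightarrow> real) \<Rightarrow> 'a \<Rightarrow> real" where
  "neg_power \<nu> lam \<Phi> s f =
     L2_lim \<nu> (\<lambda>N x. \<Sum>j<N. lam j powr (- s) * (\<integral>z. \<Phi> j z * f z \<partial>\<nu>) * \<Phi> j x)"

definition sobolev_norm ::
    "'a measure \<Rightarrow> (nat \<Rightarrow> real) \<Rightarrow> (nat \<Rightarrow> 'a \<Rightarrow> real) \<Rightarrow> real \<Rightarrow> ('a \<Rightarrow> real) \<Rightarrow> real" where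
  "sobolev_norm \<nu> lam \<Phi> s f = L2_norm \<nu> (neg_power \<nu> lam \<Phi> s f)"

definition sobolev_cauchy ::
    "'a measure \<Rightarrow> (nat \<Rightarrow> real) \<Rightarrow> (nat \<Rightarrow> 'a \<Rightarrow> real) \<Rightarrow> real \<Rightarrow> (nat \<Rightarrow> 'a \<Rightarrow> real) set" where
  "sobolev_cauchy \<nu> lam \<Phi> s = {\<phi>. (\<forall>n. \<phi> n \<in> L2_zero \<nu>) \<and>
     (\<forall>e>0. \<exists>N. \<forall>m\<ge>N. \<forall>n\<ge>N. sobolev_norm \<nu> lam \<Phi> s (\<lambda>x. \<phi> m x - \<phi> n x) < e)}"

definition sobolev_rel ::
    "'a measure \<Rightarrow> (nat \<Rightarrow> real) \<Rightarrow> (nat \<Rightarrow> 'a \<Rightarrow> real) \<Rightarrow> real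
      \<Rightarrow> ((nat \<Rightarrow> 'a \<Rightarrow> real) \<times> (nat \<Rightarrow> 'a \<Rightarrow> real)) set" where
  "sobolev_rel \<nu> lam \<Phi> s = {(\<phi>, \<psi>).
     \<phi> \<in> sobolev_cauchy \<nu> lam \<Phi> s \<and> \<psi> \<in> sobolev_cauchy \<nu> lam \<Phi> s \<and>
     (\<lambda>n. sobolev_norm \<nu> lam \<Phi> s (\<lambda>x. \<phi> n x - \<psi> n x)) \<longlonglongrightarrow> 0}"

(* The completion, realised by Cauchy sequences modulo null sequences. *)
definition sobolev_neg ::
    "'a measure \<Rightarrow> (nat \<Rightarrow> real) \<Rightarrow> (nat \<Rightarrow> 'a \<Rightarrow> real) \<Rightarrow> real
      \<Rightarrow> (nat \<Rightarrow> 'a \<Rightarrow> real) set set" where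
  "sobolev_neg \<nu> lam \<Phi> s = sobolev_cauchy \<nu> lam \<Phi> s // sobolev_rel \<nu> lam \<Phi> s"

(* Extension by continuity: apply the operator to a representing sequence and pass to the
   limit. *)
definition neg_power_ext ::
    "'a measure \<Rightarrow> (nat \<Rightarrow> real) \<Rightarrow> (nat \<Rightarrow> 'a \<Rightarrow> real) \<Rightarrow> real
      \<Rightarrow> (nat \<Rightarrow> 'a \<Rightarrow> real) set \<Rightarrow> 'a \<Rightarrow> real" where
  "neg_power_ext \<nu> lam \<Phi> s f = L2_lim \<nu> (\<lambda>n. neg_power \<nu> lam \<Phi> s ((SOME \<phi>. \<phi> \<in> f) n))"

(* Extension by continuity of composition with F to the completion; nu, lam, Phi are the data of
   the target space. *)
definition sobolev_pullback ::
    "'a measure \<Rightarrow> (nat \<Rightarrow> real) \<Rightarrow> (nat \<Rightarrow> 'a \<Rightarrow> real) \<Rightarrow> real \<Rightarrow> ('a \<Rightarrow> 'b)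
      \<Rightarrow> (nat \<Rightarrow> 'b \<Rightarrow> real) set \<Rightarrow> (nat \<Rightarrow> 'a \<Rightarrow> real) set" where
  "sobolev_pullback \<nu> lam \<Phi> s F f =
     sobolev_rel \<nu> lam \<Phi> s `` ((\<lambda>\<phi> n. \<phi> n \<circ> F) ` f)"

section \<open>Cells\<close>

definition cell :: "complex set \<Rightarrow> nat list \<Rightarrow> complex set" where
  "cell K w = sg_word_map w ` K"

definition cell_measure :: "complex set \<Rightarrow> complex measure \<Rightarrow> nat list \<Rightarrow> complex measure" where
  "cell_measure K \<mu> w = restrict_space \<mu> (cell K w)"

definition cell_eigenvalue :: "(nat \<Rightarrow> real) \<Rightarrow> nat list \<Rightarrow> nat \<Rightarrow> real" where
  "cell_eigenvalue lam w j = 5 ^ length w * lam j"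

definition cell_eigenfunction ::
    "(nat \<Rightarrow> complex \<Rightarrow> real) \<Rightarrow> nat list \<Rightarrow> nat \<Rightarrow> complex \<Rightarrow> real" where
  "cell_eigenfunction \<Phi> w j x =
     3 powr (real (length w) / 2) * \<Phi> j (inv (sg_word_map w) x)"

definition cell_heat_kernel ::
    "(nat \<Rightarrow> real) \<Rightarrow> (nat \<Rightarrow> complex \<Rightarrow> real) \<Rightarrow> nat list
      \<Rightarrow> real \<Rightarrow> complex \<Rightarrow> complex \<Rightarrow> real" where
  "cell_heat_kernel lam \<Phi> w t x y = 3 ^ length w +
     (\<Sum>j. exp (- cell_eigenvalue lam w j * t) *
            cell_eigenfunction \<Phi> w j x * cell_eigenfunction \<Phi> w j y)"

section \<open>Riesz kernels\<close>

(* The constant c is the limit of p t x y as t tends to infinity: 1 for the gasket and 3 ^ n for a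
   cell of level n.  The Lebesgue integral is 0 by convention when it does not converge, which
   concerns only the diagonal in the range of s where the kernel is left undefined there. *)
definition riesz_kernel ::
    "real \<Rightarrow> (real \<Rightarrow> 'a \<Rightarrow> 'a \<Rightarrow> real) \<Rightarrow> real \<Rightarrow> 'a \<Rightarrow> 'a \<Rightarrow> real" where
  "riesz_kernel c p s x y =
     1 / Gamma s * (LINT t:{0<..}|lborel. t powr (s - 1) * (p t x y - c))"

section \<open>Symmetric stable random measures and stochastic integrals\<close>

definition is_stable_random_measure ::
    "'w measure \<Rightarrow> 'a measure \<Rightarrow> real \<Rightarrow> ('a set \<Rightarrow> 'w \<Rightarrow> real) \<Rightarrow> bool" where
  "is_stable_random_measure P \<nu> \<alpha> W \<longleftrightarrow>
     prob_space P \<and>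
     (\<forall>A\<in>sets \<nu>. W A \<in> borel_measurable P \<and>
        (\<forall>u. (CLINT \<omega>|P. iexp (u * W A \<omega>)) =
             complex_of_real (exp (- (\<bar>u\<bar> powr \<alpha> * measure \<nu> A))))) \<and>
     (\<forall>A :: nat \<Rightarrow> 'a set. range A \<subseteq> sets \<nu> \<and> disjoint_family A \<longrightarrow>
        prob_space.indep_vars P (\<lambda>_. borel) (\<lambda>i. W (A i)) UNIV \<and>
        (AE \<omega> in P. (\<lambda>i. W (A i) \<omega>) sums W (\<Union>i. A i) \<omega>))"

definition stable_simple_integral ::
    "'a measure \<Rightarrow> ('a set \<Rightarrow> 'w \<Rightarrow> real) \<Rightarrow> ('a \<Rightarrow> real) \<Rightarrow> 'w \<Rightarrow> real" where
  "stable_simple_integral \<nu> W f \<omega> =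
     (\<Sum>c\<in>f ` space \<nu>. c * W (f -` {c} \<inter> space \<nu>) \<omega>)"

definition tendsto_in_prob ::
    "'w measure \<Rightarrow> (nat \<Rightarrow> 'w \<Rightarrow> real) \<Rightarrow> ('w \<Rightarrow> real) \<Rightarrow> bool" where
  "tendsto_in_prob P X Y \<longleftrightarrow>
     (\<forall>e>0. (\<lambda>n. measure P {\<omega> \<in> space P. \<bar>X n \<omega> - Y \<omega>\<bar> > e}) \<longlonglongrightarrow> 0)"

(* Limit in probability of the integrals of simple functions that converge to f in the space of
   order alpha, a version of which is chosen; 0 by convention outside this space. *)
definition stable_integral ::
    "'w measure \<Rightarrow> 'a measure \<Rightarrow> real \<Rightarrow> ('a set \<Rightarrow> 'w \<Rightarrow> real) \<Rightarrow> ('a \<Rightarrow> real) \<Rightarrow> 'w \<Rightarrow> real" where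
  "stable_integral P \<nu> \<alpha> W f =
     (if f \<in> Lp_set \<nu> \<alpha> then
        (SOME X. X \<in> borel_measurable P \<and>
           (\<exists>\<phi>. (\<forall>n. simple_function \<nu> (\<phi> n)) \<and>
                (\<lambda>n. \<integral>x. \<bar>\<phi> n x - f x\<bar> powr \<alpha> \<partial>\<nu>) \<longlonglongrightarrow> 0 \<and>
                tendsto_in_prob P (\<lambda>n. stable_simple_integral \<nu> W (\<phi> n)) X))
      else (\<lambda>_. 0))"

section \<open>Fractional stable fields\<close>

definition stable_field ::
    "'w measure \<Rightarrow> 'a measure \<Rightarrow> real \<Rightarrow> ('a set \<Rightarrow> 'w \<Rightarrow> real)
      \<Rightarrow> (nat \<Rightarrow> real) \<Rightarrow> (nat \<Rightarrow> 'a \<Rightarrow> real) \<Rightarrow> real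
      \<Rightarrow> (nat \<Rightarrow> 'a \<Rightarrow> real) set \<Rightarrow> 'w \<Rightarrow> real" where
  "stable_field P \<nu> \<alpha> W lam \<Phi> s f = stable_integral P \<nu> \<alpha> W (neg_power_ext \<nu> lam \<Phi> s f)"

definition stable_density_field ::
    "'w measure \<Rightarrow> 'a measure \<Rightarrow> real \<Rightarrow> ('a set \<Rightarrow> 'w \<Rightarrow> real)
      \<Rightarrow> ('a \<Rightarrow> 'a \<Rightarrow> real) \<Rightarrow> 'a \<Rightarrow> 'w \<Rightarrow> real" where
  "stable_density_field P \<nu> \<alpha> W G x = stable_integral P \<nu> \<alpha> W (G x)"

section \<open>Equality in distribution\<close>

definition same_distribution ::
    "'v measure \<Rightarrow> ('v \<Rightarrow> real) \<Rightarrow> 'w measure \<Rightarrow> ('w \<Rightarrow> real) \<Rightarrow> bool" where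
  "same_distribution P X Q Y \<longleftrightarrow>
     X \<in> borel_measurable P \<and> Y \<in> borel_measurable Q \<and> distr P borel X = distr Q borel Y"

definition same_fdd ::
    "'i set \<Rightarrow> 'v measure \<Rightarrow> ('i \<Rightarrow> 'v \<Rightarrow> real) \<Rightarrow> 'w measure \<Rightarrow> ('i \<Rightarrow> 'w \<Rightarrow> real) \<Rightarrow> bool" where
  "same_fdd I P X Q Y \<longleftrightarrow>
     (\<forall>i\<in>I. X i \<in> borel_measurable P \<and> Y i \<in> borel_measurable Q) \<and>
     (\<forall>J. finite J \<and> J \<subseteq> I \<longrightarrow>
        distr P (PiM J (\<lambda>_. borel)) (\<lambda>\<omega>. \<lambda>i\<in>J. X i \<omega>) =
        distr Q (PiM J (\<lambda>_. borel)) (\<lambda>\<omega>. \<lambda>i\<in>J. Y i \<omega>))"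

end

theory Submission
  imports Defs
begin

text \<open>An \<open>\<alpha>\<close>-stable integral has characteristic function \<open>exp (- \<bar>u\<bar> powr \<alpha> * \<parallel>f\<parallel> powr \<alpha>)\<close>, where
  \<open>\<parallel>f\<parallel>\<close> is the norm of the integrand in the space of order \<open>\<alpha>\<close>, and it is linear in the integrand.
  The finite-dimensional distributions of a family of integrals are therefore determined by the norms
  of the linear combinations of the integrands.  Self-similarity of the measure gives
  \<open>\<integral> f \<circ> F\<^sub>w \<partial>\<mu> = 3 ^ n * \<integral> f \<partial>\<mu>\<close>, integrated over the cell on the right, so all three claims reduce to
  the way in which the integrands scale under composition with \<open>F\<^sub>w\<close>: the negative power of the
  Laplacian by \<open>5 powr (n * s)\<close>, since the eigenvalues scale by \<open>5 ^ n\<close>, and the Riesz kernel by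
  \<open>3 ^ n * 5 powr (- n * s)\<close>.  The latter needs the eigenfunction expansion of the heat kernel at
  every pair of points, in order to identify the kernel of the cell, which is defined by its series,
  with a rescaled heat kernel.\<close>

section \<open>Joint characteristic functions\<close>

text \<open>The two random measures may live on different probability spaces, so only laws can be
  compared. Stochastic integrals, potentials and limits in L2 are versions selected by a choice
  operator, so identities between integrands hold almost everywhere only. For
  \<open>\<alpha>\<close> < 1 the space of order \<open>\<alpha>\<close> is not normed; one
  quasi-norm bound, valid for all positive exponents, takes the place of Minkowski's inequality. The
  measure is known only through the masses of cells, which may overlap: its self-similarity comes
  from uniqueness, since the rescaled measure of a cell has the same cell masses. The heat kernel is
  known only through its semigroup and generator; what makes it computable is that
  \<open>exp (c * t) * Pt t f x\<close> does not depend on t when f is an eigenfunction with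
  Laplacian \<open>- c * f\<close>. The powers of 3 have two sources: 3 powr (n /
  \<open>\<alpha>\<close>) compensates the mass of the cell inside an integral of
  \<open>\<alpha>\<close>-th powers, and the factor 3 ^ n, visible in the second claim but not in
  the third, is carried there by the Riesz kernel, a density with respect to a measure of smaller
  mass.\<close>

lemma (in prob_space) integrable_bounded_iexp:
  fixes Z :: "'a \<Rightarrow> complex"
  assumes [measurable]: "Z \<in> borel_measurable M" "X \<in> borel_measurable M"
    and bound: "\<And>\<omega>. norm (Z \<omega>) \<le> 1"
  shows "integrable M (\<lambda>\<omega>. Z \<omega> * iexp (X \<omega>))"
  by (rule integrable_const_bound[where B = 1]) (auto simp: norm_mult bound)

text \<open>Divided by their common mass m, the weights become densities of probability measures
  under which X and Y have equal characteristic functions. The bound 2 admits weights 1 + U with |U|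
  at most 1.\<close>

lemma finite_weight_uniqueness:
  fixes P :: "'v measure" and Q :: "'w measure"
  assumes "prob_space P" "prob_space Q"
    and [measurable]: "X \<in> borel_measurable P" "Y \<in> borel_measurable Q"
      "g \<in> borel_measurable P" "h \<in> borel_measurable Q"
    and g: "\<And>\<omega>. 0 \<le> g \<omega>" "\<And>\<omega>. g \<omega> \<le> 2" and h: "\<And>\<omega>. 0 \<le> h \<omega>" "\<And>\<omega>. h \<omega> \<le> 2"
    and eq: "\<And>v. (CLINT \<omega>|P. complex_of_real (g \<omega>) * iexp (v * X \<omega>)) =
      (CLINT \<omega>|Q. complex_of_real (h \<omega>) * iexp (v * Y \<omega>))"
    and B: "B \<in> sets borel"
  shows "(\<integral>\<omega>. g \<omega> * indicator B (X \<omega>) \<partial>P) = (\<integral>\<omega>. h \<omega> * indicator B (Y \<omega>) \<partial>Q)"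
proof -
  interpret P: prob_space P by fact
  interpret Q: prob_space Q by fact
  define m where "m = (\<integral>\<omega>. g \<omega> \<partial>P)"
  have intg: "integrable P g" by (rule P.integrable_const_bound[where B=2]) (use g in auto)
  have inth: "integrable Q h" by (rule Q.integrable_const_bound[where B=2]) (use h in auto)
  \<comment> \<open>Frequency 0 shows that both weights have the same mass.\<close>
  have "complex_of_real (\<integral>\<omega>. g \<omega> \<partial>P) = complex_of_real (\<integral>\<omega>. h \<omega> \<partial>Q)"
    using eq[of 0] by (simp add: integral_complex_of_real)
  then have m': "m = (\<integral>\<omega>. h \<omega> \<partial>Q)" by (simp add: m_def)
  have m0: "m \<ge> 0" unfolding m_def using g by simp
  have split: "\<exists>N. real_distribution N \<and> (\<forall>v. char N v = (CLINT \<omega>|R. complex_of_real (k \<omega>) * iexp (v * Z \<omega>)) / m) \<and>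
      measure N B = (\<integral>\<omega>. k \<omega> * indicator B (Z \<omega>) \<partial>R) / m"
    if m: "m > 0" and [measurable]: "Z \<in> borel_measurable R" "k \<in> borel_measurable R"
      and k: "\<And>\<omega>. 0 \<le> k \<omega>" and int: "integrable R k" and mk: "m = (\<integral>\<omega>. k \<omega> \<partial>R)" for R :: "'x measure" and k Z
  proof (intro exI conjI allI)
    let ?D = "density R (\<lambda>\<omega>. k \<omega> / m)"
    let ?N = "distr ?D borel Z"
    have D: "prob_space ?D"
    proof
      have "emeasure ?D (space ?D) = (\<integral>\<^sup>+\<omega>. ennreal (k \<omega> / m) \<partial>R)"
        by (auto simp: emeasure_density intro!: nn_integral_cong)
      also have "\<dots> = ennreal (\<integral>\<omega>. k \<omega> / m \<partial>R)"
        using int k m by (intro nn_integral_eq_integral) auto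
      also have "\<dots> = 1" using m mk by simp
      finally show "emeasure ?D (space ?D) = 1" .
    qed
    then interpret D: prob_space ?D .
    show "real_distribution ?N" by (rule D.real_distribution_distr) simp
    show "char ?N v = (CLINT \<omega>|R. complex_of_real (k \<omega>) * iexp (v * Z \<omega>)) / m" for v
    proof -
      have "char ?N v = (CLINT \<omega>|?D. iexp (v * Z \<omega>))"
        by (simp add: char_def integral_distr)
      also have "\<dots> = (CLINT \<omega>|R. (k \<omega> / m) *\<^sub>R iexp (v * Z \<omega>))"
        using k m by (intro integral_density) auto
      also have "\<dots> = (CLINT \<omega>|R. (complex_of_real (k \<omega>) * iexp (v * Z \<omega>)) / m)"
        by (intro Bochner_Integration.integral_cong) (auto simp: scaleR_conv_of_real)
      finally show ?thesis by simp
    qed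
    have "measure ?N B = (\<integral>x. indicator B x \<partial>?N)" using B by simp
    also have "\<dots> = (\<integral>\<omega>. indicator B (Z \<omega>) \<partial>?D)" using B by (intro integral_distr) auto
    also have "\<dots> = (\<integral>\<omega>. (k \<omega> / m) *\<^sub>R indicator B (Z \<omega>) \<partial>R)"
      using k m B by (intro integral_density) auto
    finally show "measure ?N B = (\<integral>\<omega>. k \<omega> * indicator B (Z \<omega>) \<partial>R) / m"
      by simp
  qed
  show ?thesis
  proof (cases "m > 0")
    case True
    from split[OF True, of X P g] obtain N1 where N1: "real_distribution N1"
      "\<And>v. char N1 v = (CLINT \<omega>|P. complex_of_real (g \<omega>) * iexp (v * X \<omega>)) / m"
      "measure N1 B = (\<integral>\<omega>. g \<omega> * indicator B (X \<omega>) \<partial>P) / m"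
      using g intg m_def by auto
    from split[OF True, of Y Q h] obtain N2 where N2: "real_distribution N2"
      "\<And>v. char N2 v = (CLINT \<omega>|Q. complex_of_real (h \<omega>) * iexp (v * Y \<omega>)) / m"
      "measure N2 B = (\<integral>\<omega>. h \<omega> * indicator B (Y \<omega>) \<partial>Q) / m"
      using h inth m' by auto
    have "N1 = N2"
      by (rule Levy_uniqueness[OF N1(1) N2(1)]) (simp only: fun_eq_iff N1(2) N2(2) eq simp_thms)
    then show ?thesis using N1(3) N2(3) True by simp
  next
    case False
    then have "m = 0" using m0 by simp
    then have "AE \<omega> in P. g \<omega> = 0" "AE \<omega> in Q. h \<omega> = 0"
      using m' m_def integral_nonneg_eq_0_iff_AE[OF intg] integral_nonneg_eq_0_iff_AE[OF inth] g h
      by auto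
    then have "(\<integral>\<omega>. g \<omega> * indicator B (X \<omega>) \<partial>P) = (\<integral>\<omega>. 0 \<partial>P)"
      "(\<integral>\<omega>. h \<omega> * indicator B (Y \<omega>) \<partial>Q) = (\<integral>\<omega>. 0 \<partial>Q)"
      by (intro integral_cong_AE; use B in \<open>auto\<close>)+
    then show ?thesis by simp
  qed
qed

text \<open>A complex weight splits into real and imaginary part, and a real weight U with |U| at
  most 1 is the difference of the nonnegative weights 1 + U and 1. Hypothesis \<open>eq1\<close>
  supplies the weight 1.\<close>

lemma complex_weight_uniqueness:
  fixes P :: "'v measure" and Q :: "'w measure" and Z :: "'v \<Rightarrow> complex" and Z' :: "'w \<Rightarrow> complex"
  assumes "prob_space P" "prob_space Q"
    and [measurable]: "X \<in> borel_measurable P" "Y \<in> borel_measurable Q"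
      "Z \<in> borel_measurable P" "Z' \<in> borel_measurable Q"
    and Z: "\<And>\<omega>. norm (Z \<omega>) \<le> 1" "\<And>\<omega>. norm (Z' \<omega>) \<le> 1"
    and eq1: "\<And>v. (CLINT \<omega>|P. iexp (v * X \<omega>)) = (CLINT \<omega>|Q. iexp (v * Y \<omega>))"
    and eq: "\<And>v. (CLINT \<omega>|P. Z \<omega> * iexp (v * X \<omega>)) = (CLINT \<omega>|Q. Z' \<omega> * iexp (v * Y \<omega>))"
    and B[measurable]: "B \<in> sets borel"
  shows "(CLINT \<omega>|P. Z \<omega> * indicator B (X \<omega>)) = (CLINT \<omega>|Q. Z' \<omega> * indicator B (Y \<omega>))"
proof -
  interpret P: prob_space P by fact
  interpret Q: prob_space Q by fact
  have [measurable]: "cnj \<in> borel_measurable borel"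
    by (intro borel_measurable_continuous_onI continuous_intros)
  have cZ: "(\<lambda>\<omega>. cnj (Z \<omega>)) \<in> borel_measurable P" "(\<lambda>\<omega>. cnj (Z' \<omega>)) \<in> borel_measurable Q"
    by measurable
  have intP: "integrable P (\<lambda>\<omega>. U \<omega> * iexp (v * X \<omega>))" if "U \<in> borel_measurable P" "\<And>\<omega>. norm (U \<omega>) \<le> 1" for U v
    using that by (intro P.integrable_bounded_iexp) auto
  have intQ: "integrable Q (\<lambda>\<omega>. U \<omega> * iexp (v * Y \<omega>))" if "U \<in> borel_measurable Q" "\<And>\<omega>. norm (U \<omega>) \<le> 1" for U v
    using that by (intro Q.integrable_bounded_iexp) auto
  \<comment> \<open>Conjugating the hypothesis at the frequency -v yields it for the conjugate
    weights; \<open>Re\<close> and \<open>Im\<close> are combined from the two below.\<close>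
  have eqc: "(CLINT \<omega>|P. cnj (Z \<omega>) * iexp (v * X \<omega>)) = (CLINT \<omega>|Q. cnj (Z' \<omega>) * iexp (v * Y \<omega>))" for v
  proof -
    have "cnj (iexp (v * t)) = iexp (-v * t)" for t by (simp add: exp_cnj)
    then have "(CLINT \<omega>|P. cnj (Z \<omega> * iexp (-v * X \<omega>))) = (CLINT \<omega>|Q. cnj (Z' \<omega> * iexp (-v * Y \<omega>)))"
      unfolding Bochner_Integration.integral_cnj using eq[of "-v"] by simp
    then show ?thesis by (simp add: exp_cnj)
  qed
  have real: "(\<integral>\<omega>. U \<omega> * indicator B (X \<omega>) \<partial>P) = (\<integral>\<omega>. U' \<omega> * indicator B (Y \<omega>) \<partial>Q)"
    if [measurable]: "U \<in> borel_measurable P" "U' \<in> borel_measurable Q"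
      and U: "\<And>\<omega>. \<bar>U \<omega>\<bar> \<le> 1" "\<And>\<omega>. \<bar>U' \<omega>\<bar> \<le> 1"
      and e: "\<And>v. (CLINT \<omega>|P. complex_of_real (U \<omega>) * iexp (v * X \<omega>)) = (CLINT \<omega>|Q. complex_of_real (U' \<omega>) * iexp (v * Y \<omega>))"
    for U U'
  proof -
    have i: "integrable P (\<lambda>\<omega>. iexp (v * X \<omega>))" "integrable Q (\<lambda>\<omega>. iexp (v * Y \<omega>))" for v
      using intP[of "\<lambda>_. 1" v] intQ[of "\<lambda>_. 1" v] by auto
    have e1: "(CLINT \<omega>|P. complex_of_real (1 + U \<omega>) * iexp (v * X \<omega>)) =
      (CLINT \<omega>|Q. complex_of_real (1 + U' \<omega>) * iexp (v * Y \<omega>))" for v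
      using i intP[of "\<lambda>\<omega>. complex_of_real (U \<omega>)" v] intQ[of "\<lambda>\<omega>. complex_of_real (U' \<omega>)" v] U e[of v] eq1[of v]
      by (simp add: algebra_simps)
    have b: "0 \<le> 1 + U \<omega>" "1 + U \<omega> \<le> 2" "0 \<le> 1 + U' \<omega>'" "1 + U' \<omega>' \<le> 2" for \<omega> \<omega>'
      using U(1)[of \<omega>] U(2)[of \<omega>'] by linarith+
    have 1: "(\<integral>\<omega>. (1 + U \<omega>) * indicator B (X \<omega>) \<partial>P) = (\<integral>\<omega>. (1 + U' \<omega>) * indicator B (Y \<omega>) \<partial>Q)"
      by (rule finite_weight_uniqueness) (use assms b e1 in auto)
    have 2: "(\<integral>\<omega>. (1::real) * indicator B (X \<omega>) \<partial>P) = (\<integral>\<omega>. 1 * indicator B (Y \<omega>) \<partial>Q)"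
      by (rule finite_weight_uniqueness[where g = "\<lambda>_. 1" and h = "\<lambda>_. 1"]) (use assms eq1 in auto)
    have j: "integrable P (\<lambda>\<omega>. indicator B (X \<omega>) :: real)" "integrable Q (\<lambda>\<omega>. indicator B (Y \<omega>) :: real)"
      "integrable P (\<lambda>\<omega>. U \<omega> * indicator B (X \<omega>))" "integrable Q (\<lambda>\<omega>. U' \<omega> * indicator B (Y \<omega>))"
      using U by (auto intro!: P.integrable_const_bound[where B=1] Q.integrable_const_bound[where B=1]
          simp: abs_mult split: split_indicator)
    show ?thesis using 1 2 j by (simp add: algebra_simps)
  qed
  have re: "(\<integral>\<omega>. Re (Z \<omega>) * indicator B (X \<omega>) \<partial>P) = (\<integral>\<omega>. Re (Z' \<omega>) * indicator B (Y \<omega>) \<partial>Q)"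
  proof (rule real)
    show "\<bar>Re (Z \<omega>)\<bar> \<le> 1" "\<bar>Re (Z' \<omega>')\<bar> \<le> 1" for \<omega> \<omega>'
      using abs_Re_le_cmod order_trans Z by blast+
    have r: "complex_of_real (Re z) * y = (z * y + cnj z * y) / 2" for z y
      by (simp add: complex_add_cnj distrib_right[symmetric])
    show "(CLINT \<omega>|P. complex_of_real (Re (Z \<omega>)) * iexp (v * X \<omega>)) =
      (CLINT \<omega>|Q. complex_of_real (Re (Z' \<omega>)) * iexp (v * Y \<omega>))" for v
      unfolding r using intP[of Z v] intP[of "\<lambda>\<omega>. cnj (Z \<omega>)" v] intQ[of Z' v] intQ[of "\<lambda>\<omega>. cnj (Z' \<omega>)" v]
        eq[of v] eqc[of v] Z cZ by simp
  qed auto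
  have im: "(\<integral>\<omega>. Im (Z \<omega>) * indicator B (X \<omega>) \<partial>P) = (\<integral>\<omega>. Im (Z' \<omega>) * indicator B (Y \<omega>) \<partial>Q)"
  proof (rule real)
    show "\<bar>Im (Z \<omega>)\<bar> \<le> 1" "\<bar>Im (Z' \<omega>')\<bar> \<le> 1" for \<omega> \<omega>'
      using abs_Im_le_cmod order_trans Z by blast+
    have r: "complex_of_real (Im z) * y = (z * y - cnj z * y) / (2 * \<i>)" for z y
    proof -
      have "z * y - cnj z * y = (2 * \<i>) * (complex_of_real (Im z) * y)"
        unfolding left_diff_distrib[symmetric] complex_diff_cnj by (simp only: mult_ac of_real_mult of_real_numeral)
      then show ?thesis by simp
    qed
    show "(CLINT \<omega>|P. complex_of_real (Im (Z \<omega>)) * iexp (v * X \<omega>)) =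
      (CLINT \<omega>|Q. complex_of_real (Im (Z' \<omega>)) * iexp (v * Y \<omega>))" for v
      unfolding r using intP[of Z v] intP[of "\<lambda>\<omega>. cnj (Z \<omega>)" v] intQ[of Z' v] intQ[of "\<lambda>\<omega>. cnj (Z' \<omega>)" v]
        eq[of v] eqc[of v] Z cZ by simp
  qed auto
  have "integrable P (\<lambda>\<omega>. Z \<omega> * indicator B (X \<omega>))" "integrable Q (\<lambda>\<omega>. Z' \<omega> * indicator B (Y \<omega>))"
    using Z by (auto intro!: P.integrable_const_bound[where B=1] Q.integrable_const_bound[where B=1]
        simp: norm_mult split: split_indicator)
  moreover have "Re (z * indicator B x) = Re z * indicator B x" "Im (z * indicator B x) = Im z * indicator B x"
    for z and x :: real by (auto split: split_indicator)
  ultimately show ?thesis using re im by (intro complex_eqI) (simp_all flip: integral_Re integral_Im)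
qed

text \<open>The coordinates are treated one at a time: once the indicators of some of them are paired
  with a character in the others, the one-dimensional uniqueness theorem trades a further
  character for an indicator.\<close>

lemma joint_char_uniqueness:
  fixes P :: "'v measure" and Q :: "'w measure" and X :: "'i \<Rightarrow> 'v \<Rightarrow> real"
  assumes "prob_space P" "prob_space Q" and J: "finite J"
    and X: "\<And>i. i \<in> J \<Longrightarrow> X i \<in> borel_measurable P"
    and Y: "\<And>i. i \<in> J \<Longrightarrow> Y i \<in> borel_measurable Q"
    and eq: "\<And>u. (CLINT \<omega>|P. iexp (\<Sum>i\<in>J. u i * X i \<omega>)) = (CLINT \<omega>|Q. iexp (\<Sum>i\<in>J. u i * Y i \<omega>))"
  shows "distr P (PiM J (\<lambda>_. borel)) (\<lambda>\<omega>. \<lambda>i\<in>J. X i \<omega>) =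
    distr Q (PiM J (\<lambda>_. borel)) (\<lambda>\<omega>. \<lambda>i\<in>J. Y i \<omega>)"
proof -
  interpret P: prob_space P by fact
  interpret Q: prob_space Q by fact
  note [measurable] = X Y
  have mX: "(\<lambda>\<omega>. \<lambda>i\<in>J. X i \<omega>) \<in> measurable P (PiM J (\<lambda>_. borel))"
    and mY: "(\<lambda>\<omega>. \<lambda>i\<in>J. Y i \<omega>) \<in> measurable Q (PiM J (\<lambda>_. borel))"
    by (auto intro!: measurable_restrict X Y)
  have key: "(CLINT \<omega>|P. (\<Prod>i\<in>S. indicator (B i) (X i \<omega>)) * iexp (\<Sum>i\<in>J-S. u i * X i \<omega>)) =
      (CLINT \<omega>|Q. (\<Prod>i\<in>S. indicator (B i) (Y i \<omega>)) * iexp (\<Sum>i\<in>J-S. u i * Y i \<omega>))"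
    if S: "finite S" "S \<subseteq> J" and B: "\<And>i. i \<in> J \<Longrightarrow> B i \<in> sets borel" for S B u
    using S
  proof (induction S arbitrary: u rule: finite_induct)
    case empty
    then show ?case using eq[of u] by simp
  next
    case (insert k S)
    note [measurable] = B
    have J': "J - S = insert k (J - insert k S)" "k \<notin> J - insert k S" "finite (J - insert k S)"
      using insert.prems insert.hyps J by auto
    have kJ: "k \<in> J" "S \<subseteq> J" using insert.prems by auto
    \<comment> \<open>\<open>f\<close> gathers the indicators already inserted and the characters
      still left; it is the bounded complex weight against which the coordinate k is
      exchanged.\<close>
    define f :: "('i \<Rightarrow> real) \<Rightarrow> complex" where
      "f x = (\<Prod>i\<in>S. indicator (B i) (x i)) * iexp (\<Sum>i\<in>J - insert k S. u i * x i)" for x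
    have fb: "norm (f x) \<le> 1" for x
      unfolding f_def by (simp add: norm_mult prod_le_1 flip: prod_norm split: split_indicator)
    have "(CLINT \<omega>|P. f (\<lambda>i. X i \<omega>) * indicator (B k) (X k \<omega>)) =
      (CLINT \<omega>|Q. f (\<lambda>i. Y i \<omega>) * indicator (B k) (Y k \<omega>))"
    proof (rule complex_weight_uniqueness)
      show "(\<lambda>\<omega>. f (\<lambda>i. X i \<omega>)) \<in> borel_measurable P" "(\<lambda>\<omega>. f (\<lambda>i. Y i \<omega>)) \<in> borel_measurable Q"
        unfolding f_def using kJ(2)
        by (auto intro!: borel_measurable_times borel_measurable_prod borel_measurable_sum measurable_compose[OF _ borel_measurable_indicator]
             measurable_compose[OF _ borel_measurable_exp] borel_measurable_of_real X Y B simp: subset_iff)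
      show "(CLINT \<omega>|P. iexp (v * X k \<omega>)) = (CLINT \<omega>|Q. iexp (v * Y k \<omega>))" for v
      proof -
        have "(\<Sum>i\<in>J. (if i = k then v else 0) * x i) = v * x k" for x
          using J kJ by (simp add: if_distrib[of "\<lambda>a. a * _"] sum.delta cong: if_cong)
        then show ?thesis using eq[of "\<lambda>i. if i = k then v else 0"] by simp
      qed
      show "(CLINT \<omega>|P. f (\<lambda>i. X i \<omega>) * iexp (v * X k \<omega>)) =
          (CLINT \<omega>|Q. f (\<lambda>i. Y i \<omega>) * iexp (v * Y k \<omega>))" for v
      proof -
        \<comment> \<open>The set J - S still contains k, so the induction hypothesis at
          \<open>u(k := v)\<close> leaves the frequency v at k free.\<close>
        have s: "(\<Sum>i\<in>J - S. (u(k := v)) i * x i) = v * x k + (\<Sum>i\<in>J - insert k S. u i * x i)" for x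
          unfolding J'(1) using J'(2,3) by (subst sum.insert) (auto intro!: sum.cong)
        show ?thesis using insert.IH[of "u(k := v)"] kJ
          unfolding s f_def by (simp add: exp_add distrib_left mult_ac)
      qed
    qed (use assms kJ B fb in auto)
    then show ?case
      using insert.hyps by (simp add: f_def mult_ac)
  qed
  show ?thesis
  proof (rule measure_eqI_PiM_finite[OF J, where A = "\<lambda>_. Pi\<^sub>E J (\<lambda>_. UNIV)"])
    fix B :: "'i \<Rightarrow> real set" assume B: "\<And>i. i \<in> J \<Longrightarrow> B i \<in> sets borel"
    have box: "emeasure (distr R (PiM J (\<lambda>_. borel)) (\<lambda>\<omega>. \<lambda>i\<in>J. Z i \<omega>)) (Pi\<^sub>E J B) =
      ennreal (Re (CLINT \<omega>|R. (\<Prod>i\<in>J. indicator (B i) (Z i \<omega>))))"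
      if "prob_space R" and m: "(\<lambda>\<omega>. \<lambda>i\<in>J. Z i \<omega>) \<in> measurable R (PiM J (\<lambda>_. borel))" for R :: "'x measure" and Z
    proof -
      interpret R: prob_space R by fact
      let ?S = "(\<lambda>\<omega>. \<lambda>i\<in>J. Z i \<omega>) -` Pi\<^sub>E J B \<inter> space R"
      have S: "?S \<in> sets R" by (rule measurable_sets[OF m]) (use B J in \<open>auto intro!: sets_PiM_I_finite\<close>)
      have "(CLINT \<omega>|R. (\<Prod>i\<in>J. indicator (B i) (Z i \<omega>))) = (CLINT \<omega>|R. complex_of_real (indicator ?S \<omega>))"
        using J by (intro Bochner_Integration.integral_cong) (auto simp: indicator_def prod_zero_iff PiE_iff split: if_splits)
      also have "\<dots> = complex_of_real (measure R ?S)" 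
        using S integral_complex_of_real[of R "indicator ?S"] by (simp add: of_real_indicator)
      finally show ?thesis
        using B J by (subst emeasure_distr[OF m]) (auto intro!: sets_PiM_I_finite simp: R.emeasure_eq_measure)
    qed
    show "emeasure (distr P (PiM J (\<lambda>_. borel)) (\<lambda>\<omega>. \<lambda>i\<in>J. X i \<omega>)) (Pi\<^sub>E J B) =
       emeasure (distr Q (PiM J (\<lambda>_. borel)) (\<lambda>\<omega>. \<lambda>i\<in>J. Y i \<omega>)) (Pi\<^sub>E J B)"
      unfolding box[OF assms(1) mX] box[OF assms(2) mY] using key[of J B] J B by simp
  next
    show "range (\<lambda>_::nat. Pi\<^sub>E J (\<lambda>_. UNIV :: real set)) \<subseteq> prod_algebra J (\<lambda>_. borel)"
      using J by (auto intro!: prod_algebraI_finite)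
    show "emeasure (distr P (PiM J (\<lambda>_. borel)) (\<lambda>\<omega>. \<lambda>i\<in>J. X i \<omega>)) (Pi\<^sub>E J (\<lambda>_. UNIV)) \<noteq> \<infinity>"
      using mX by (subst emeasure_distr) (auto intro!: sets_PiM_I_finite J)
  qed (auto simp: space_PiM)
qed

section \<open>Fast subsequences and almost everywhere summability\<close>

lemma Cauchy_fast_subseq:
  fixes D :: "nat \<Rightarrow> nat \<Rightarrow> real"
  assumes "\<And>e. e > 0 \<Longrightarrow> \<exists>N. \<forall>m\<ge>N. \<forall>n\<ge>N. D m n < e"
  obtains r where "strict_mono r" "\<And>k m n. r k \<le> m \<Longrightarrow> r k \<le> n \<Longrightarrow> D m n < (1/2) ^ k"
proof -
  have "\<exists>N. \<forall>m\<ge>N. \<forall>n\<ge>N. D m n < (1/2) ^ k" for k :: nat by (rule assms) simp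
  then obtain N where N: "\<And>k m n. N k \<le> m \<Longrightarrow> N k \<le> n \<Longrightarrow> D m n < (1/2) ^ k" by metis
  \<comment> \<open>Adding up the thresholds keeps r above each \<open>N k\<close>, and the summand
    k makes it strictly increasing.\<close>
  define r where "r k = (\<Sum>i\<le>k. N i) + k" for k
  have "strict_mono r" unfolding strict_mono_Suc_iff r_def by simp
  moreover have "N k \<le> r k" for k unfolding r_def by (simp add: member_le_sum trans_le_add1)
  ultimately show ?thesis using that N order_trans by metis
qed

lemma squeeze_zero:
  fixes f g :: "nat \<Rightarrow> real"
  assumes "\<And>n. 0 \<le> f n" "\<And>n. f n \<le> g n" "g \<longlonglongrightarrow> 0"
  shows "f \<longlonglongrightarrow> 0"
  by (rule tendsto_sandwich[OF _ _ tendsto_const assms(3)]) (simp_all add: assms)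

text \<open>By Tonelli the series has a finite integral, so it is finite almost everywhere. Both
  completeness proofs below use this in place of the Borel-Cantelli lemma.\<close>

lemma AE_summable_integral:
  fixes u :: "nat \<Rightarrow> 'a \<Rightarrow> real"
  assumes int: "\<And>k. integrable M (u k)" and nn: "\<And>k x. 0 \<le> u k x"
    and sum: "summable (\<lambda>k. \<integral>x. u k x \<partial>M)"
  shows "AE x in M. summable (\<lambda>k. u k x)"
proof -
  note [measurable] = borel_measurable_integrable[OF int]
  have "(\<integral>\<^sup>+x. (\<Sum>k. ennreal (u k x)) \<partial>M) = (\<Sum>k. \<integral>\<^sup>+x. ennreal (u k x) \<partial>M)"
    by (rule nn_integral_suminf) simp
  also have "\<dots> = (\<Sum>k. ennreal (\<integral>x. u k x \<partial>M))"
    using int nn by (simp add: nn_integral_eq_integral)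
  also have "\<dots> < \<infinity>" using sum nn by (simp add: suminf_ennreal2)
  finally have "AE x in M. (\<Sum>k. ennreal (u k x)) \<noteq> \<infinity>"
    by (intro nn_integral_PInf_AE) auto
  then show ?thesis
    by eventually_elim (use nn in \<open>auto intro!: summable_suminf_not_top\<close>)
qed

section \<open>Convergence in probability\<close>

context prob_space
begin

lemma integrable_min_1:
  assumes [measurable]: "X \<in> borel_measurable M"
  shows "integrable M (\<lambda>\<omega>. min 1 \<bar>X \<omega>\<bar> :: real)"
  by (rule integrable_const_bound[where B=1]) auto

text \<open>The truncated mean distance metrises convergence in probability; it turns limits, Cauchy
  sequences and uniqueness into statements about integrals.\<close>

lemma tendsto_in_prob_iff:
  assumes [measurable]: "\<And>n. X n \<in> borel_measurable M" "Y \<in> borel_measurable M"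
  shows "tendsto_in_prob M X Y \<longleftrightarrow> (\<lambda>n. \<integral>\<omega>. min 1 \<bar>X n \<omega> - Y \<omega>\<bar> \<partial>M) \<longlonglongrightarrow> 0"
proof
  let ?E = "\<lambda>n. \<integral>\<omega>. min 1 \<bar>X n \<omega> - Y \<omega>\<bar> \<partial>M"
  have nn: "?E n \<ge> 0" for n by (rule integral_nonneg_AE) auto
  assume L: "tendsto_in_prob M X Y"
  show "?E \<longlonglongrightarrow> 0"
  proof (rule LIMSEQ_I)
    fix e :: real assume e: "e > 0"
    let ?A = "\<lambda>n. {\<omega>\<in>space M. \<bar>X n \<omega> - Y \<omega>\<bar> > e/2}"
    have "(\<lambda>n. prob (?A n)) \<longlonglongrightarrow> 0" using L e unfolding tendsto_in_prob_def by (auto dest!: spec[of _ "e/2"])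
    from LIMSEQ_D[OF this, of "e/2"] e obtain N where N: "\<And>n. n \<ge> N \<Longrightarrow> prob (?A n) < e/2" by auto
    have "?E n < e" if "n \<ge> N" for n
    proof -
      have "?E n \<le> (\<integral>\<omega>. e/2 + indicator (?A n) \<omega> \<partial>M)"
        using e by (intro integral_mono integrable_min_1) (auto simp: less_top[symmetric] min_def split: split_indicator)
      also have "\<dots> = e/2 + prob (?A n)"
        by (subst Bochner_Integration.integral_add) (auto simp: prob_space less_top[symmetric])
      finally show ?thesis using N[OF that] by simp
    qed
    then show "\<exists>N. \<forall>n\<ge>N. norm (?E n - 0) < e" using nn by auto
  qed
next
  let ?E = "\<lambda>n. \<integral>\<omega>. min 1 \<bar>X n \<omega> - Y \<omega>\<bar> \<partial>M"
  assume L: "?E \<longlonglongrightarrow> 0"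
  show "tendsto_in_prob M X Y"
    unfolding tendsto_in_prob_def
  proof (intro allI impI)
    fix e :: real assume e: "e > 0"
    let ?A = "\<lambda>n. {\<omega>\<in>space M. \<bar>X n \<omega> - Y \<omega>\<bar> > e}"
    \<comment> \<open>Markov's inequality for the truncated difference, which is at least
      \<open>min 1 e\<close> on the event.\<close>
    have "prob (?A n) \<le> ?E n / min 1 e" for n
    proof -
      have "(\<integral>\<omega>. min 1 e * indicator (?A n) \<omega> \<partial>M) \<le> ?E n"
        using e by (intro integral_mono integrable_min_1) (auto simp: less_top[symmetric] split: split_indicator)
      then show ?thesis using e by (simp add: field_simps)
    qed
    moreover have "(\<lambda>n. ?E n / min 1 e) \<longlonglongrightarrow> 0" using tendsto_divide[OF L tendsto_const[of "min 1 e"]] e by simp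
    ultimately show "(\<lambda>n. prob (?A n)) \<longlonglongrightarrow> 0"
      by (rule squeeze_zero[rotated]) simp
  qed
qed

lemma tendsto_in_prob_lincomb:
  assumes [measurable]: "\<And>n. X n \<in> borel_measurable M" "X' \<in> borel_measurable M"
      "\<And>n. Y n \<in> borel_measurable M" "Y' \<in> borel_measurable M"
    and L: "tendsto_in_prob M X X'" "tendsto_in_prob M Y Y'"
  shows "tendsto_in_prob M (\<lambda>n \<omega>. a * X n \<omega> + b * Y n \<omega>) (\<lambda>\<omega>. a * X' \<omega> + b * Y' \<omega>)"
proof -
  let ?E = "\<lambda>X Y. \<integral>\<omega>. min 1 \<bar>X \<omega> - Y \<omega>\<bar> \<partial>M"
  \<comment> \<open>Truncation is not homogeneous: the factor 1 + |c| covers |c| where |x| is at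
    most 1, and the truncation level 1 elsewhere.\<close>
  have min_scale: "min 1 (\<bar>c\<bar> * \<bar>x\<bar>) \<le> (1 + \<bar>c\<bar>) * min 1 \<bar>x\<bar>" for c x :: real
  proof (cases "\<bar>x\<bar> \<le> 1")
    case True
    then show ?thesis by (auto simp: min_def algebra_simps)
  qed (auto simp: min_def)
  have "min 1 \<bar>a * x + b * y\<bar> \<le> (1 + \<bar>a\<bar>) * min 1 \<bar>x\<bar> + (1 + \<bar>b\<bar>) * min 1 \<bar>y\<bar>" for x y
  proof -
    have "min 1 \<bar>a * x + b * y\<bar> \<le> min 1 (\<bar>a\<bar> * \<bar>x\<bar>) + min 1 (\<bar>b\<bar> * \<bar>y\<bar>)"
    proof -
      have "min 1 t \<le> min 1 p + min 1 q" if "t \<le> p + q" "0 \<le> p" "0 \<le> q" for t p q :: real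
        using that by (auto simp: min_def)
      moreover have "\<bar>a * x + b * y\<bar> \<le> \<bar>a\<bar> * \<bar>x\<bar> + \<bar>b\<bar> * \<bar>y\<bar>"
        using abs_triangle_ineq[of "a * x" "b * y"] by (simp only: abs_mult)
      ultimately show ?thesis by (simp only: mult_nonneg_nonneg abs_ge_zero)
    qed
    also have "\<dots> \<le> (1 + \<bar>a\<bar>) * min 1 \<bar>x\<bar> + (1 + \<bar>b\<bar>) * min 1 \<bar>y\<bar>"
      by (intro add_mono min_scale)
    finally show ?thesis .
  qed
  from this[of "X n \<omega> - X' \<omega>" "Y n \<omega> - Y' \<omega>" for n \<omega>]
  have pt: "min 1 \<bar>a * X n \<omega> + b * Y n \<omega> - (a * X' \<omega> + b * Y' \<omega>)\<bar> \<le>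
      (1 + \<bar>a\<bar>) * min 1 \<bar>X n \<omega> - X' \<omega>\<bar> + (1 + \<bar>b\<bar>) * min 1 \<bar>Y n \<omega> - Y' \<omega>\<bar>" for n \<omega>
    by (simp add: algebra_simps)
  have "(\<integral>\<omega>. min 1 \<bar>a * X n \<omega> + b * Y n \<omega> - (a * X' \<omega> + b * Y' \<omega>)\<bar> \<partial>M) \<le>
      (1 + \<bar>a\<bar>) * ?E (X n) X' + (1 + \<bar>b\<bar>) * ?E (Y n) Y'" for n
  proof -
    have "(\<integral>\<omega>. min 1 \<bar>a * X n \<omega> + b * Y n \<omega> - (a * X' \<omega> + b * Y' \<omega>)\<bar> \<partial>M) \<le>
      (\<integral>\<omega>. (1 + \<bar>a\<bar>) * min 1 \<bar>X n \<omega> - X' \<omega>\<bar> + (1 + \<bar>b\<bar>) * min 1 \<bar>Y n \<omega> - Y' \<omega>\<bar> \<partial>M)"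
      by (intro integral_mono pt integrable_min_1 Bochner_Integration.integrable_add integrable_mult_right) auto
    then show ?thesis by (simp add: integrable_min_1)
  qed
  moreover have "(\<lambda>n. (1 + \<bar>a\<bar>) * ?E (X n) X' + (1 + \<bar>b\<bar>) * ?E (Y n) Y') \<longlonglongrightarrow> 0"
    using L by (auto simp: tendsto_in_prob_iff intro!: tendsto_add_zero tendsto_mult_right_zero)
  ultimately have "(\<lambda>n. \<integral>\<omega>. min 1 \<bar>a * X n \<omega> + b * Y n \<omega> - (a * X' \<omega> + b * Y' \<omega>)\<bar> \<partial>M) \<longlonglongrightarrow> 0"
    by (rule squeeze_zero[rotated]) (rule Bochner_Integration.integral_nonneg, simp)
  then show ?thesis by (subst tendsto_in_prob_iff) auto
qed

lemma tendsto_in_prob_cong: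
  assumes [measurable]: "\<And>n. X n \<in> borel_measurable M" "\<And>n. X' n \<in> borel_measurable M" "Y \<in> borel_measurable M"
    and "\<And>n. AE \<omega> in M. X n \<omega> = X' n \<omega>" "tendsto_in_prob M X Y"
  shows "tendsto_in_prob M X' Y"
proof -
  have "(\<integral>\<omega>. min 1 \<bar>X n \<omega> - Y \<omega>\<bar> \<partial>M) = (\<integral>\<omega>. min 1 \<bar>X' n \<omega> - Y \<omega>\<bar> \<partial>M)" for n
    by (intro integral_cong_AE) (use assms(4)[of n] in auto)
  then show ?thesis using assms(5) by (simp add: tendsto_in_prob_iff)
qed

lemma tendsto_in_prob_unique:
  assumes [measurable]: "\<And>n. X n \<in> borel_measurable M" "Y \<in> borel_measurable M" "Z \<in> borel_measurable M"
    and L: "tendsto_in_prob M X Y" "tendsto_in_prob M X Z"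
  shows "AE \<omega> in M. Y \<omega> = Z \<omega>"
proof -
  have "tendsto_in_prob M (\<lambda>n \<omega>. 1 * X n \<omega> + (-1) * X n \<omega>) (\<lambda>\<omega>. 1 * Y \<omega> + (-1) * Z \<omega>)"
    by (rule tendsto_in_prob_lincomb) (use L in auto)
  then have "(\<lambda>n::nat. \<integral>\<omega>. min 1 \<bar>Y \<omega> - Z \<omega>\<bar> \<partial>M) \<longlonglongrightarrow> 0"
    by (subst (asm) tendsto_in_prob_iff) (auto simp: abs_minus_commute)
  then have "(\<integral>\<omega>. min 1 \<bar>Y \<omega> - Z \<omega>\<bar> \<partial>M) = 0" by (simp add: LIMSEQ_const_iff)
  then have "AE \<omega> in M. min 1 \<bar>Y \<omega> - Z \<omega>\<bar> = 0"
    by (subst (asm) integral_nonneg_eq_0_iff_AE) (auto intro: integrable_min_1)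
  then show ?thesis by eventually_elim (auto simp: min_def split: if_splits)
qed

lemma tendsto_in_prob_char:
  assumes [measurable]: "\<And>n. X n \<in> borel_measurable M" "Y \<in> borel_measurable M"
    and L: "tendsto_in_prob M X Y"
  shows "(\<lambda>n. CLINT \<omega>|M. iexp (u * X n \<omega>)) \<longlonglongrightarrow> (CLINT \<omega>|M. iexp (u * Y \<omega>))"
proof -
  have ie: "norm (iexp x - iexp y) \<le> \<bar>x - y\<bar>" for x y :: real
  proof -
    have "norm (iexp x - iexp y) = norm (iexp (x - y) - 1)"
    proof -
      have "iexp x - iexp y = iexp y * (iexp (x - y) - 1)"
        by (simp add: algebra_simps exp_diff)
      then show ?thesis by (simp only: norm_mult norm_exp_i_times mult_1)
    qed
    also have "\<dots> \<le> \<bar>x - y\<bar>" using iexp_approx1[of "x - y" 0] by simp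
    finally show ?thesis .
  qed
  \<comment> \<open>The factor covers two regimes: the Lipschitz constant |u| where |x - y| is at
    most 1, and the trivial bound 2 elsewhere.\<close>
  have pt: "norm (iexp (u * x) - iexp (u * y)) \<le> (2 + \<bar>u\<bar>) * min 1 \<bar>x - y\<bar>" for x y
  proof (cases "\<bar>x - y\<bar> \<le> 1")
    case True
    have "norm (iexp (u * x) - iexp (u * y)) \<le> \<bar>u * x - u * y\<bar>" by (rule ie)
    also have "\<dots> = \<bar>u\<bar> * \<bar>x - y\<bar>" by (simp add: abs_mult flip: right_diff_distrib)
    also have "\<dots> \<le> (2 + \<bar>u\<bar>) * \<bar>x - y\<bar>" by (intro mult_right_mono) auto
    finally show ?thesis using True by simp
  next
    case False
    have "norm (iexp (u * x) - iexp (u * y)) \<le> 2"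
      using norm_triangle_ineq4[of "iexp (u * x)" "iexp (u * y)"] by simp
    then show ?thesis using False by simp
  qed
  have i: "integrable M (\<lambda>\<omega>. iexp (u * Z \<omega>))" if "Z \<in> borel_measurable M" for Z
    using integrable_bounded_iexp[of "\<lambda>_. 1" "\<lambda>\<omega>. u * Z \<omega>"] that by simp
  have bound: "norm ((CLINT \<omega>|M. iexp (u * X n \<omega>)) - (CLINT \<omega>|M. iexp (u * Y \<omega>))) \<le>
     (2 + \<bar>u\<bar>) * (\<integral>\<omega>. min 1 \<bar>X n \<omega> - Y \<omega>\<bar> \<partial>M)" for n
  proof -
    have "(CLINT \<omega>|M. iexp (u * X n \<omega>)) - (CLINT \<omega>|M. iexp (u * Y \<omega>)) =
      (CLINT \<omega>|M. iexp (u * X n \<omega>) - iexp (u * Y \<omega>))" by (simp only: Bochner_Integration.integral_diff i assms)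
    also have "norm \<dots> \<le> (\<integral>\<omega>. norm (iexp (u * X n \<omega>) - iexp (u * Y \<omega>)) \<partial>M)"
      by (rule integral_norm_bound)
    also have "\<dots> \<le> (\<integral>\<omega>. (2 + \<bar>u\<bar>) * min 1 \<bar>X n \<omega> - Y \<omega>\<bar> \<partial>M)"
      by (intro integral_mono integrable_norm Bochner_Integration.integrable_diff i pt integrable_mult_right integrable_min_1) auto
    finally show ?thesis by simp
  qed
  have lim: "(\<lambda>n. (2 + \<bar>u\<bar>) * (\<integral>\<omega>. min 1 \<bar>X n \<omega> - Y \<omega>\<bar> \<partial>M)) \<longlonglongrightarrow> 0"
    using L by (auto simp: tendsto_in_prob_iff intro!: tendsto_mult_right_zero)
  show ?thesis
    by (rule LIM_zero_cancel, rule Lim_null_comparison[OF always_eventually[OF allI] lim], rule bound)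
qed

text \<open>A rapidly Cauchy subsequence has summable increments almost surely and so converges
  pointwise; dominated convergence along it bounds the distance of each member of the full sequence
  to that limit.\<close>

lemma tendsto_in_prob_complete:
  assumes [measurable]: "\<And>n. X n \<in> borel_measurable M"
    and Cauchy: "\<And>e. e > 0 \<Longrightarrow> \<exists>N. \<forall>m\<ge>N. \<forall>n\<ge>N. (\<integral>\<omega>. min 1 \<bar>X m \<omega> - X n \<omega>\<bar> \<partial>M) < e"
  shows "\<exists>Y. Y \<in> borel_measurable M \<and> tendsto_in_prob M X Y"
proof -
  let ?E = "\<lambda>X Y. \<integral>\<omega>. min 1 \<bar>X \<omega> - Y \<omega>\<bar> \<partial>M"
  obtain r where r: "strict_mono r" "\<And>k m n. r k \<le> m \<Longrightarrow> r k \<le> n \<Longrightarrow> ?E (X m) (X n) < (1/2) ^ k"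
    using Cauchy_fast_subseq[of "\<lambda>m n. ?E (X m) (X n)", OF Cauchy] by blast
  have "AE \<omega> in M. summable (\<lambda>k. min 1 \<bar>X (r (Suc k)) \<omega> - X (r k) \<omega>\<bar>)"
  proof (rule AE_summable_integral)
    show "summable (\<lambda>k. ?E (X (r (Suc k))) (X (r k)))"
      by (rule summable_comparison_test'[OF summable_geometric, of "1/2" 0])
         (use r(2)[of n "r (Suc n)" "r n" for n] strict_monoD[OF r(1)] in
           \<open>auto intro!: less_imp_le abs_leI simp: integral_nonneg_AE abs_of_nonneg\<close>)
  qed (auto intro: integrable_min_1)
  then have conv: "AE \<omega> in M. convergent (\<lambda>k. X (r k) \<omega>)"
  proof eventually_elim
    case (elim \<omega>)
    \<comment> \<open>Summable terms tend to 0, so the truncation is eventually inactive and the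
      increments themselves are summable.\<close>
    have "eventually (\<lambda>k. min 1 \<bar>X (r (Suc k)) \<omega> - X (r k) \<omega>\<bar> < 1) sequentially"
      using summable_LIMSEQ_zero[OF elim] by (rule order_tendstoD) simp
    then have "eventually (\<lambda>k. norm (X (r (Suc k)) \<omega> - X (r k) \<omega>) \<le> min 1 \<bar>X (r (Suc k)) \<omega> - X (r k) \<omega>\<bar>) sequentially"
      by eventually_elim auto
    from summable_comparison_test_ev[OF this elim]
    have "summable (\<lambda>k. X (r (Suc k)) \<omega> - X (r k) \<omega>)" .
    then have "convergent (\<lambda>n. \<Sum>k<n. X (r (Suc k)) \<omega> - X (r k) \<omega>)" by (simp add: summable_iff_convergent)
    then have "convergent (\<lambda>n. X (r n) \<omega> - X (r 0) \<omega>)" by (simp only: sum_lessThan_telescope[of "\<lambda>k. X (r k) \<omega>"])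
    from convergent_add[OF this convergent_const[of "X (r 0) \<omega>"]] show ?case by simp
  qed
  define Y where "Y \<omega> = lim (\<lambda>k. X (r k) \<omega>)" for \<omega>
  have [measurable]: "Y \<in> borel_measurable M" unfolding Y_def by measurable
  have sub: "(\<lambda>k. ?E (X m) (X (r k))) \<longlonglongrightarrow> ?E (X m) Y" for m
  proof (rule integral_dominated_convergence[where w = "\<lambda>_. 1"])
    show "AE \<omega> in M. (\<lambda>k. min 1 \<bar>X m \<omega> - X (r k) \<omega>\<bar>) \<longlonglongrightarrow> min 1 \<bar>X m \<omega> - Y \<omega>\<bar>"
      using conv by eventually_elim (auto simp: Y_def convergent_LIMSEQ_iff intro!: tendsto_intros)
  qed auto
  have "?E (X m) Y \<le> (1/2)^k" if "m \<ge> r k" for m k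
  proof (rule LIMSEQ_le_const2[OF sub])
    show "\<exists>N. \<forall>n\<ge>N. ?E (X m) (X (r n)) \<le> (1/2)^k"
      using r(2)[OF that] strict_mono_mono[OF r(1)] by (auto intro!: exI[of _ k] less_imp_le simp: mono_def)
  qed
  have "(\<lambda>m. ?E (X m) Y) \<longlonglongrightarrow> 0"
  proof (rule LIMSEQ_I)
    fix e :: real assume "e > 0"
    then obtain k where k: "(1/2)^k < e" using real_arch_pow_inv[of e "1/2"] by auto
    have "norm (?E (X m) Y - 0) < e" if "m \<ge> r k" for m
      using \<open>\<And>m k. m \<ge> r k \<Longrightarrow> ?E (X m) Y \<le> (1/2)^k\<close>[OF that] k by (simp add: integral_nonneg_AE abs_of_nonneg)
    then show "\<exists>N. \<forall>m\<ge>N. norm (?E (X m) Y - 0) < e" by blast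
  qed
  then show ?thesis by (intro exI[of _ Y]) (simp add: tendsto_in_prob_iff)
qed

text \<open>Convergence in law to a constant is convergence in probability: by Levy's continuity
  theorem the laws converge weakly to the point mass at 0, whose distribution function is continuous
  away from 0, and the distribution functions at e and -e bound the probability of a deviation
  beyond e.\<close>

lemma tendsto_in_prob_0_of_char:
  assumes [measurable]: "\<And>n. X n \<in> borel_measurable M"
    and L: "\<And>u. (\<lambda>n. CLINT \<omega>|M. iexp (u * X n \<omega>)) \<longlonglongrightarrow> 1"
  shows "tendsto_in_prob M X (\<lambda>_. 0)"
  unfolding tendsto_in_prob_def
proof (intro allI impI)
  fix e :: real assume e: "e > 0"
  let ?N = "\<lambda>n. distr M borel (X n)" and ?D = "return borel (0::real)"
  interpret N: real_distribution "?N n" for n by (rule real_distribution_distr) simp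
  interpret D: real_distribution ?D
    by (intro real_distribution.intro real_distribution_axioms.intro prob_space_return) auto
  have "weak_conv_m ?N ?D"
  proof (rule levy_continuity)
    show "(\<lambda>n. char (?N n) t) \<longlonglongrightarrow> char ?D t" for t
    proof -
      have "char ?D t = 1" by (simp add: char_def integral_return)
      moreover have "char (?N n) t = (CLINT \<omega>|M. iexp (t * X n \<omega>))" for n
        by (simp add: char_def integral_distr)
      ultimately show ?thesis using L[of t] by simp
    qed
  qed unfold_locales
  have cdfD: "cdf ?D x = (if 0 \<le> x then 1 else 0)" for x by (simp add: cdf_def measure_return)
  have lim: "(\<lambda>n. cdf (?N n) x) \<longlonglongrightarrow> cdf ?D x" if "x \<noteq> 0" for x
  proof -
    have "isCont (cdf ?D) x"
    proof (rule iffD2[OF isCont_cong[where g = "\<lambda>_. cdf ?D x"]])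
      have "eventually (\<lambda>y. y \<in> (if x > 0 then {0<..} else {..<0})) (nhds x)"
        using that by (intro eventually_nhds_in_open) auto
      then show "\<forall>\<^sub>F y in nhds x. cdf ?D y = cdf ?D x"
        by eventually_elim (use that in \<open>auto simp: cdfD split: if_splits\<close>)
    qed simp
    then show ?thesis using \<open>weak_conv_m ?N ?D\<close> unfolding weak_conv_m_def weak_conv_def by blast
  qed
  have bound: "prob {\<omega>\<in>space M. \<bar>X n \<omega> - 0\<bar> > e} \<le> (1 - cdf (?N n) e) + cdf (?N n) (-e)" for n
  proof -
    have c: "cdf (?N n) x = prob {\<omega>\<in>space M. X n \<omega> \<le> x}" for x
      by (auto simp: cdf_def measure_distr intro!: arg_cong[where f=prob])
    have "prob {\<omega>\<in>space M. \<bar>X n \<omega> - 0\<bar> > e} \<le> prob ({\<omega>\<in>space M. X n \<omega> > e} \<union> {\<omega>\<in>space M. X n \<omega> \<le> -e})"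
      by (intro finite_measure_mono) auto
    also have "\<dots> \<le> prob {\<omega>\<in>space M. X n \<omega> > e} + prob {\<omega>\<in>space M. X n \<omega> \<le> -e}"
      by (intro measure_Un_le) auto
    also have "prob {\<omega>\<in>space M. X n \<omega> > e} = 1 - prob {\<omega>\<in>space M. X n \<omega> \<le> e}"
      by (subst prob_compl[symmetric]) (auto intro!: arg_cong[where f=prob])
    finally show ?thesis by (simp add: c)
  qed
  have "(\<lambda>n. (1 - cdf (?N n) e) + cdf (?N n) (-e)) \<longlonglongrightarrow> (1 - cdf ?D e) + cdf ?D (-e)"
    using e by (intro tendsto_intros lim) auto
  also have "(1 - cdf ?D e) + cdf ?D (-e) = 0" using e by (simp add: cdfD)
  finally show "(\<lambda>n. prob {\<omega>\<in>space M. \<bar>X n \<omega> - 0\<bar> > e}) \<longlonglongrightarrow> 0"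
    by (rule squeeze_zero[rotated 2]) (use bound in auto)
qed

end

section \<open>Stable integrals\<close>

text \<open>Passing to the larger of |x| and |y| gives a constant that works for every positive p,
  also below 1, where the p-th power is not convex.\<close>

lemma abs_lincomb_powr_le:
  fixes a b x y p :: real
  assumes "0 < p"
  shows "\<bar>a * x + b * y\<bar> powr p \<le> (\<bar>a\<bar> + \<bar>b\<bar>) powr p * (\<bar>x\<bar> powr p + \<bar>y\<bar> powr p)"
proof -
  have "\<bar>a * x + b * y\<bar> \<le> \<bar>a\<bar> * \<bar>x\<bar> + \<bar>b\<bar> * \<bar>y\<bar>"
    using abs_triangle_ineq[of "a * x" "b * y"] by (simp add: abs_mult)
  also have "\<dots> \<le> \<bar>a\<bar> * max \<bar>x\<bar> \<bar>y\<bar> + \<bar>b\<bar> * max \<bar>x\<bar> \<bar>y\<bar>"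
    by (intro add_mono mult_left_mono) auto
  finally have "\<bar>a * x + b * y\<bar> powr p \<le> ((\<bar>a\<bar> + \<bar>b\<bar>) * max \<bar>x\<bar> \<bar>y\<bar>) powr p"
    using assms by (intro powr_mono2) (auto simp: distrib_right)
  also have "\<dots> = (\<bar>a\<bar> + \<bar>b\<bar>) powr p * max \<bar>x\<bar> \<bar>y\<bar> powr p"
    by (simp add: powr_mult)
  also have "max \<bar>x\<bar> \<bar>y\<bar> powr p \<le> \<bar>x\<bar> powr p + \<bar>y\<bar> powr p"
    by (auto simp: max_def)
  finally show ?thesis by (simp add: mult_left_mono)
qed

lemma Lp_set_lincomb:
  assumes "0 < p" "f \<in> Lp_set \<nu> p" "g \<in> Lp_set \<nu> p"
  shows "(\<lambda>x. a * f x + b * g x) \<in> Lp_set \<nu> p"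
    and "(\<integral>x. \<bar>a * f x + b * g x\<bar> powr p \<partial>\<nu>) \<le>
      (\<bar>a\<bar> + \<bar>b\<bar>) powr p * ((\<integral>x. \<bar>f x\<bar> powr p \<partial>\<nu>) + (\<integral>x. \<bar>g x\<bar> powr p \<partial>\<nu>))"
proof -
  have [measurable]: "f \<in> borel_measurable \<nu>" "g \<in> borel_measurable \<nu>"
    and int: "integrable \<nu> (\<lambda>x. \<bar>f x\<bar> powr p)" "integrable \<nu> (\<lambda>x. \<bar>g x\<bar> powr p)"
    using assms by (auto simp: Lp_set_def)
  let ?c = "(\<bar>a\<bar> + \<bar>b\<bar>) powr p"
  have B: "integrable \<nu> (\<lambda>x. ?c * (\<bar>f x\<bar> powr p + \<bar>g x\<bar> powr p))" using int by auto
  have I: "integrable \<nu> (\<lambda>x. \<bar>a * f x + b * g x\<bar> powr p)"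
    by (rule Bochner_Integration.integrable_bound[OF B]) (auto simp: abs_lincomb_powr_le[OF assms(1)] abs_mult)
  then show "(\<lambda>x. a * f x + b * g x) \<in> Lp_set \<nu> p" by (simp add: Lp_set_def)
  have "(\<integral>x. \<bar>a * f x + b * g x\<bar> powr p \<partial>\<nu>) \<le> (\<integral>x. ?c * (\<bar>f x\<bar> powr p + \<bar>g x\<bar> powr p) \<partial>\<nu>)"
    by (rule integral_mono[OF I B abs_lincomb_powr_le[OF assms(1)]])
  then show "(\<integral>x. \<bar>a * f x + b * g x\<bar> powr p \<partial>\<nu>) \<le>
      ?c * ((\<integral>x. \<bar>f x\<bar> powr p \<partial>\<nu>) + (\<integral>x. \<bar>g x\<bar> powr p \<partial>\<nu>))"
    using int by simp
qed

lemma (in finite_measure) simple_function_Lp_set: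
  assumes "simple_function M f"
  shows "f \<in> Lp_set M p"
proof -
  have "finite ((\<lambda>x. \<bar>f x\<bar> powr p) ` space M)"
    using simple_functionD(1)[OF assms] by (simp add: image_image[symmetric, of "\<lambda>c. \<bar>c\<bar> powr p" f])
  then obtain B where "\<And>x. x \<in> space M \<Longrightarrow> \<bar>f x\<bar> powr p \<le> B"
    by (meson finite_has_maximal2 bdd_above_finite bdd_above.unfold image_eqI)
  then show ?thesis using assms borel_measurable_simple_function[OF assms]
    by (auto simp: Lp_set_def intro!: integrable_const_bound[where B=B])
qed

text \<open>The simple functions are dominated by a multiple of |f|, so dominated convergence gives
  both limits. The moments are recorded because the characteristic function of an integral is
  computed from them.\<close>

lemma Lp_set_simple_approx:
  assumes "0 < p" "f \<in> Lp_set \<nu> p"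
  shows "\<exists>\<phi>. (\<forall>n. simple_function \<nu> (\<phi> n)) \<and>
    (\<lambda>n. \<integral>x. \<bar>\<phi> n x - f x\<bar> powr p \<partial>\<nu>) \<longlonglongrightarrow> 0 \<and>
    (\<lambda>n. \<integral>x. \<bar>\<phi> n x\<bar> powr p \<partial>\<nu>) \<longlonglongrightarrow> (\<integral>x. \<bar>f x\<bar> powr p \<partial>\<nu>)"
proof -
  have f[measurable]: "f \<in> borel_measurable \<nu>" and int: "integrable \<nu> (\<lambda>x. \<bar>f x\<bar> powr p)"
    using assms by (auto simp: Lp_set_def)
  obtain \<phi> where s: "\<And>n. simple_function \<nu> (\<phi> n)"
    and lim: "\<And>x. x \<in> space \<nu> \<Longrightarrow> (\<lambda>n. \<phi> n x) \<longlonglongrightarrow> f x"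
    and bd: "\<And>n x. x \<in> space \<nu> \<Longrightarrow> \<bar>\<phi> n x\<bar> \<le> 2 * \<bar>f x\<bar>"
    using borel_measurable_implies_sequence_metric[OF f, of 0] unfolding dist_real_def diff_0_right by blast
  note [measurable] = borel_measurable_simple_function[OF s]
  have intc: "integrable \<nu> (\<lambda>x. c powr p * \<bar>f x\<bar> powr p)" for c using int by simp
  have "(\<lambda>n. \<integral>x. \<bar>\<phi> n x - f x\<bar> powr p \<partial>\<nu>) \<longlonglongrightarrow> (\<integral>x. 0 \<partial>\<nu>)"
  proof (rule integral_dominated_convergence[OF _ _ intc[of 3]])
    show "AE x in \<nu>. (\<lambda>n. \<bar>\<phi> n x - f x\<bar> powr p) \<longlonglongrightarrow> 0"
    proof (rule AE_I2)
      fix x assume "x \<in> space \<nu>"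
      then have "(\<lambda>n. \<bar>\<phi> n x - f x\<bar>) \<longlonglongrightarrow> 0" using lim by (intro tendsto_rabs_zero LIM_zero)
      from tendsto_powr'[OF this tendsto_const[of p]] show "(\<lambda>n. \<bar>\<phi> n x - f x\<bar> powr p) \<longlonglongrightarrow> 0"
        using assms by simp
    qed
    show "AE x in \<nu>. norm (\<bar>\<phi> n x - f x\<bar> powr p) \<le> 3 powr p * \<bar>f x\<bar> powr p" for n
    proof (rule AE_I2)
      fix x assume "x \<in> space \<nu>"
      then have "\<bar>\<phi> n x - f x\<bar> \<le> 3 * \<bar>f x\<bar>" using bd[of x n] by linarith
      then have "\<bar>\<phi> n x - f x\<bar> powr p \<le> (3 * \<bar>f x\<bar>) powr p" using assms by (intro powr_mono2) auto
      then show "norm (\<bar>\<phi> n x - f x\<bar> powr p) \<le> 3 powr p * \<bar>f x\<bar> powr p" by (simp add: powr_mult)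
    qed
  qed auto
  moreover have "(\<lambda>n. \<integral>x. \<bar>\<phi> n x\<bar> powr p \<partial>\<nu>) \<longlonglongrightarrow> (\<integral>x. \<bar>f x\<bar> powr p \<partial>\<nu>)"
  proof (rule integral_dominated_convergence[OF _ _ intc[of 2]])
    show "AE x in \<nu>. (\<lambda>n. \<bar>\<phi> n x\<bar> powr p) \<longlonglongrightarrow> \<bar>f x\<bar> powr p"
      using lim assms by (intro AE_I2 tendsto_powr' tendsto_rabs tendsto_const) auto
    show "AE x in \<nu>. norm (\<bar>\<phi> n x\<bar> powr p) \<le> 2 powr p * \<bar>f x\<bar> powr p" for n
    proof (rule AE_I2)
      fix x assume "x \<in> space \<nu>"
      then have "\<bar>\<phi> n x\<bar> powr p \<le> (2 * \<bar>f x\<bar>) powr p" using assms bd by (intro powr_mono2) auto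
      then show "norm (\<bar>\<phi> n x\<bar> powr p) \<le> 2 powr p * \<bar>f x\<bar> powr p" by (simp add: powr_mult)
    qed
  qed auto
  ultimately show ?thesis using s by auto
qed

section \<open>Integration against a stable random measure, from simple functions to the space of
  order \<open>\<alpha>\<close>\<close>

locale stable_random_measure = prob_space P + \<nu>: finite_measure \<nu>
  for P :: "'w measure" and \<nu> :: "'a measure" and \<alpha> :: real and W :: "'a set \<Rightarrow> 'w \<Rightarrow> real" +
  assumes alpha_pos: "0 < \<alpha>" and stable: "is_stable_random_measure P \<nu> \<alpha> W"
begin

lemma W_measurable [measurable]: "A \<in> sets \<nu> \<Longrightarrow> W A \<in> borel_measurable P"
  using stable by (auto simp: is_stable_random_measure_def)

lemma W_char: "A \<in> sets \<nu> \<Longrightarrow>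
    (CLINT \<omega>|P. iexp (u * W A \<omega>)) = complex_of_real (exp (- (\<bar>u\<bar> powr \<alpha> * measure \<nu> A)))"
  using stable by (auto simp: is_stable_random_measure_def)

text \<open>The empty set has measure 0, so the characteristic function is constantly 1, and the
  constant sequence \<open>W {}\<close> tends in probability both to 0 and to itself.\<close>

lemma W_empty: "AE \<omega> in P. W {} \<omega> = 0"
proof -
  have "tendsto_in_prob P (\<lambda>_::nat. W {}) (\<lambda>_. 0)"
    by (rule tendsto_in_prob_0_of_char) (simp_all only: W_char W_measurable sets.empty_sets measure_empty, simp)
  moreover have "tendsto_in_prob P (\<lambda>_::nat. W {}) (W {})"
    by (subst tendsto_in_prob_iff) auto
  ultimately show ?thesis
    by (intro tendsto_in_prob_unique[of "\<lambda>_. W {}"]) auto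
qed

text \<open>A finite disjoint family is enumerated and continued by the empty set to match the
  sequences in the definition of a random measure.\<close>

lemma W_finite_family:
  assumes R: "finite R" and B: "\<And>r. r \<in> R \<Longrightarrow> B r \<in> sets \<nu>" "disjoint_family_on B R"
  shows "AE \<omega> in P. W (\<Union>r\<in>R. B r) \<omega> = (\<Sum>r\<in>R. W (B r) \<omega>)"
    and "(CLINT \<omega>|P. iexp (u * (\<Sum>r\<in>R. c r * W (B r) \<omega>))) =
      complex_of_real (exp (- (\<bar>u\<bar> powr \<alpha> * (\<Sum>r\<in>R. \<bar>c r\<bar> powr \<alpha> * measure \<nu> (B r)))))"
proof -
  obtain e where e: "bij_betw e {..<card R} R"
    using ex_bij_betw_nat_finite[OF R] by (auto simp: lessThan_atLeast0)
  define A where "A i = (if i < card R then B (e i) else {})" for i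
  have sumR: "(\<Sum>r\<in>R. h r (B r)) = (\<Sum>i<card R. h (e i) (A i))" for h :: "_ \<Rightarrow> _ \<Rightarrow> real"
    using sum.reindex_bij_betw[OF e, of "\<lambda>r. h r (B r)"] by (simp add: A_def)
  have eR: "e i \<in> R" if "i < card R" for i using e that by (auto simp: bij_betw_def)
  have A: "range A \<subseteq> sets \<nu>" "disjoint_family A"
  proof -
    show "range A \<subseteq> sets \<nu>" using B(1) eR by (auto simp: A_def)
    show "disjoint_family A"
      using B(2) eR e unfolding disjoint_family_on_def A_def bij_betw_def inj_on_def by (auto split: if_splits) blast
  qed
  from A stable have indep: "indep_vars (\<lambda>_. borel) (\<lambda>i. W (A i)) UNIV"
    and sums: "AE \<omega> in P. (\<lambda>i. W (A i) \<omega>) sums W (\<Union>i. A i) \<omega>"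
    by (auto simp: is_stable_random_measure_def)
  have U: "(\<Union>i. A i) = (\<Union>r\<in>R. B r)"
  proof -
    have "(\<Union>i. A i) = (\<Union>r\<in>e ` {..<card R}. B r)" by (auto simp: A_def split: if_splits)
    also have "e ` {..<card R} = R" using e by (simp add: bij_betw_def)
    finally show ?thesis .
  qed
  from sums W_empty show "AE \<omega> in P. W (\<Union>r\<in>R. B r) \<omega> = (\<Sum>r\<in>R. W (B r) \<omega>)"
  proof eventually_elim
    case (elim \<omega>)
    have "(\<lambda>i. W (A i) \<omega>) sums (\<Sum>i<card R. W (A i) \<omega>)"
      by (rule sums_finite) (use elim in \<open>auto simp: A_def\<close>)
    then show ?case using elim(1) sumR[of "\<lambda>_ S. W S \<omega>"] unfolding U by (simp add: sums_unique2)
  qed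
  have Am: "A i \<in> sets \<nu>" for i using A by auto
  note [measurable] = W_measurable[OF Am]
  have "indep_vars (\<lambda>_. borel) (\<lambda>i \<omega>. c (e i) * W (A i) \<omega>) {..<card R}"
    using indep_vars_subset[OF indep_vars_compose2[OF indep, of "\<lambda>i x. c (e i) * x" "\<lambda>_. borel"]] by simp
  from char_distr_sum[OF this, of u]
  have "(CLINT \<omega>|P. iexp (u * (\<Sum>i<card R. c (e i) * W (A i) \<omega>))) =
      (\<Prod>i<card R. CLINT \<omega>|P. iexp (u * (c (e i) * W (A i) \<omega>)))"
    by (simp only: char_def) (subst (asm) integral_distr, simp, simp, subst (asm) integral_distr, simp_all)
  also have "\<dots> = (\<Prod>i<card R. complex_of_real (exp (- (\<bar>u * c (e i)\<bar> powr \<alpha> * measure \<nu> (A i)))))"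
    using Am by (intro prod.cong refl) (simp only: mult.assoc[symmetric] W_char)
  also have "\<dots> = complex_of_real (exp (\<Sum>i<card R. - (\<bar>u * c (e i)\<bar> powr \<alpha> * measure \<nu> (A i))))"
    by (simp add: exp_sum)
  also have "(\<Sum>i<card R. - (\<bar>u * c (e i)\<bar> powr \<alpha> * measure \<nu> (A i))) =
      - (\<bar>u\<bar> powr \<alpha> * (\<Sum>r\<in>R. \<bar>c r\<bar> powr \<alpha> * measure \<nu> (B r)))"
    unfolding sumR[of "\<lambda>r S. \<bar>c r\<bar> powr \<alpha> * measure \<nu> S"]
    by (simp add: sum_negf sum_distrib_left abs_mult powr_mult mult_ac)
  finally show "(CLINT \<omega>|P. iexp (u * (\<Sum>r\<in>R. c r * W (B r) \<omega>))) =
      complex_of_real (exp (- (\<bar>u\<bar> powr \<alpha> * (\<Sum>r\<in>R. \<bar>c r\<bar> powr \<alpha> * measure \<nu> (B r)))))"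
    unfolding sumR[of "\<lambda>r S. c r * W S \<omega>" for \<omega>] .
qed

abbreviation I_simple :: "('a \<Rightarrow> real) \<Rightarrow> 'w \<Rightarrow> real" where
  "I_simple \<equiv> stable_simple_integral \<nu> W"

lemma I_simple_measurable [measurable]:
  "simple_function \<nu> f \<Longrightarrow> I_simple f \<in> borel_measurable P"
  unfolding stable_simple_integral_def[abs_def]
  by (intro borel_measurable_sum borel_measurable_times borel_measurable_const W_measurable simple_functionD(2))

text \<open>Where f identifies several values of h, additivity merges their level sets. Two simple
  functions can thus be integrated over the partition generated by the pair of them, which reduces
  linearity to finite sums.\<close>

lemma I_simple_compose:
  assumes h: "simple_function \<nu> h"
  shows "AE \<omega> in P. I_simple (\<lambda>x. f (h x)) \<omega> =
    (\<Sum>r\<in>h ` space \<nu>. f r * W (h -` {r} \<inter> space \<nu>) \<omega>)"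
proof -
  let ?R = "h ` space \<nu>" and ?B = "\<lambda>r. h -` {r} \<inter> space \<nu>"
  have fin: "finite ?R" and B: "\<And>r. ?B r \<in> sets \<nu>" using simple_functionD[OF h] by auto
  have "AE \<omega> in P. \<forall>c\<in>f ` ?R. W (\<Union>r\<in>{r\<in>?R. f r = c}. ?B r) \<omega> = (\<Sum>r\<in>{r\<in>?R. f r = c}. W (?B r) \<omega>)"
    using B by (intro AE_finite_allI finite_imageI[OF fin] W_finite_family) (auto simp: disjoint_family_on_def fin)
  then show ?thesis
  proof eventually_elim
    case (elim \<omega>)
    have set: "(\<lambda>x. f (h x)) -` {c} \<inter> space \<nu> = (\<Union>r\<in>{r\<in>?R. f r = c}. ?B r)" for c by auto
    have "I_simple (\<lambda>x. f (h x)) \<omega> = (\<Sum>c\<in>f ` ?R. c * W (\<Union>r\<in>{r\<in>?R. f r = c}. ?B r) \<omega>)"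
      unfolding stable_simple_integral_def set by (simp add: image_image)
    also have "\<dots> = (\<Sum>c\<in>f ` ?R. \<Sum>r\<in>{r\<in>?R. f r = c}. f r * W (?B r) \<omega>)"
      using elim by (intro sum.cong refl) (auto simp: sum_distrib_left)
    also have "\<dots> = (\<Sum>r\<in>?R. f r * W (?B r) \<omega>)"
      using sum.image_gen[OF fin, of "\<lambda>r. f r * W (?B r) \<omega>" f] by simp
    finally show ?case .
  qed
qed

lemma I_simple_lincomb:
  assumes "simple_function \<nu> f" "simple_function \<nu> g"
  shows "AE \<omega> in P. I_simple (\<lambda>x. a * f x + b * g x) \<omega> = a * I_simple f \<omega> + b * I_simple g \<omega>"
proof -
  let ?h = "\<lambda>x. (f x, g x)"
  have h: "simple_function \<nu> ?h" using assms by simp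
  show ?thesis
    using I_simple_compose[OF h, of fst] I_simple_compose[OF h, of snd]
      I_simple_compose[OF h, of "\<lambda>r. a * fst r + b * snd r"]
    by eventually_elim (simp add: sum.distrib sum_distrib_left distrib_right mult.assoc)
qed

lemma I_simple_char:
  assumes f: "simple_function \<nu> f"
  shows "(CLINT \<omega>|P. iexp (u * I_simple f \<omega>)) =
    complex_of_real (exp (- (\<bar>u\<bar> powr \<alpha> * (\<integral>x. \<bar>f x\<bar> powr \<alpha> \<partial>\<nu>))))"
proof -
  let ?R = "f ` space \<nu>" and ?B = "\<lambda>r. f -` {r} \<inter> space \<nu>"
  have fin: "finite ?R" and B: "\<And>r. ?B r \<in> sets \<nu>" using simple_functionD[OF f] by auto
  have "(\<integral>x. \<bar>f x\<bar> powr \<alpha> \<partial>\<nu>) = (\<integral>x. (\<Sum>c\<in>?R. \<bar>c\<bar> powr \<alpha> * indicator (?B c) x) \<partial>\<nu>)"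
    using fin by (intro Bochner_Integration.integral_cong refl) (simp add: indicator_def sum.delta' if_distrib[of "\<lambda>a. _ * a"] cong: if_cong)
  also have "\<dots> = (\<Sum>c\<in>?R. \<bar>c\<bar> powr \<alpha> * measure \<nu> (?B c))"
    using B by (subst Bochner_Integration.integral_sum) (auto simp: less_top[symmetric])
  finally have "(\<integral>x. \<bar>f x\<bar> powr \<alpha> \<partial>\<nu>) = (\<Sum>c\<in>?R. \<bar>c\<bar> powr \<alpha> * measure \<nu> (?B c))" .
  then show ?thesis
    unfolding stable_simple_integral_def
    using fin B by (simp only:) (intro W_finite_family, auto simp: disjoint_family_on_def)
qed

lemma I_simple_tendsto_0:
  assumes "\<And>n. simple_function \<nu> (\<phi> n)" "(\<lambda>n. \<integral>x. \<bar>\<phi> n x\<bar> powr \<alpha> \<partial>\<nu>) \<longlonglongrightarrow> 0"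
  shows "tendsto_in_prob P (\<lambda>n. I_simple (\<phi> n)) (\<lambda>_. 0)"
proof (rule tendsto_in_prob_0_of_char)
  fix u
  have "(\<lambda>n. complex_of_real (exp (- (\<bar>u\<bar> powr \<alpha> * (\<integral>x. \<bar>\<phi> n x\<bar> powr \<alpha> \<partial>\<nu>))))) \<longlonglongrightarrow>
      complex_of_real (exp (- (\<bar>u\<bar> powr \<alpha> * 0)))"
    by (intro tendsto_intros assms)
  then show "(\<lambda>n. CLINT \<omega>|P. iexp (u * I_simple (\<phi> n) \<omega>)) \<longlonglongrightarrow> 1"
    unfolding I_simple_char[OF assms(1)] by simp
qed (use assms in auto)

text \<open>This is the condition inside the choice that defines \<open>stable_integral\<close>;
  naming it permits statements about every version of the integral.\<close>

definition is_integral :: "('a \<Rightarrow> real) \<Rightarrow> ('w \<Rightarrow> real) \<Rightarrow> bool" where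
  "is_integral f X \<longleftrightarrow> X \<in> borel_measurable P \<and>
     (\<exists>\<phi>. (\<forall>n. simple_function \<nu> (\<phi> n)) \<and>
        (\<lambda>n. \<integral>x. \<bar>\<phi> n x - f x\<bar> powr \<alpha> \<partial>\<nu>) \<longlonglongrightarrow> 0 \<and>
        tendsto_in_prob P (\<lambda>n. I_simple (\<phi> n)) X)"

lemma is_integral_lincomb:
  assumes f: "f \<in> Lp_set \<nu> \<alpha>" "is_integral f X" and g: "g \<in> Lp_set \<nu> \<alpha>" "is_integral g Y"
  shows "is_integral (\<lambda>x. a * f x + b * g x) (\<lambda>\<omega>. a * X \<omega> + b * Y \<omega>)"
proof -
  from f obtain \<phi> where [measurable]: "X \<in> borel_measurable P" and \<phi>: "\<And>n. simple_function \<nu> (\<phi> n)"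
    "(\<lambda>n. \<integral>x. \<bar>\<phi> n x - f x\<bar> powr \<alpha> \<partial>\<nu>) \<longlonglongrightarrow> 0" "tendsto_in_prob P (\<lambda>n. I_simple (\<phi> n)) X"
    by (auto simp: is_integral_def)
  from g obtain \<psi> where [measurable]: "Y \<in> borel_measurable P" and \<psi>: "\<And>n. simple_function \<nu> (\<psi> n)"
    "(\<lambda>n. \<integral>x. \<bar>\<psi> n x - g x\<bar> powr \<alpha> \<partial>\<nu>) \<longlonglongrightarrow> 0" "tendsto_in_prob P (\<lambda>n. I_simple (\<psi> n)) Y"
    by (auto simp: is_integral_def)
  have s: "simple_function \<nu> (\<lambda>x. a * \<phi> n x + b * \<psi> n x)" for n
    using \<phi>(1) \<psi>(1) by (intro simple_function_compose2[of _ _ _ "\<lambda>x y. a * x + b * y"])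
  have L: "(\<lambda>x. \<phi> n x - f x) \<in> Lp_set \<nu> \<alpha>" "(\<lambda>x. \<psi> n x - g x) \<in> Lp_set \<nu> \<alpha>" for n
    using Lp_set_lincomb(1)[OF alpha_pos \<nu>.simple_function_Lp_set[OF \<phi>(1)[of n]] f(1), of 1 "-1"]
      Lp_set_lincomb(1)[OF alpha_pos \<nu>.simple_function_Lp_set[OF \<psi>(1)[of n]] g(1), of 1 "-1"] by auto
  have "(\<lambda>n. \<integral>x. \<bar>(a * \<phi> n x + b * \<psi> n x) - (a * f x + b * g x)\<bar> powr \<alpha> \<partial>\<nu>) \<longlonglongrightarrow> 0"
  proof (rule squeeze_zero)
    show "(\<integral>x. \<bar>(a * \<phi> n x + b * \<psi> n x) - (a * f x + b * g x)\<bar> powr \<alpha> \<partial>\<nu>) \<le> (\<bar>a\<bar> + \<bar>b\<bar>) powr \<alpha> *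
      ((\<integral>x. \<bar>\<phi> n x - f x\<bar> powr \<alpha> \<partial>\<nu>) + (\<integral>x. \<bar>\<psi> n x - g x\<bar> powr \<alpha> \<partial>\<nu>))" for n
      using Lp_set_lincomb(2)[OF alpha_pos L(1) L(2), of a n b n] by (simp add: algebra_simps)
    show "(\<lambda>n. (\<bar>a\<bar> + \<bar>b\<bar>) powr \<alpha> *
      ((\<integral>x. \<bar>\<phi> n x - f x\<bar> powr \<alpha> \<partial>\<nu>) + (\<integral>x. \<bar>\<psi> n x - g x\<bar> powr \<alpha> \<partial>\<nu>))) \<longlonglongrightarrow> 0"
      using \<phi>(2) \<psi>(2) by (intro tendsto_mult_right_zero tendsto_add_zero)
  qed simp
  moreover have "tendsto_in_prob P (\<lambda>n. I_simple (\<lambda>x. a * \<phi> n x + b * \<psi> n x)) (\<lambda>\<omega>. a * X \<omega> + b * Y \<omega>)"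
  proof (rule tendsto_in_prob_cong)
    show "tendsto_in_prob P (\<lambda>n \<omega>. a * I_simple (\<phi> n) \<omega> + b * I_simple (\<psi> n) \<omega>) (\<lambda>\<omega>. a * X \<omega> + b * Y \<omega>)"
      using \<phi> \<psi> by (intro tendsto_in_prob_lincomb) auto
    show "AE \<omega> in P. a * I_simple (\<phi> n) \<omega> + b * I_simple (\<psi> n) \<omega> = I_simple (\<lambda>x. a * \<phi> n x + b * \<psi> n x) \<omega>" for n
      using I_simple_lincomb[OF \<phi>(1)[of n] \<psi>(1)[of n], of a b] by eventually_elim simp
  qed (use s \<phi>(1) \<psi>(1) in auto)
  ultimately show ?thesis
    unfolding is_integral_def using s by (auto intro!: exI[of _ "\<lambda>n x. a * \<phi> n x + b * \<psi> n x"])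
qed

lemma is_integral_zero: "is_integral (\<lambda>_. 0) (\<lambda>_. 0)"
  unfolding is_integral_def
  by (auto intro!: exI[of _ "\<lambda>_ _. 0"] I_simple_tendsto_0)

lemma is_integral_sum:
  assumes "finite J" "\<And>j. j \<in> J \<Longrightarrow> f j \<in> Lp_set \<nu> \<alpha>" "\<And>j. j \<in> J \<Longrightarrow> is_integral (f j) (X j)"
  shows "(\<lambda>x. \<Sum>j\<in>J. u j * f j x) \<in> Lp_set \<nu> \<alpha> \<and>
    is_integral (\<lambda>x. \<Sum>j\<in>J. u j * f j x) (\<lambda>\<omega>. \<Sum>j\<in>J. u j * X j \<omega>)"
  using assms
proof (induction J rule: finite_induct)
  case empty
  show ?case using is_integral_zero alpha_pos by (simp add: Lp_set_def)
next
  case (insert j J)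
  then show ?case
    using Lp_set_lincomb(1)[OF alpha_pos, of "f j" \<nu> "\<lambda>x. \<Sum>j\<in>J. u j * f j x" "u j" 1]
      is_integral_lincomb[of "f j" "X j" "\<lambda>x. \<Sum>j\<in>J. u j * f j x" "\<lambda>\<omega>. \<Sum>j\<in>J. u j * X j \<omega>" "u j" 1]
    by simp
qed

text \<open>The approximating sequence that comes with X is arbitrary. It is exchanged for one with
  converging moments: the integrals of the differences tend to 0 in probability, so both sequences
  have the limit X, and characteristic functions pass to the limit.\<close>

lemma is_integral_char:
  assumes f: "f \<in> Lp_set \<nu> \<alpha>" "is_integral f X"
  shows "(CLINT \<omega>|P. iexp (u * X \<omega>)) =
    complex_of_real (exp (- (\<bar>u\<bar> powr \<alpha> * (\<integral>x. \<bar>f x\<bar> powr \<alpha> \<partial>\<nu>))))"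
proof -
  from f obtain \<phi> where [measurable]: "X \<in> borel_measurable P" and \<phi>: "\<And>n. simple_function \<nu> (\<phi> n)"
    "(\<lambda>n. \<integral>x. \<bar>\<phi> n x - f x\<bar> powr \<alpha> \<partial>\<nu>) \<longlonglongrightarrow> 0" "tendsto_in_prob P (\<lambda>n. I_simple (\<phi> n)) X"
    by (auto simp: is_integral_def)
  from Lp_set_simple_approx[OF alpha_pos f(1)] obtain \<psi> where \<psi>: "\<And>n. simple_function \<nu> (\<psi> n)"
    "(\<lambda>n. \<integral>x. \<bar>\<psi> n x - f x\<bar> powr \<alpha> \<partial>\<nu>) \<longlonglongrightarrow> 0"
    "(\<lambda>n. \<integral>x. \<bar>\<psi> n x\<bar> powr \<alpha> \<partial>\<nu>) \<longlonglongrightarrow> (\<integral>x. \<bar>f x\<bar> powr \<alpha> \<partial>\<nu>)" by blast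
  have L: "(\<lambda>x. \<phi> n x - f x) \<in> Lp_set \<nu> \<alpha>" "(\<lambda>x. \<psi> n x - f x) \<in> Lp_set \<nu> \<alpha>" for n
    using Lp_set_lincomb(1)[OF alpha_pos \<nu>.simple_function_Lp_set[OF \<phi>(1)[of n]] f(1), of 1 "-1"]
      Lp_set_lincomb(1)[OF alpha_pos \<nu>.simple_function_Lp_set[OF \<psi>(1)[of n]] f(1), of 1 "-1"] by auto
  have s: "simple_function \<nu> (\<lambda>x. 1 * \<psi> n x + (-1) * \<phi> n x)" for n
    using \<phi>(1) \<psi>(1) by (intro simple_function_compose2[of _ _ _ "\<lambda>x y. 1 * x + (-1) * y"])
  have "tendsto_in_prob P (\<lambda>n. I_simple (\<lambda>x. 1 * \<psi> n x + (-1) * \<phi> n x)) (\<lambda>_. 0)"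
  proof (rule I_simple_tendsto_0[OF s], rule squeeze_zero)
    show "(\<integral>x. \<bar>1 * \<psi> n x + (-1) * \<phi> n x\<bar> powr \<alpha> \<partial>\<nu>) \<le> 2 powr \<alpha> *
      ((\<integral>x. \<bar>\<psi> n x - f x\<bar> powr \<alpha> \<partial>\<nu>) + (\<integral>x. \<bar>\<phi> n x - f x\<bar> powr \<alpha> \<partial>\<nu>))" for n
      using Lp_set_lincomb(2)[OF alpha_pos L(2) L(1), of 1 n "-1" n] by simp
    show "(\<lambda>n. 2 powr \<alpha> *
      ((\<integral>x. \<bar>\<psi> n x - f x\<bar> powr \<alpha> \<partial>\<nu>) + (\<integral>x. \<bar>\<phi> n x - f x\<bar> powr \<alpha> \<partial>\<nu>))) \<longlonglongrightarrow> 0"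
      using \<phi>(2) \<psi>(2) by (intro tendsto_mult_right_zero tendsto_add_zero)
  qed simp
  from tendsto_in_prob_lincomb[OF _ _ _ _ this \<phi>(3), of 1 1]
  have 1: "tendsto_in_prob P (\<lambda>n \<omega>. I_simple (\<lambda>x. 1 * \<psi> n x + (-1) * \<phi> n x) \<omega> + I_simple (\<phi> n) \<omega>) X"
    using s \<phi>(1) by simp
  have "tendsto_in_prob P (\<lambda>n. I_simple (\<psi> n)) X"
  proof (rule tendsto_in_prob_cong[OF _ _ _ _ 1])
    show "AE \<omega> in P. I_simple (\<lambda>x. 1 * \<psi> n x + (-1) * \<phi> n x) \<omega> + I_simple (\<phi> n) \<omega> = I_simple (\<psi> n) \<omega>" for n
      using I_simple_lincomb[OF \<psi>(1)[of n] \<phi>(1)[of n], of 1 "-1"] by eventually_elim simp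
  qed (use s \<phi>(1) \<psi>(1) in auto)
  then have "(\<lambda>n. CLINT \<omega>|P. iexp (u * I_simple (\<psi> n) \<omega>)) \<longlonglongrightarrow> (CLINT \<omega>|P. iexp (u * X \<omega>))"
    using \<psi>(1) by (intro tendsto_in_prob_char) auto
  moreover have "(\<lambda>n. complex_of_real (exp (- (\<bar>u\<bar> powr \<alpha> * (\<integral>x. \<bar>\<psi> n x\<bar> powr \<alpha> \<partial>\<nu>))))) \<longlonglongrightarrow>
      complex_of_real (exp (- (\<bar>u\<bar> powr \<alpha> * (\<integral>x. \<bar>f x\<bar> powr \<alpha> \<partial>\<nu>))))"
    by (intro tendsto_intros \<psi>)
  ultimately show ?thesis using \<psi>(1) by (simp only: I_simple_char) (rule LIMSEQ_unique)
qed

text \<open>If the simple integrals were not Cauchy in probability, pairs of ever larger indices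
  would stay apart; but the differences along such pairs tend to 0 in the space of order
  \<open>\<alpha>\<close>, hence their integrals tend to 0 in probability.\<close>

lemma is_integral_exists:
  assumes f: "f \<in> Lp_set \<nu> \<alpha>"
  shows "\<exists>X. is_integral f X"
proof -
  from Lp_set_simple_approx[OF alpha_pos f(1)] obtain \<phi> where \<phi>: "\<And>n. simple_function \<nu> (\<phi> n)"
    "(\<lambda>n. \<integral>x. \<bar>\<phi> n x - f x\<bar> powr \<alpha> \<partial>\<nu>) \<longlonglongrightarrow> 0" by blast
  have L: "(\<lambda>x. \<phi> n x - f x) \<in> Lp_set \<nu> \<alpha>" for n
    using Lp_set_lincomb(1)[OF alpha_pos \<nu>.simple_function_Lp_set[OF \<phi>(1)[of n]] f(1), of 1 "-1"] by auto
  let ?E = "\<lambda>m n. \<integral>\<omega>. min 1 \<bar>I_simple (\<phi> m) \<omega> - I_simple (\<phi> n) \<omega>\<bar> \<partial>P"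
  have "\<exists>X. X \<in> borel_measurable P \<and> tendsto_in_prob P (\<lambda>n. I_simple (\<phi> n)) X"
  proof (rule tendsto_in_prob_complete)
    show "\<exists>N. \<forall>m\<ge>N. \<forall>n\<ge>N. ?E m n < e" if e: "e > 0" for e
    proof (rule ccontr)
      assume "\<not> ?thesis"
      then have "\<forall>N. \<exists>m n. N \<le> m \<and> N \<le> n \<and> \<not> ?E m n < e" by blast
      then obtain a b where ab: "\<And>N. N \<le> a N" "\<And>N. N \<le> b N" "\<And>N. \<not> ?E (a N) (b N) < e" by metis
      have s: "simple_function \<nu> (\<lambda>x. 1 * \<phi> (a n) x + (-1) * \<phi> (b n) x)" for n
        using \<phi>(1) by (intro simple_function_compose2[of _ _ _ "\<lambda>x y. 1 * x + (-1) * y"])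
      have lim: "(\<lambda>n. \<integral>x. \<bar>\<phi> (c n) x - f x\<bar> powr \<alpha> \<partial>\<nu>) \<longlonglongrightarrow> 0" if "\<And>n. n \<le> c n" for c :: "nat \<Rightarrow> nat"
      proof (rule LIMSEQ_I)
        fix r :: real assume "r > 0"
        from LIMSEQ_D[OF \<phi>(2) this] that
        show "\<exists>N. \<forall>n\<ge>N. norm ((\<integral>x. \<bar>\<phi> (c n) x - f x\<bar> powr \<alpha> \<partial>\<nu>) - 0) < r"
          by (meson order_trans)
      qed
      have "tendsto_in_prob P (\<lambda>n. I_simple (\<lambda>x. 1 * \<phi> (a n) x + (-1) * \<phi> (b n) x)) (\<lambda>_. 0)"
      proof (rule I_simple_tendsto_0[OF s], rule squeeze_zero)
        show "(\<integral>x. \<bar>1 * \<phi> (a n) x + (-1) * \<phi> (b n) x\<bar> powr \<alpha> \<partial>\<nu>) \<le> 2 powr \<alpha> *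
          ((\<integral>x. \<bar>\<phi> (a n) x - f x\<bar> powr \<alpha> \<partial>\<nu>) + (\<integral>x. \<bar>\<phi> (b n) x - f x\<bar> powr \<alpha> \<partial>\<nu>))" for n
          using Lp_set_lincomb(2)[OF alpha_pos L L, of 1 "a n" "-1" "b n"] by simp
        show "(\<lambda>n. 2 powr \<alpha> *
          ((\<integral>x. \<bar>\<phi> (a n) x - f x\<bar> powr \<alpha> \<partial>\<nu>) + (\<integral>x. \<bar>\<phi> (b n) x - f x\<bar> powr \<alpha> \<partial>\<nu>))) \<longlonglongrightarrow> 0"
          by (intro tendsto_mult_right_zero tendsto_add_zero lim ab)
      qed simp
      then have "tendsto_in_prob P (\<lambda>n \<omega>. I_simple (\<phi> (a n)) \<omega> - I_simple (\<phi> (b n)) \<omega>) (\<lambda>_. 0)"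
      proof (rule tendsto_in_prob_cong[rotated -1])
        show "AE \<omega> in P. I_simple (\<lambda>x. 1 * \<phi> (a n) x + (-1) * \<phi> (b n) x) \<omega> =
            I_simple (\<phi> (a n)) \<omega> - I_simple (\<phi> (b n)) \<omega>" for n
          using I_simple_lincomb[OF \<phi>(1)[of "a n"] \<phi>(1)[of "b n"], of 1 "-1"] by eventually_elim simp
      qed (use s \<phi>(1) in auto)
      then have "(\<lambda>n. ?E (a n) (b n)) \<longlonglongrightarrow> 0"
        using \<phi>(1) by (subst (asm) tendsto_in_prob_iff) auto
      from LIMSEQ_D[OF this e] have "\<exists>n. ?E (a n) (b n) < e" by (auto intro: order_le_less_trans[OF abs_ge_self])
      then show False using ab(3) by blast
    qed
  qed (use \<phi>(1) in auto)
  then show ?thesis unfolding is_integral_def using \<phi> by blast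
qed

text \<open>The default value 0 outside the space is the integral of the zero function, which makes
  all later statements uniform in f.\<close>

lemma stable_integral_is_integral:
  "is_integral (if f \<in> Lp_set \<nu> \<alpha> then f else (\<lambda>_. 0)) (stable_integral P \<nu> \<alpha> W f)"
proof (cases "f \<in> Lp_set \<nu> \<alpha>")
  case True
  from someI_ex[OF is_integral_exists[OF True]] show ?thesis
    using True unfolding stable_integral_def is_integral_def by simp
qed (simp add: stable_integral_def is_integral_zero)

lemma stable_integral_measurable [measurable]: "stable_integral P \<nu> \<alpha> W f \<in> borel_measurable P"
  using stable_integral_is_integral by (simp add: is_integral_def)

text \<open>By linearity the phase is a single stable integral, taken at frequency 1.\<close>

lemma stable_integral_joint_char:
  assumes "finite J"
  shows "(CLINT \<omega>|P. iexp (\<Sum>j\<in>J. u j * stable_integral P \<nu> \<alpha> W (f j) \<omega>)) =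
    complex_of_real (exp (- (\<integral>x. \<bar>\<Sum>j\<in>J. u j * (if f j \<in> Lp_set \<nu> \<alpha> then f j x else 0)\<bar> powr \<alpha> \<partial>\<nu>)))"
proof -
  let ?f = "\<lambda>j. if f j \<in> Lp_set \<nu> \<alpha> then f j else (\<lambda>_. 0)"
  have L: "?f j \<in> Lp_set \<nu> \<alpha>" for j by (simp add: Lp_set_def[of \<nu> \<alpha>])
  have a: "?f j x = (if f j \<in> Lp_set \<nu> \<alpha> then f j x else 0)" for j x by simp
  from is_integral_sum[OF assms L stable_integral_is_integral, of u] is_integral_char[where u = 1]
  show ?thesis unfolding a by fastforce
qed

end

text \<open>Both sides of a stochastic integral identity are determined by the \<^term>\<open>\<alpha>\<close>-norms of the
  linear combinations of the integrands.\<close>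

lemma same_fdd_stable_integral:
  fixes I :: "'i set"
  assumes S: "stable_random_measure P \<nu> \<alpha> W" and S': "stable_random_measure P' \<nu>' \<alpha> W'"
    and Lp: "\<And>i. i \<in> I \<Longrightarrow> f i \<in> Lp_set \<nu> \<alpha> \<longleftrightarrow> g i \<in> Lp_set \<nu>' \<alpha>"
    and eq: "\<And>J u. finite J \<Longrightarrow> J \<subseteq> I \<Longrightarrow> (\<And>j. j \<in> J \<Longrightarrow> f j \<in> Lp_set \<nu> \<alpha>) \<Longrightarrow>
      \<bar>c\<bar> powr \<alpha> * (\<integral>x. \<bar>\<Sum>j\<in>J. u j * f j x\<bar> powr \<alpha> \<partial>\<nu>) = (\<integral>x. \<bar>\<Sum>j\<in>J. u j * g j x\<bar> powr \<alpha> \<partial>\<nu>')"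
  shows "same_fdd I P (\<lambda>i \<omega>. c * stable_integral P \<nu> \<alpha> W (f i) \<omega>) P' (\<lambda>i. stable_integral P' \<nu>' \<alpha> W' (g i))"
proof -
  interpret S: stable_random_measure P \<nu> \<alpha> W by fact
  interpret S': stable_random_measure P' \<nu>' \<alpha> W' by fact
  show ?thesis
    unfolding same_fdd_def
  proof (intro conjI ballI allI impI; (elim conjE)?)
    fix J assume J: "finite J" "J \<subseteq> I"
    show "distr P (PiM J (\<lambda>_. borel)) (\<lambda>\<omega>. \<lambda>i\<in>J. c * stable_integral P \<nu> \<alpha> W (f i) \<omega>) =
        distr P' (PiM J (\<lambda>_. borel)) (\<lambda>\<omega>. \<lambda>i\<in>J. stable_integral P' \<nu>' \<alpha> W' (g i) \<omega>)"
    proof (rule joint_char_uniqueness[OF S.prob_space_axioms S'.prob_space_axioms J(1)])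
      fix u :: "'i \<Rightarrow> real"
      \<comment> \<open>Indices whose integrals take the default value 0 are dropped; by
        \<open>Lp\<close> they are the same on both sides.\<close>
      define J' where "J' = {j\<in>J. f j \<in> Lp_set \<nu> \<alpha>}"
      have J': "finite J'" "J' \<subseteq> I" "J' \<subseteq> J" using J by (auto simp: J'_def)
      have g: "(\<Sum>j\<in>J. u j * (if g j \<in> Lp_set \<nu>' \<alpha> then g j x else 0)) = (\<Sum>j\<in>J'. u j * g j x)" for x
        using J Lp by (intro sum.mono_neutral_cong_right) (auto simp: J'_def)
      have f: "(\<Sum>j\<in>J. (u j * c) * (if f j \<in> Lp_set \<nu> \<alpha> then f j x else 0)) = c * (\<Sum>j\<in>J'. u j * f j x)" for x
        unfolding sum_distrib_left using J by (intro sum.mono_neutral_cong_right) (auto simp: J'_def)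
      have "(CLINT \<omega>|P. iexp (\<Sum>i\<in>J. u i * (c * stable_integral P \<nu> \<alpha> W (f i) \<omega>))) =
          complex_of_real (exp (- (\<integral>x. \<bar>c * (\<Sum>j\<in>J'. u j * f j x)\<bar> powr \<alpha> \<partial>\<nu>)))"
        using S.stable_integral_joint_char[OF J(1), of "\<lambda>j. u j * c" f] unfolding f by (simp only: mult.assoc)
      also have "(\<integral>x. \<bar>c * (\<Sum>j\<in>J'. u j * f j x)\<bar> powr \<alpha> \<partial>\<nu>) = (\<integral>x. \<bar>\<Sum>j\<in>J'. u j * g j x\<bar> powr \<alpha> \<partial>\<nu>')"
        using eq[OF J'(1,2), of u] by (simp add: J'_def abs_mult powr_mult)
      also have "complex_of_real (exp (- \<dots>)) = (CLINT \<omega>|P'. iexp (\<Sum>i\<in>J. u i * stable_integral P' \<nu>' \<alpha> W' (g i) \<omega>))"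
        unfolding S'.stable_integral_joint_char[OF J(1)] g ..
      finally show "(CLINT \<omega>|P. iexp (\<Sum>i\<in>J. u i * (c * stable_integral P \<nu> \<alpha> W (f i) \<omega>))) =
        (CLINT \<omega>|P'. iexp (\<Sum>i\<in>J. u i * stable_integral P' \<nu>' \<alpha> W' (g i) \<omega>))" .
    qed auto
  qed auto
qed

lemma same_fdd_imp_same_distribution:
  assumes "same_fdd I P X Q Y" "i \<in> I"
  shows "same_distribution P (X i) Q (Y i)"
proof -
  let ?M = "PiM {i} (\<lambda>_. borel :: real measure)"
  have m: "X i \<in> borel_measurable P" "Y i \<in> borel_measurable Q"
    and eq: "distr P ?M (\<lambda>\<omega>. \<lambda>j\<in>{i}. X j \<omega>) = distr Q ?M (\<lambda>\<omega>. \<lambda>j\<in>{i}. Y j \<omega>)"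
    using assms unfolding same_fdd_def by auto
  have "distr (distr P ?M (\<lambda>\<omega>. \<lambda>j\<in>{i}. X j \<omega>)) borel (\<lambda>x. x i) = distr P borel (X i)"
    using m by (subst distr_distr) (auto simp: comp_def intro!: measurable_restrict measurable_component_singleton)
  moreover have "distr (distr Q ?M (\<lambda>\<omega>. \<lambda>j\<in>{i}. Y j \<omega>)) borel (\<lambda>x. x i) = distr Q borel (Y i)"
    using m by (subst distr_distr) (auto simp: comp_def intro!: measurable_restrict measurable_component_singleton)
  ultimately show ?thesis using m eq by (simp add: same_distribution_def)
qed

section \<open>Self-similarity of the gasket measure\<close>

lemma sg_word_map_Nil [simp]: "sg_word_map [] = id"
  by (simp add: sg_word_map_def)

lemma sg_word_map_Cons: "sg_word_map (i # w) = sg_map i \<circ> sg_word_map w"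
  by (simp add: sg_word_map_def)

lemma sg_word_map_append: "sg_word_map (v @ w) = sg_word_map v \<circ> sg_word_map w"
  by (induction v) (simp_all add: sg_word_map_Cons comp_assoc)

lemma sg_word_map_affine: "sg_word_map w z = z / 2 ^ length w + sg_word_map w 0"
proof (induction w)
  case (Cons i w)
  have "sg_word_map (i # w) z = (z / 2 ^ length w + sg_word_map w 0 - sg_q i) / 2 + sg_q i"
    by (subst sg_word_map_Cons) (simp add: sg_map_def Cons.IH[symmetric])
  also have "\<dots> = z / 2 ^ length (i # w) + sg_word_map (i # w) 0"
    by (simp add: sg_word_map_Cons sg_map_def field_simps)
  finally show ?case .
qed simp

lemma dist_sg_word_map: "dist (sg_word_map w x) (sg_word_map w y) = dist x y / 2 ^ length w"
  by (subst (1 2) sg_word_map_affine) (simp add: dist_norm norm_divide norm_power flip: diff_divide_distrib)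

lemma inj_sg_word_map: "inj (sg_word_map w)"
  by (rule injI) (metis dist_sg_word_map dist_eq_0_iff divide_eq_0_iff power_not_zero zero_neq_numeral)

lemma continuous_on_sg_word_map: "continuous_on S (sg_word_map w)"
proof -
  have "sg_word_map w = (\<lambda>z. z / 2 ^ length w + sg_word_map w 0)" by (rule ext) (rule sg_word_map_affine)
  moreover have "continuous_on S (\<lambda>z. z / 2 ^ length w + sg_word_map w 0)" by (intro continuous_intros) auto
  ultimately show ?thesis by metis
qed

lemma inv_sg_word_map: "inv (sg_word_map w) y = 2 ^ length w * (y - sg_word_map w 0)"
  by (rule inv_f_eq[OF inj_sg_word_map]) (subst sg_word_map_affine, simp)

lemma continuous_on_inv_sg_word_map: "continuous_on S (inv (sg_word_map w))"
proof -
  have "inv (sg_word_map w) = (\<lambda>y. 2 ^ length w * (y - sg_word_map w 0))" by (rule ext) (rule inv_sg_word_map)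
  moreover have "continuous_on S (\<lambda>y. 2 ^ length w * (y - sg_word_map w 0))" by (intro continuous_intros)
  ultimately show ?thesis by metis
qed

lemma card_sg_words: "card (sg_words m) = 3 ^ m" and finite_sg_words: "finite (sg_words m)"
proof -
  have "sg_words m = {xs. set xs \<subseteq> {0, 1, 2} \<and> length xs = m}" by (auto simp: sg_words_def)
  then show "card (sg_words m) = 3 ^ m" "finite (sg_words m)"
    by (simp_all only: card_lists_length_eq finite_lists_length_eq finite.insertI finite.emptyI)
      (simp add: card_insert_if numeral_3_eq_3)
qed

lemma sg_words_append: "v \<in> sg_words m \<Longrightarrow> w \<in> sg_words n \<Longrightarrow> v @ w \<in> sg_words (m + n)"
  by (auto simp: sg_words_def)

section \<open>Cells of the gasket and uniqueness of its measure\<close>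

locale gasket =
  fixes K :: "complex set" and \<mu> :: "complex measure"
  assumes K: "is_sierpinski_gasket K" and mu: "is_gasket_measure K \<mu>"
begin

lemma compact_K: "compact K" and K_nonempty: "K \<noteq> {}" and K_eq: "K = (\<Union>i\<in>{0, 1, 2}. sg_map i ` K)"
  using K by (simp_all add: is_sierpinski_gasket_def)

lemma K_words: "K = (\<Union>v\<in>sg_words m. sg_word_map v ` K)"
proof (induction m)
  case 0
  then show ?case by (simp add: sg_words_def)
next
  case (Suc m)
  have w: "sg_words (Suc m) = (\<Union>i\<in>{0, 1, 2}. (#) i ` sg_words m)"
    by (auto simp: sg_words_def length_Suc_conv)
  have "K = (\<Union>i\<in>{0, 1, 2}. sg_map i ` (\<Union>v\<in>sg_words m. sg_word_map v ` K))"
    using K_eq Suc.IH by simp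
  also have "\<dots> = (\<Union>v\<in>sg_words (Suc m). sg_word_map v ` K)"
    unfolding w by (simp add: sg_word_map_Cons image_UN image_comp)
  finally show ?case .
qed

lemma cell_subset: "v \<in> sg_words m \<Longrightarrow> sg_word_map v ` K \<subseteq> K"
  using K_words[of m] by blast

lemma compact_cell: "compact (sg_word_map v ` K)"
  by (intro compact_continuous_image continuous_on_sg_word_map compact_K)

lemma sets_mu: "sets \<mu> = sets (restrict_space borel K)"
  and prob_mu: "prob_space \<mu>"
  and measure_cell: "v \<in> sg_words m \<Longrightarrow> measure \<mu> (sg_word_map v ` K) = 1 / 3 ^ m"
  using mu by (auto simp: is_gasket_measure_def)

lemma space_mu: "space \<mu> = K"
  using sets_eq_imp_space_eq[OF sets_mu] by (simp add: space_restrict_space)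

lemma sets_mu_iff: "A \<in> sets \<mu> \<longleftrightarrow> A \<subseteq> K \<and> A \<in> sets borel"
  unfolding sets_mu using compact_imp_closed[OF compact_K]
  by (subst sets_restrict_space_iff) auto

lemma cell_sets: "v \<in> sg_words m \<Longrightarrow> sg_word_map v ` K \<in> sets \<mu>"
  using cell_subset compact_imp_closed[OF compact_cell] by (auto simp: sets_mu_iff)

lemma continuous_on_measurable: "continuous_on K f \<Longrightarrow> f \<in> borel_measurable \<mu>"
  by (subst measurable_cong_sets[OF sets_mu refl]) (rule borel_measurable_continuous_on_restrict)

end

sublocale gasket \<subseteq> prob_space \<mu> by (rule prob_mu)

text \<open>The number of cells of level \<^term>\<open>m\<close> that meet a closed set \<^term>\<open>C\<close> bounds the first
  measure of \<^term>\<open>C\<close> from above, and, since the other cells cover the complement of their union,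
  bounds the second measure of a neighbourhood of \<^term>\<open>C\<close> from below.  In this way the null
  intersections of cells need not be discussed.\<close>

lemma gasket_measure_closed_le:
  assumes "gasket K \<mu>" "gasket K \<nu>" and C: "closed C" "C \<subseteq> K"
  shows "measure \<mu> C \<le> measure \<nu> C"
proof (cases "C = {}")
  case False
  interpret \<mu>: gasket K \<mu> by fact
  interpret \<nu>: gasket K \<nu> by fact
  obtain D where D: "\<And>x y. x \<in> K \<Longrightarrow> y \<in> K \<Longrightarrow> dist x y \<le> D"
    using compact_imp_bounded[OF \<mu>.compact_K, unfolded bounded_two_points] by blast
  \<comment> \<open>A cell of level m has diameter at most \<open>D / 2 ^ m\<close>, so
    \<open>N m\<close> contains every such cell that meets C.\<close>
  define N where "N m = {x \<in> K. infdist x C \<le> D / 2 ^ m}" for m :: nat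
  have Ncl: "closed (N m)" for m
  proof -
    have "N m = K \<inter> {x. infdist x C \<le> D / 2 ^ m}" by (auto simp: N_def)
    then show ?thesis using compact_imp_closed[OF \<mu>.compact_K]
      by (simp add: closed_Int closed_Collect_le continuous_on_infdist)
  qed
  have le: "measure \<mu> C \<le> measure \<nu> (N m)" for m
  proof -
    define V where "V = {v \<in> sg_words m. sg_word_map v ` K \<inter> C \<noteq> {}}"
    let ?U = "\<Union>v\<in>V. sg_word_map v ` K"
    have V: "finite V" "V \<subseteq> sg_words m" using finite_sg_words[of m] by (auto simp: V_def)
    have setsU: "?U \<in> sets \<mu>" "?U \<in> sets \<nu>"
      using V by (auto intro!: sets.finite_UN \<mu>.cell_sets \<nu>.cell_sets)
    have "C \<subseteq> ?U" using C(2) \<mu>.K_words[of m] by (fastforce simp: V_def)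
    then have "measure \<mu> C \<le> measure \<mu> ?U" by (intro \<mu>.finite_measure_mono setsU)
    also have "\<dots> \<le> (\<Sum>v\<in>V. measure \<mu> (sg_word_map v ` K))"
      using V by (intro measure_UNION_le) (auto intro: \<mu>.cell_sets)
    also have "\<dots> = card V / 3 ^ m"
      using V by (subst sum.cong[OF refl \<mu>.measure_cell]) auto
    finally have 1: "measure \<mu> C \<le> card V / 3 ^ m" .
    have "measure \<nu> (K - ?U) \<le> measure \<nu> (\<Union>v\<in>sg_words m - V. sg_word_map v ` K)"
    proof (rule \<nu>.finite_measure_mono)
      show "K - ?U \<subseteq> (\<Union>v\<in>sg_words m - V. sg_word_map v ` K)"
      proof
        fix x assume x: "x \<in> K - ?U"
        then have "x \<in> (\<Union>v\<in>sg_words m. sg_word_map v ` K)" using \<nu>.K_words[of m] by simp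
        with x show "x \<in> (\<Union>v\<in>sg_words m - V. sg_word_map v ` K)" by blast
      qed
    qed (use finite_sg_words[of m] in \<open>auto intro!: sets.finite_UN \<nu>.cell_sets\<close>)
    also have "\<dots> \<le> (\<Sum>v\<in>sg_words m - V. measure \<nu> (sg_word_map v ` K))"
      using finite_sg_words[of m] by (intro measure_UNION_le) (auto intro: \<nu>.cell_sets)
    also have "\<dots> = card (sg_words m - V) / 3 ^ m"
      by (subst sum.cong[OF refl \<nu>.measure_cell]) auto
    also have "\<dots> = 1 - card V / 3 ^ m"
      using V card_mono[OF finite_sg_words[of m] V(2)]
      by (simp add: card_Diff_subset card_sg_words of_nat_diff diff_divide_distrib)
    finally have 2: "card V / 3 ^ m \<le> measure \<nu> ?U"
      using \<nu>.prob_compl[OF setsU(2)] by (simp add: \<nu>.space_mu)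
    have "?U \<subseteq> N m"
    proof
      fix x assume "x \<in> ?U"
      then obtain v a where v: "v \<in> sg_words m" "sg_word_map v ` K \<inter> C \<noteq> {}" and a: "a \<in> K" "x = sg_word_map v a"
        by (auto simp: V_def)
      then obtain b where b: "b \<in> K" "sg_word_map v b \<in> C" by auto
      have "infdist x C \<le> dist x (sg_word_map v b)" by (rule infdist_le[OF b(2)])
      also have "\<dots> = dist a b / 2 ^ m" using v(1) a by (simp add: dist_sg_word_map sg_words_def)
      also have "\<dots> \<le> D / 2 ^ m" using D a b by (simp add: divide_right_mono)
      finally show "x \<in> N m" using \<mu>.cell_subset[OF v(1)] a by (auto simp: N_def)
    qed
    then have "measure \<nu> ?U \<le> measure \<nu> (N m)"
      using Ncl[of m] by (intro \<nu>.finite_measure_mono) (auto simp: \<nu>.sets_mu_iff N_def)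
    with 1 2 show ?thesis by linarith
  qed
  have D0: "D \<ge> 0" using D \<mu>.K_nonempty by (metis dist_self ex_in_conv)
  have dec: "decseq N"
  proof (rule decseq_SucI)
    show "N (Suc m) \<subseteq> N m" for m
    proof -
      have "D / 2 ^ Suc m \<le> D / 2 ^ m" using D0 by (intro divide_left_mono) auto
      then show ?thesis by (auto simp: N_def)
    qed
  qed
  have "(\<Inter>m. N m) = C"
  proof (intro equalityI subsetI)
    fix x assume "x \<in> (\<Inter>m. N m)"
    then have x: "infdist x C \<le> D / 2 ^ m" for m by (auto simp: N_def)
    have "(\<lambda>m. D / 2 ^ m) \<longlonglongrightarrow> 0"
      using LIMSEQ_divide_realpow_zero[of 2 D] by simp
    then have "infdist x C \<le> 0" using x by (intro LIMSEQ_le_const) auto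
    then have "infdist x C = 0" using infdist_nonneg[of x C] by linarith
    then show "x \<in> C" using in_closed_iff_infdist_zero[OF C(1) False] by simp
  qed (use C D0 in \<open>auto simp: N_def\<close>)
  moreover have "(\<lambda>m. measure \<nu> (N m)) \<longlonglongrightarrow> measure \<nu> (\<Inter>m. N m)"
  proof (rule \<nu>.finite_Lim_measure_decseq[OF _ dec])
    have "N m \<in> sets \<nu>" for m using Ncl[of m] by (auto simp: \<nu>.sets_mu_iff N_def)
    then show "range N \<subseteq> sets \<nu>" by auto
  qed
  ultimately show ?thesis using le by (intro LIMSEQ_le_const) auto
qed simp

text \<open>The inequality for closed sets holds in both directions, and closed sets are stable
  under intersection and generate the Borel sets. The map \<open>id\<close> serves to view both
  measures on the whole plane.\<close>

lemma gasket_measure_unique: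
  assumes "gasket K \<mu>" "gasket K \<nu>"
  shows "\<mu> = \<nu>"
proof -
  interpret \<mu>: gasket K \<mu> by fact
  interpret \<nu>: gasket K \<nu> by fact
  have id: "id \<in> borel_measurable \<mu>" "id \<in> borel_measurable \<nu>"
    by (auto intro!: \<mu>.continuous_on_measurable \<nu>.continuous_on_measurable continuous_on_id')
  have "distr \<mu> borel id = distr \<nu> borel id"
  proof (rule measure_eqI_generator_eq[where E = "{S. closed S}" and \<Omega> = UNIV and A = "\<lambda>_. UNIV"])
    fix S :: "complex set" assume "S \<in> {S. closed S}"
    then have S: "closed S" "closed (S \<inter> K)" using compact_imp_closed[OF \<mu>.compact_K] by auto
    have "measure \<mu> (S \<inter> K) = measure \<nu> (S \<inter> K)"
      by (intro antisym gasket_measure_closed_le[OF assms] gasket_measure_closed_le[OF assms(2,1)] S) auto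
    then show "emeasure (distr \<mu> borel id) S = emeasure (distr \<nu> borel id) S"
      using id S by (simp add: emeasure_distr \<mu>.space_mu \<nu>.space_mu \<mu>.emeasure_eq_measure \<nu>.emeasure_eq_measure)
  next
    show "emeasure (distr \<mu> borel id) UNIV \<noteq> \<infinity>"
      using id by (simp add: emeasure_distr)
  qed (auto simp: Int_stable_def borel_eq_closed)
  then have eq: "emeasure (distr \<mu> borel id) A = emeasure (distr \<nu> borel id) A" for A by simp
  show ?thesis
  proof (rule measure_eqI)
    fix A assume "A \<in> sets \<mu>"
    then have "A \<subseteq> K" "A \<in> sets borel" by (auto simp: \<mu>.sets_mu_iff)
    then show "emeasure \<mu> A = emeasure \<nu> A"
      using eq[of A] id by (simp add: emeasure_distr \<mu>.space_mu \<nu>.space_mu Int_absorb2)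
  qed (simp add: \<mu>.sets_mu \<nu>.sets_mu)
qed

section \<open>Transport of measure and integrals between a cell and the gasket\<close>

locale gasket_cell = gasket +
  fixes w :: "nat list" and n :: nat
  assumes word: "w \<in> sg_words n"
begin

abbreviation "F \<equiv> sg_word_map w"
abbreviation "\<mu>w \<equiv> cell_measure K \<mu> w"

lemma length_w: "length w = n" using word by (simp add: sg_words_def)

lemma FK_subset: "F ` K \<subseteq> K" by (rule cell_subset[OF word])

lemma FK_sets: "F ` K \<in> sets \<mu>" by (rule cell_sets[OF word])

lemma inv_F [simp]: "inv F (F x) = x" by (rule inv_f_f[OF inj_sg_word_map])

lemma space_cell: "space \<mu>w = F ` K"
  using FK_subset by (auto simp: cell_measure_def cell_def space_restrict_space space_mu)

lemma sets_cell_iff: "A \<in> sets \<mu>w \<longleftrightarrow> A \<subseteq> F ` K \<and> A \<in> sets borel"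
  using FK_sets FK_subset unfolding cell_measure_def cell_def
  by (subst sets_restrict_space_iff) (auto simp: sets_mu_iff space_mu Int_absorb2)

lemma emeasure_cell: "A \<in> sets \<mu>w \<Longrightarrow> emeasure \<mu>w A = emeasure \<mu> A"
  using FK_sets FK_subset unfolding cell_measure_def cell_def
  by (intro emeasure_restrict_space) (auto simp: sets_restrict_space_iff space_mu Int_absorb2)

lemma measurable_F: "F \<in> measurable \<mu> \<mu>w"
proof (rule measurableI)
  fix A assume "A \<in> sets \<mu>w"
  then have "A \<in> sets borel" by (simp add: sets_cell_iff)
  with continuous_on_measurable[OF continuous_on_sg_word_map]
  show "F -` A \<inter> space \<mu> \<in> sets \<mu>" by (rule measurable_sets)
qed (simp add: space_mu space_cell)

lemma measurable_inv_F: "inv F \<in> measurable \<mu>w \<mu>"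
proof (rule measurableI)
  fix A assume "A \<in> sets \<mu>"
  then have A: "A \<in> sets borel" "A \<subseteq> K" by (simp_all add: sets_mu_iff)
  have "inv F \<in> borel_measurable borel"
    by (rule borel_measurable_continuous_onI) (rule continuous_on_inv_sg_word_map)
  from measurable_sets[OF this A(1)] have "inv F -` A \<inter> space borel \<in> sets borel" .
  then show "inv F -` A \<inter> space \<mu>w \<in> sets \<mu>w"
    using FK_sets unfolding sets_cell_iff by (auto simp: space_cell sets_mu_iff)
qed (auto simp: space_mu space_cell)

lemma image_F_eq: "A \<subseteq> K \<Longrightarrow> F ` A = inv F -` A \<inter> space \<mu>w"
  by (auto simp: space_cell)

text \<open>Carried back to K and multiplied by 3 ^ n, the measure of the cell gives the cell of a
  word v of length m the mass 3 ^ n / 3 ^ (n + m), because F maps it onto the cell of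
  \<open>w @ v\<close>. The result is again a gasket measure, and uniqueness applies.\<close>

lemma emeasure_image_F:
  assumes "A \<in> sets \<mu>"
  shows "emeasure \<mu> A = 3 ^ n * emeasure \<mu> (F ` A)"
proof -
  define \<nu> where "\<nu> = scale_measure (3 ^ n) (distr \<mu>w (restrict_space borel K) (inv F))"
  have inv: "inv F \<in> measurable \<mu>w (restrict_space borel K)"
    using measurable_inv_F by (simp add: measurable_cong_sets[OF refl sets_mu])
  have sets\<nu>: "sets \<nu> = sets (restrict_space borel K)" by (simp add: \<nu>_def)
  have em: "emeasure \<nu> B = 3 ^ n * emeasure \<mu> (F ` B)" if "B \<in> sets \<mu>" for B
  proof -
    have B: "B \<subseteq> K" "B \<in> sets (restrict_space borel K)" using that sets_mu sets_mu_iff by auto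
    have "emeasure \<nu> B = 3 ^ n * emeasure \<mu>w (F ` B)"
      using B inv by (simp add: \<nu>_def emeasure_distr image_F_eq)
    also have "emeasure \<mu>w (F ` B) = emeasure \<mu> (F ` B)"
      unfolding image_F_eq[OF B(1)] by (intro emeasure_cell measurable_sets[OF measurable_inv_F that])
    finally show ?thesis .
  qed
  have cell: "emeasure \<nu> (sg_word_map v ` K) = ennreal (1 / 3 ^ m)" if v: "v \<in> sg_words m" for v m
  proof -
    have "F ` sg_word_map v ` K = sg_word_map (w @ v) ` K" by (simp add: sg_word_map_append image_comp)
    then have "emeasure \<nu> (sg_word_map v ` K) = 3 ^ n * ennreal (1 / 3 ^ (n + m))"
      using em[OF cell_sets[OF v]] measure_cell[OF sg_words_append[OF word v]] by (simp add: emeasure_eq_measure)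
    also have "\<dots> = ennreal (3 ^ n * (1 / 3 ^ (n + m)))"
      by (subst ennreal_mult) (simp_all flip: ennreal_power)
    also have "3 ^ n * (1 / 3 ^ (n + m)) = (1 / 3 ^ m :: real)" by (simp add: power_add)
    finally show ?thesis .
  qed
  have "gasket K \<nu>"
  proof
    show "is_gasket_measure K \<nu>"
      unfolding is_gasket_measure_def
    proof (intro conjI allI ballI)
      show "prob_space \<nu>"
      proof
        have "space \<nu> = K" using sets_eq_imp_space_eq[OF sets\<nu>] by (simp add: space_restrict_space)
        then show "emeasure \<nu> (space \<nu>) = 1" using cell[of "[]" 0] by (simp add: sg_words_def)
      qed
      show "measure \<nu> (sg_word_map v ` K) = 1 / 3 ^ m" if "v \<in> sg_words m" for m v
        using cell[OF that] by (simp add: measure_def)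
    qed (rule sets\<nu>)
  qed (rule K)
  then have "\<mu> = \<nu>" using gasket_measure_unique gasket_axioms by blast
  then show ?thesis using em[OF assms] by simp
qed

lemma distr_F: "distr \<mu> \<mu>w F = density \<mu>w (\<lambda>_. 3 ^ n)"
proof (rule measure_eqI)
  fix A assume "A \<in> sets (distr \<mu> \<mu>w F)"
  then have A: "A \<in> sets \<mu>w" by simp
  have "F ` (F -` A \<inter> space \<mu>) = A" using A by (auto simp: space_mu sets_cell_iff)
  then show "emeasure (distr \<mu> \<mu>w F) A = emeasure (density \<mu>w (\<lambda>_. 3 ^ n)) A"
    using emeasure_image_F[OF measurable_sets[OF measurable_F A]] A
    by (simp add: emeasure_distr measurable_F emeasure_density_const emeasure_cell)
qed simp

lemma finite_measure_cell: "finite_measure \<mu>w"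
  using emeasure_cell[of "F ` K"] FK_sets FK_subset
  by (intro finite_measureI) (auto simp: space_cell sets_cell_iff sets_mu_iff)

lemma measurable_comp_F_iff: "(\<lambda>x. f (F x)) \<in> borel_measurable \<mu> \<longleftrightarrow> f \<in> borel_measurable \<mu>w"
proof
  assume "(\<lambda>x. f (F x)) \<in> borel_measurable \<mu>"
  from measurable_compose[OF measurable_inv_F this] show "f \<in> borel_measurable \<mu>w"
    by (rule measurable_cong[THEN iffD1, rotated]) (auto simp: space_cell)
qed (rule measurable_compose[OF measurable_F])

lemma integrable_comp_F_iff:
  fixes f :: "complex \<Rightarrow> real"
  assumes "f \<in> borel_measurable \<mu>w"
  shows "integrable \<mu> (\<lambda>x. f (F x)) \<longleftrightarrow> integrable \<mu>w f"
proof -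
  have "integrable \<mu> (\<lambda>x. f (F x)) \<longleftrightarrow> integrable (density \<mu>w (\<lambda>_. ennreal (3 ^ n))) f"
    using integrable_distr_eq[OF measurable_F assms] distr_F by (simp flip: ennreal_power)
  also have "\<dots> \<longleftrightarrow> integrable \<mu>w f"
    using assms by (subst integrable_density) auto
  finally show ?thesis .
qed

lemma integral_comp_F:
  fixes f :: "complex \<Rightarrow> real"
  assumes "f \<in> borel_measurable \<mu>w"
  shows "(\<integral>x. f (F x) \<partial>\<mu>) = 3 ^ n * (\<integral>x. f x \<partial>\<mu>w)"
proof -
  have "(\<integral>x. f (F x) \<partial>\<mu>) = (\<integral>x. f x \<partial>density \<mu>w (\<lambda>_. ennreal (3 ^ n)))"
    using integral_distr[OF measurable_F assms] distr_F by (simp flip: ennreal_power)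
  also have "\<dots> = 3 ^ n * (\<integral>x. f x \<partial>\<mu>w)"
    using assms by (subst integral_density) auto
  finally show ?thesis .
qed

lemma Lp_set_comp_F_iff: "(\<lambda>x. f (F x)) \<in> Lp_set \<mu> p \<longleftrightarrow> f \<in> Lp_set \<mu>w p"
  using integrable_comp_F_iff[of "\<lambda>x. \<bar>f x\<bar> powr p"] by (auto simp: Lp_set_def measurable_comp_F_iff)

end

sublocale gasket_cell \<subseteq> cell: finite_measure \<mu>w by (rule finite_measure_cell)

section \<open>Square integrable functions\<close>

lemma abs_powr_2 [simp]: "\<bar>x :: real\<bar> powr 2 = x\<^sup>2"
  by (cases "x = 0") (simp_all add: powr_numeral)

lemma Lp_set_2_iff: "f \<in> Lp_set \<nu> 2 \<longleftrightarrow> f \<in> borel_measurable \<nu> \<and> integrable \<nu> (\<lambda>x. (f x)\<^sup>2)"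
  by (simp add: Lp_set_def)

text \<open>The p-th power of |a| is dominated by 1 plus the square of a, and constants have a
  finite integral. Potentials are obtained in L2; this makes them admissible integrands for every
  \<open>\<alpha>\<close> up to 2.\<close>

lemma (in finite_measure) Lp_set_2_subset:
  assumes "0 < p" "p \<le> 2" "f \<in> Lp_set M 2"
  shows "f \<in> Lp_set M p"
proof -
  have [measurable]: "f \<in> borel_measurable M" and int: "integrable M (\<lambda>x. 1 + (f x)\<^sup>2)"
    using assms by (auto simp: Lp_set_2_iff)
  have "\<bar>a\<bar> powr p \<le> 1 + a\<^sup>2" for a :: real
  proof (cases "\<bar>a\<bar> \<le> 1")
    case True
    then have "\<bar>a\<bar> powr p \<le> 1 powr p" using assms(1) by (intro powr_mono2) auto
    then show ?thesis by (simp add: add_increasing2)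
  next
    case False
    then have "\<bar>a\<bar> powr p \<le> \<bar>a\<bar> powr 2" using assms(2) by (intro powr_mono) auto
    then show ?thesis by simp
  qed
  then have "integrable M (\<lambda>x. \<bar>f x\<bar> powr p)"
    by (intro Bochner_Integration.integrable_bound[OF int]) auto
  then show ?thesis by (simp add: Lp_set_def)
qed

lemma Lp_set_cmult_iff:
  assumes "c \<noteq> 0"
  shows "(\<lambda>x. c * f x) \<in> Lp_set \<nu> p \<longleftrightarrow> f \<in> Lp_set \<nu> p"
proof -
  have i: "(\<lambda>x. c * f x) \<in> Lp_set \<nu> p" if "f \<in> Lp_set \<nu> p" for c f
    using that by (auto simp: Lp_set_def abs_mult powr_mult)
  from i[of "\<lambda>x. c * f x" "1/c"] i[of f c] assms show ?thesis by auto
qed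

lemma Lp_set_2_lincomb:
  assumes "f \<in> Lp_set \<nu> 2" "g \<in> Lp_set \<nu> 2"
  shows "(\<lambda>x. a * f x + b * g x) \<in> Lp_set \<nu> 2"
    and "(\<integral>x. (a * f x + b * g x)\<^sup>2 \<partial>\<nu>) \<le> (\<bar>a\<bar> + \<bar>b\<bar>)\<^sup>2 * ((\<integral>x. (f x)\<^sup>2 \<partial>\<nu>) + (\<integral>x. (g x)\<^sup>2 \<partial>\<nu>))"
  using Lp_set_lincomb[of 2 f \<nu> g a b] assms abs_powr_2[of "\<bar>a\<bar> + \<bar>b\<bar>"] by simp_all

lemma Lp_set_2_diff:
  assumes "f \<in> Lp_set \<nu> 2" "g \<in> Lp_set \<nu> 2"
  shows "(\<lambda>x. f x - g x) \<in> Lp_set \<nu> 2"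
    and "(\<integral>x. (f x - g x)\<^sup>2 \<partial>\<nu>) \<le> 4 * ((\<integral>x. (f x)\<^sup>2 \<partial>\<nu>) + (\<integral>x. (g x)\<^sup>2 \<partial>\<nu>))"
  using Lp_set_2_lincomb[OF assms, of 1 "-1"] by simp_all

lemma Lp_set_2_mult:
  assumes "f \<in> Lp_set \<nu> 2" "g \<in> Lp_set \<nu> 2"
  shows "integrable \<nu> (\<lambda>x. f x * g x)"
proof (rule Bochner_Integration.integrable_bound)
  show "integrable \<nu> (\<lambda>x. (f x)\<^sup>2 + (g x)\<^sup>2)" "(\<lambda>x. f x * g x) \<in> borel_measurable \<nu>"
    using assms by (auto simp: Lp_set_2_iff)
  have "\<bar>a * b\<bar> \<le> a\<^sup>2 + b\<^sup>2" for a b :: real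
  proof -
    have "2 * (\<bar>a\<bar> * \<bar>b\<bar>) \<le> a\<^sup>2 + b\<^sup>2" using sum_squares_bound[of "\<bar>a\<bar>" "\<bar>b\<bar>"] by simp
    moreover have "0 \<le> \<bar>a\<bar> * \<bar>b\<bar>" by simp
    ultimately show ?thesis unfolding abs_mult by linarith
  qed
  then show "AE x in \<nu>. norm (f x * g x) \<le> norm ((f x)\<^sup>2 + (g x)\<^sup>2)" by simp
qed

lemma L2_norm_tendsto_0_iff:
  "((\<lambda>n. L2_norm \<nu> (f n)) \<longlongrightarrow> 0) G \<longleftrightarrow> ((\<lambda>n. \<integral>x. (f n x)\<^sup>2 \<partial>\<nu>) \<longlongrightarrow> 0) G"
proof
  assume "((\<lambda>n. L2_norm \<nu> (f n)) \<longlongrightarrow> 0) G"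
  from tendsto_power[OF this, of 2] show "((\<lambda>n. \<integral>x. (f n x)\<^sup>2 \<partial>\<nu>) \<longlongrightarrow> 0) G"
    by (simp add: L2_norm_def)
next
  assume "((\<lambda>n. \<integral>x. (f n x)\<^sup>2 \<partial>\<nu>) \<longlongrightarrow> 0) G"
  from tendsto_real_sqrt[OF this] show "((\<lambda>n. L2_norm \<nu> (f n)) \<longlongrightarrow> 0) G"
    by (simp add: L2_norm_def)
qed

text \<open>The memberships belong to the notion because the integral of a function that is not
  integrable is 0 by default, so that the limit alone would carry no information.\<close>

definition L2_conv :: "'a measure \<Rightarrow> (nat \<Rightarrow> 'a \<Rightarrow> real) \<Rightarrow> ('a \<Rightarrow> real) \<Rightarrow> bool" where
  "L2_conv \<nu> S g \<longleftrightarrow> (\<forall>n. S n \<in> Lp_set \<nu> 2) \<and> g \<in> Lp_set \<nu> 2 \<and> (\<lambda>n. \<integral>x. (S n x - g x)\<^sup>2 \<partial>\<nu>) \<longlonglongrightarrow> 0"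

lemma L2_conv_L2_lim:
  assumes "L2_conv \<nu> S g"
  shows "L2_conv \<nu> S (L2_lim \<nu> S)"
proof -
  have "\<exists>g. g \<in> Lp_set \<nu> 2 \<and> (\<lambda>n. L2_norm \<nu> (\<lambda>x. S n x - g x)) \<longlonglongrightarrow> 0"
    using assms by (auto simp: L2_conv_def L2_norm_tendsto_0_iff)
  from someI_ex[OF this] show ?thesis
    using assms by (simp add: L2_conv_def L2_lim_def L2_norm_tendsto_0_iff)
qed

lemma L2_conv_lincomb:
  assumes S: "L2_conv \<nu> S f" and T: "L2_conv \<nu> T g"
  shows "L2_conv \<nu> (\<lambda>n x. a * S n x + b * T n x) (\<lambda>x. a * f x + b * g x)"
  unfolding L2_conv_def
proof (intro conjI allI)
  note L = S[unfolded L2_conv_def] T[unfolded L2_conv_def]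
  show "(\<lambda>x. a * S n x + b * T n x) \<in> Lp_set \<nu> 2" "(\<lambda>x. a * f x + b * g x) \<in> Lp_set \<nu> 2" for n
    using L by (auto intro: Lp_set_2_lincomb)
  show "(\<lambda>n. \<integral>x. (a * S n x + b * T n x - (a * f x + b * g x))\<^sup>2 \<partial>\<nu>) \<longlonglongrightarrow> 0"
  proof (rule squeeze_zero)
    show "(\<integral>x. (a * S n x + b * T n x - (a * f x + b * g x))\<^sup>2 \<partial>\<nu>) \<le>
      (\<bar>a\<bar> + \<bar>b\<bar>)\<^sup>2 * ((\<integral>x. (S n x - f x)\<^sup>2 \<partial>\<nu>) + (\<integral>x. (T n x - g x)\<^sup>2 \<partial>\<nu>))" for n
      using Lp_set_2_lincomb(2)[OF Lp_set_2_diff(1)[of "S n" \<nu> f] Lp_set_2_diff(1)[of "T n" \<nu> g], of a b] L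
      by (simp add: algebra_simps)
    show "(\<lambda>n. (\<bar>a\<bar> + \<bar>b\<bar>)\<^sup>2 * ((\<integral>x. (S n x - f x)\<^sup>2 \<partial>\<nu>) + (\<integral>x. (T n x - g x)\<^sup>2 \<partial>\<nu>))) \<longlonglongrightarrow> 0"
      using L by (intro tendsto_mult_right_zero tendsto_add_zero) auto
  qed simp
qed

lemma L2_conv_cong:
  assumes S: "L2_conv \<nu> S f" and "\<And>n. T n \<in> Lp_set \<nu> 2" "\<And>n. AE x in \<nu>. S n x = T n x"
  shows "L2_conv \<nu> T f"
proof -
  have "(\<integral>x. (S n x - f x)\<^sup>2 \<partial>\<nu>) = (\<integral>x. (T n x - f x)\<^sup>2 \<partial>\<nu>)" for n
    using assms(2,3)[of n] S
    by (intro integral_cong_AE borel_measurable_power borel_measurable_diff) (auto simp: L2_conv_def Lp_set_2_iff)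
  then show ?thesis using S assms(2) by (simp add: L2_conv_def)
qed

lemma AE_eq_of_integral_square:
  assumes "f \<in> Lp_set \<nu> 2" "g \<in> Lp_set \<nu> 2" "(\<integral>x. (f x - g x)\<^sup>2 \<partial>\<nu>) = 0"
  shows "AE x in \<nu>. f x = g x"
proof -
  have "integrable \<nu> (\<lambda>x. (f x - g x)\<^sup>2)" using Lp_set_2_diff(1)[OF assms(1,2)] by (simp add: Lp_set_2_iff)
  with assms(3) have "AE x in \<nu>. (f x - g x)\<^sup>2 = 0"
    by (subst (asm) integral_nonneg_eq_0_iff_AE) auto
  then show ?thesis by eventually_elim simp
qed

lemma L2_conv_unique:
  assumes "L2_conv \<nu> S f" "L2_conv \<nu> S g"
  shows "AE x in \<nu>. f x = g x"
proof (rule AE_eq_of_integral_square)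
  show "f \<in> Lp_set \<nu> 2" "g \<in> Lp_set \<nu> 2" using assms by (auto simp: L2_conv_def)
  from L2_conv_lincomb[OF assms, of 1 "-1"] have "(\<lambda>n::nat. \<integral>x. (f x - g x)\<^sup>2 \<partial>\<nu>) \<longlonglongrightarrow> 0"
    by (simp add: L2_conv_def power2_commute)
  then show "(\<integral>x. (f x - g x)\<^sup>2 \<partial>\<nu>) = 0" by (simp add: LIMSEQ_const_iff)
qed

lemma L2_conv_Cauchy:
  assumes S: "L2_conv \<nu> S f" and "e > 0"
  shows "\<exists>N. \<forall>m\<ge>N. \<forall>n\<ge>N. (\<integral>x. (S m x - S n x)\<^sup>2 \<partial>\<nu>) < e"
proof -
  have L: "\<And>n. S n \<in> Lp_set \<nu> 2" "f \<in> Lp_set \<nu> 2" "(\<lambda>n. \<integral>x. (S n x - f x)\<^sup>2 \<partial>\<nu>) \<longlonglongrightarrow> 0"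
    using S by (auto simp: L2_conv_def)
  from LIMSEQ_D[OF L(3), of "e/8"] \<open>e > 0\<close> obtain N where N: "\<And>n. n \<ge> N \<Longrightarrow> (\<integral>x. (S n x - f x)\<^sup>2 \<partial>\<nu>) < e/8"
    by auto
  have "(\<integral>x. (S m x - S n x)\<^sup>2 \<partial>\<nu>) < e" if "m \<ge> N" "n \<ge> N" for m n
    using Lp_set_2_diff(2)[OF Lp_set_2_diff(1)[OF L(1)[of m] L(2)] Lp_set_2_diff(1)[OF L(1)[of n] L(2)]]
      N[OF that(1)] N[OF that(2)] by simp
  then show ?thesis by blast
qed

section \<open>Completeness of the space of square integrable functions\<close>

context finite_measure
begin

lemma Lp_set_2_integrable:
  assumes "f \<in> Lp_set M 2"
  shows "integrable M f"
proof -
  have "(\<lambda>_. 1) \<in> Lp_set M 2" by (simp add: Lp_set_2_iff)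
  from Lp_set_2_mult[OF assms this] show ?thesis by simp
qed

text \<open>A substitute for the Cauchy-Schwarz inequality; the free parameter
  \<open>\<delta>\<close> is balanced against the size of the square integral.\<close>

lemma integral_abs_le:
  assumes "f \<in> Lp_set M 2" "\<delta> > 0"
  shows "(\<integral>x. \<bar>f x\<bar> \<partial>M) \<le> \<delta> * measure M (space M) + (\<integral>x. (f x)\<^sup>2 \<partial>M) / \<delta>"
proof -
  have int: "integrable M f" "integrable M (\<lambda>x. (f x)\<^sup>2)"
    using assms(1) Lp_set_2_integrable[OF assms(1)] by (auto simp: Lp_set_2_iff)
  have "\<bar>a\<bar> \<le> \<delta> + a\<^sup>2 / \<delta>" for a :: real
  proof (cases "\<bar>a\<bar> \<le> \<delta>")
    case False
    then have "\<bar>a\<bar> * \<delta> \<le> \<bar>a\<bar> * \<bar>a\<bar>" by (intro mult_left_mono) auto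
    then have "\<bar>a\<bar> \<le> a\<^sup>2 / \<delta>" using assms(2) by (simp add: field_simps power2_eq_square)
    then show ?thesis using assms(2) by simp
  qed (use assms(2) in \<open>simp add: add_increasing2\<close>)
  then have "(\<integral>x. \<bar>f x\<bar> \<partial>M) \<le> (\<integral>x. \<delta> + (f x)\<^sup>2 / \<delta> \<partial>M)"
    using int by (intro integral_mono) auto
  also have "\<dots> = \<delta> * measure M (space M) + (\<integral>x. (f x)\<^sup>2 \<partial>M) / \<delta>"
    using int by simp
  finally show ?thesis .
qed

text \<open>Along a fast subsequence the increments are absolutely summable almost everywhere, which
  produces the limit g. No dominating function is at hand, so the distance to g is bounded by
  Fatou's lemma.\<close>

lemma L2_complete:
  assumes S: "\<And>n. S n \<in> Lp_set M 2"
    and Cauchy: "\<And>e. e > 0 \<Longrightarrow> \<exists>N. \<forall>m\<ge>N. \<forall>n\<ge>N. (\<integral>x. (S m x - S n x)\<^sup>2 \<partial>M) < e"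
  shows "\<exists>g. L2_conv M S g"
proof -
  let ?N = "\<lambda>m n. \<integral>x. (S m x - S n x)\<^sup>2 \<partial>M"
  have meas[measurable]: "S n \<in> borel_measurable M" for n using S by (simp add: Lp_set_2_iff)
  obtain r' where r': "strict_mono r'" "\<And>k m n. r' k \<le> m \<Longrightarrow> r' k \<le> n \<Longrightarrow> ?N m n < (1/2) ^ k"
    using Cauchy_fast_subseq[of ?N, OF Cauchy] by blast
  \<comment> \<open>Doubling the index improves the rate to (1/4) ^ k; divided by
    \<open>\<delta>\<close> = (1/2) ^ k it still leaves a summable (1/2) ^ k.\<close>
  define r where "r k = r' (2 * k)" for k
  have r: "strict_mono r" "\<And>k m n. r k \<le> m \<Longrightarrow> r k \<le> n \<Longrightarrow> ?N m n < (1/4) ^ k"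
  proof -
    show "strict_mono r" using r'(1) by (auto simp: r_def strict_mono_def)
    have "(1/2) ^ (2 * k) = (1/4 :: real) ^ k" for k by (simp add: power_mult power_divide)
    then show "?N m n < (1/4) ^ k" if "r k \<le> m" "r k \<le> n" for k m n
      using r'(2)[of "2 * k" m n] that by (simp add: r_def)
  qed
  have d: "(\<lambda>x. S m x - S n x) \<in> Lp_set M 2" for m n by (intro Lp_set_2_diff S)
  have "AE x in M. summable (\<lambda>k. \<bar>S (r (Suc k)) x - S (r k) x\<bar>)"
  proof (rule AE_summable_integral)
    show "summable (\<lambda>k. \<integral>x. \<bar>S (r (Suc k)) x - S (r k) x\<bar> \<partial>M)"
    proof (rule summable_comparison_test')
      show "summable (\<lambda>k. (measure M (space M) + 1) * (1/2) ^ k :: real)" by (intro summable_mult summable_geometric) simp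
      show "norm (\<integral>x. \<bar>S (r (Suc k)) x - S (r k) x\<bar> \<partial>M) \<le> (measure M (space M) + 1) * (1/2) ^ k" if "k \<ge> 0" for k
      proof -
        have "?N (r (Suc k)) (r k) \<le> (1/4) ^ k"
          using r(2)[of k "r (Suc k)" "r k"] strict_monoD[OF r(1), of k "Suc k"] by (auto intro: less_imp_le)
        then have "?N (r (Suc k)) (r k) / (1/2) ^ k \<le> (1/4) ^ k / (1/2) ^ k"
          by (intro divide_right_mono) auto
        also have "(1/4) ^ k / (1/2) ^ k = (1/2 :: real) ^ k" by (simp flip: power_divide)
        finally show ?thesis
          using integral_abs_le[OF d, of "(1/2) ^ k" "r (Suc k)" "r k"] by (simp add: algebra_simps)
      qed
    qed
    show "integrable M (\<lambda>x. \<bar>S (r (Suc k)) x - S (r k) x\<bar>)" for k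
      using Lp_set_2_integrable[OF d] by auto
  qed auto
  then have conv: "AE x in M. convergent (\<lambda>k. S (r k) x)"
  proof eventually_elim
    case (elim x)
    then have "summable (\<lambda>k. S (r (Suc k)) x - S (r k) x)" by (rule summable_rabs_cancel)
    then have "convergent (\<lambda>n. \<Sum>k<n. S (r (Suc k)) x - S (r k) x)" by (simp add: summable_iff_convergent)
    then have "convergent (\<lambda>n. S (r n) x - S (r 0) x)" by (simp only: sum_lessThan_telescope[of "\<lambda>k. S (r k) x"])
    from convergent_add[OF this convergent_const[of "S (r 0) x"]] show ?case by simp
  qed
  define g where "g x = lim (\<lambda>k. S (r k) x)" for x
  have g[measurable]: "g \<in> borel_measurable M" unfolding g_def by measurable
  have nn: "(\<integral>\<^sup>+x. ennreal ((S m x - g x)\<^sup>2) \<partial>M) \<le> ennreal ((1/4) ^ k)" if "m \<ge> r k" for m k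
  proof -
    have "AE x in M. ennreal ((S m x - g x)\<^sup>2) = liminf (\<lambda>i. ennreal ((S m x - S (r i) x)\<^sup>2))"
      using conv
    proof eventually_elim
      case (elim x)
      then have "(\<lambda>i. ennreal ((S m x - S (r i) x)\<^sup>2)) \<longlonglongrightarrow> ennreal ((S m x - g x)\<^sup>2)"
        by (intro tendsto_intros tendsto_ennrealI) (simp add: g_def convergent_LIMSEQ_iff)
      then show ?case by (intro lim_imp_Liminf[symmetric]) auto
    qed
    then have "(\<integral>\<^sup>+x. ennreal ((S m x - g x)\<^sup>2) \<partial>M) = (\<integral>\<^sup>+x. liminf (\<lambda>i. ennreal ((S m x - S (r i) x)\<^sup>2)) \<partial>M)"
      by (rule nn_integral_cong_AE)
    also have "\<dots> \<le> liminf (\<lambda>i. \<integral>\<^sup>+x. ennreal ((S m x - S (r i) x)\<^sup>2) \<partial>M)"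
      by (rule nn_integral_liminf) simp
    also have "\<dots> \<le> ennreal ((1/4) ^ k)"
    proof (rule Liminf_le)
      have "(\<integral>\<^sup>+x. ennreal ((S m x - S (r i) x)\<^sup>2) \<partial>M) \<le> ennreal ((1/4) ^ k)" if "i \<ge> k" for i
      proof -
        have "r k \<le> r i" using strict_mono_mono[OF r(1)] that by (simp add: mono_def)
        then show ?thesis using r(2)[of k m "r i"] d[of m "r i"] \<open>m \<ge> r k\<close>
          by (subst nn_integral_eq_integral) (auto simp: Lp_set_2_iff intro!: ennreal_leI less_imp_le)
      qed
      then show "\<forall>\<^sub>F i in sequentially. (\<integral>\<^sup>+x. ennreal ((S m x - S (r i) x)\<^sup>2) \<partial>M) \<le> ennreal ((1/4) ^ k)"
        by (auto simp: eventually_sequentially)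
    qed simp
    finally show ?thesis .
  qed
  have int: "integrable M (\<lambda>x. (S m x - g x)\<^sup>2)" "(\<integral>x. (S m x - g x)\<^sup>2 \<partial>M) \<le> (1/4) ^ k" if "m \<ge> r k" for m k
  proof -
    show i: "integrable M (\<lambda>x. (S m x - g x)\<^sup>2)"
      using nn[OF that] by (intro integrableI_bounded) (auto intro: le_less_trans)
    show "(\<integral>x. (S m x - g x)\<^sup>2 \<partial>M) \<le> (1/4) ^ k"
      using nn[OF that] by (subst (asm) nn_integral_eq_integral[OF i]) (auto simp: ennreal_le_iff)
  qed
  have "(\<lambda>x. S (r 0) x - g x) \<in> Lp_set M 2" using int(1)[of 0] by (simp add: Lp_set_2_iff)
  from Lp_set_2_diff(1)[OF S[of "r 0"] this] have gL: "g \<in> Lp_set M 2" by simp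
  have "(\<lambda>m. \<integral>x. (S m x - g x)\<^sup>2 \<partial>M) \<longlonglongrightarrow> 0"
  proof (rule LIMSEQ_I)
    fix e :: real assume "e > 0"
    then obtain k where k: "(1/4)^k < e" using real_arch_pow_inv[of e "1/4"] by auto
    then have "norm ((\<integral>x. (S m x - g x)\<^sup>2 \<partial>M) - 0) < e" if "m \<ge> r k" for m
      using int(2)[OF that] by simp
    then show "\<exists>N. \<forall>m\<ge>N. norm ((\<integral>x. (S m x - g x)\<^sup>2 \<partial>M) - 0) < e" by blast
  qed
  then show ?thesis using S gL by (auto simp: L2_conv_def)
qed

end

section \<open>Negative powers and the Sobolev completion\<close>

locale orthonormal_system = finite_measure M for M :: "'a measure" +
  fixes \<Phi> :: "nat \<Rightarrow> 'a \<Rightarrow> real"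
  assumes Phi_L2: "\<And>j. \<Phi> j \<in> Lp_set M 2"
    and orthonormal: "\<And>i j. (\<integral>x. \<Phi> i x * \<Phi> j x \<partial>M) = (if i = j then 1 else 0)"
begin

lemma span_L2: "finite A \<Longrightarrow> (\<lambda>x. \<Sum>j\<in>A. a j * \<Phi> j x) \<in> Lp_set M 2"
proof (induction A rule: finite_induct)
  case (insert j A)
  then show ?case using Lp_set_2_lincomb(1)[OF Phi_L2[of j] insert.IH, of "a j" 1] by simp
qed (simp add: Lp_set_2_iff)

lemma integral_span_mult:
  assumes "finite A" "f \<in> Lp_set M 2"
  shows "(\<integral>x. (\<Sum>j\<in>A. a j * \<Phi> j x) * f x \<partial>M) = (\<Sum>j\<in>A. a j * (\<integral>x. \<Phi> j x * f x \<partial>M))"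
  using Lp_set_2_mult[OF Phi_L2 assms(2)]
  by (simp add: sum_distrib_right mult.assoc Bochner_Integration.integral_sum)

lemma integral_span_square:
  assumes "finite A"
  shows "(\<integral>x. (\<Sum>j\<in>A. a j * \<Phi> j x)\<^sup>2 \<partial>M) = (\<Sum>j\<in>A. (a j)\<^sup>2)"
proof -
  have "(\<integral>x. \<Phi> j x * (\<Sum>i\<in>A. a i * \<Phi> i x) \<partial>M) = a j" if "j \<in> A" for j
  proof -
    have "(\<integral>x. \<Phi> j x * (\<Sum>i\<in>A. a i * \<Phi> i x) \<partial>M) = (\<Sum>i\<in>A. a i * (\<integral>x. \<Phi> i x * \<Phi> j x \<partial>M))"
      using integral_span_mult[OF assms Phi_L2, of a j] by (simp add: mult.commute)
    then show ?thesis using assms that by (simp add: orthonormal if_distrib[of "\<lambda>c. _ * c"] cong: if_cong)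
  qed
  then show ?thesis
    unfolding power2_eq_square by (subst integral_span_mult[OF assms span_L2[OF assms]]) simp
qed

lemma bessel:
  assumes "finite A" "f \<in> Lp_set M 2"
  shows "(\<Sum>j\<in>A. (\<integral>x. \<Phi> j x * f x \<partial>M)\<^sup>2) \<le> (\<integral>x. (f x)\<^sup>2 \<partial>M)"
proof -
  let ?c = "\<lambda>j. \<integral>x. \<Phi> j x * f x \<partial>M" and ?S = "\<lambda>x. \<Sum>j\<in>A. (\<integral>x. \<Phi> j x * f x \<partial>M) * \<Phi> j x"
  have S: "?S \<in> Lp_set M 2" by (rule span_L2[OF assms(1)])
  have "0 \<le> (\<integral>x. (f x - ?S x)\<^sup>2 \<partial>M)" by simp
  also have "\<dots> = (\<integral>x. (f x)\<^sup>2 - 2 * (?S x * f x) + (?S x)\<^sup>2 \<partial>M)"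
    by (intro Bochner_Integration.integral_cong) (auto simp: power2_diff algebra_simps)
  also have "\<dots> = (\<integral>x. (f x)\<^sup>2 \<partial>M) - 2 * (\<integral>x. ?S x * f x \<partial>M) + (\<integral>x. (?S x)\<^sup>2 \<partial>M)"
    using S assms(2) Lp_set_2_mult[OF S assms(2)] by (simp add: Lp_set_2_iff)
  also have "\<dots> = (\<integral>x. (f x)\<^sup>2 \<partial>M) - (\<Sum>j\<in>A. (?c j)\<^sup>2)"
    unfolding integral_span_square[OF assms(1)] integral_span_mult[OF assms] by (simp add: power2_eq_square)
  finally show ?thesis by simp
qed

lemma summable_coeffs:
  assumes "f \<in> Lp_set M 2"
  shows "summable (\<lambda>j. (\<integral>x. \<Phi> j x * f x \<partial>M)\<^sup>2)"
  by (rule bounded_imp_summable[OF zero_le_power2 bessel[OF finite_atMost assms]])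

end

text \<open>The lower bound l keeps the factors \<open>lam j powr (- s)\<close> bounded, so that
  Bessel's inequality makes the defining series converge in L2. The locale is instantiated for the
  gasket and for a cell, both times with l = \<open>lam 0\<close>.\<close>

locale negative_powers = orthonormal_system M \<Phi> for M :: "'a measure" and \<Phi> +
  fixes lam :: "nat \<Rightarrow> real" and l s :: real
  assumes lam: "\<And>j. l \<le> lam j" and l_pos: "0 < l" and s_pos: "0 < s"
begin

abbreviation "T \<equiv> neg_power M lam \<Phi> s"

definition part :: "('a \<Rightarrow> real) \<Rightarrow> nat \<Rightarrow> 'a \<Rightarrow> real" where
  "part f N x = (\<Sum>j<N. lam j powr (- s) * (\<integral>z. \<Phi> j z * f z \<partial>M) * \<Phi> j x)"

lemma part_conv:
  assumes f: "f \<in> Lp_set M 2"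
  shows "L2_conv M (part f) (T f)"
proof -
  let ?c = "\<lambda>j. \<integral>x. \<Phi> j x * f x \<partial>M" and ?a = "\<lambda>j. lam j powr (- s) * (\<integral>x. \<Phi> j x * f x \<partial>M)"
  have L: "part f N \<in> Lp_set M 2" for N
    using span_L2[of "{..<N}" ?a] by (simp add: part_def[abs_def])
  have le: "(?a j)\<^sup>2 \<le> (l powr (- s))\<^sup>2 * (?c j)\<^sup>2" for j
  proof -
    have "lam j powr (- s) \<le> l powr (- s)"
      using powr_mono2'[of "- s" l "lam j"] lam[of j] l_pos s_pos by simp
    then show ?thesis by (simp add: power_mult_distrib power_mono mult_right_mono)
  qed
  have summ: "summable (\<lambda>j. (?a j)\<^sup>2)"
    by (rule summable_comparison_test'[OF summable_mult[OF summable_coeffs[OF f], of "(l powr (- s))\<^sup>2"]])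
      (use le in auto)
  have ordered: "(\<integral>x. (part f n x - part f m x)\<^sup>2 \<partial>M) = (\<Sum>j\<in>{m..<n}. (?a j)\<^sup>2)" if "m \<le> n" for m n
  proof -
    have "part f n x - part f m x = (\<Sum>j\<in>{m..<n}. ?a j * \<Phi> j x)" for x
      using sum_diff_nat_ivl[of 0 m n "\<lambda>j. ?a j * \<Phi> j x"] that by (simp add: part_def atLeast0LessThan)
    then show ?thesis by (simp add: integral_span_square)
  qed
  have "\<exists>N. \<forall>m\<ge>N. \<forall>n\<ge>N. (\<integral>x. (part f m x - part f n x)\<^sup>2 \<partial>M) < e" if "e > 0" for e
  proof -
    from summ[unfolded summable_Cauchy] that obtain N where
      N: "\<And>m n. m \<ge> N \<Longrightarrow> norm (\<Sum>j\<in>{m..<n}. (?a j)\<^sup>2) < e" by blast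
    have "(\<integral>x. (part f m x - part f n x)\<^sup>2 \<partial>M) < e" if "m \<ge> N" "n \<ge> N" for m n
    proof (cases "m \<le> n")
      case True
      have "(\<integral>x. (part f m x - part f n x)\<^sup>2 \<partial>M) = (\<Sum>j\<in>{m..<n}. (?a j)\<^sup>2)"
        using ordered[OF True] by (simp add: power2_commute)
      then show ?thesis using N[OF that(1), of n] by auto
    next
      case False
      then show ?thesis using ordered[of n m] N[OF that(2), of m] by auto
    qed
    then show ?thesis by blast
  qed
  from L2_complete[OF L this] obtain g where "L2_conv M (part f) g" by blast
  then have "L2_conv M (part f) (L2_lim M (part f))" by (rule L2_conv_L2_lim)
  then show ?thesis by (simp add: neg_power_def part_def[abs_def])
qed

lemma T_L2: "f \<in> Lp_set M 2 \<Longrightarrow> T f \<in> Lp_set M 2"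
  using part_conv by (auto simp: L2_conv_def)

text \<open>Partial sums are linear in f, and limits in square mean are unique up to null sets.
  Pointwise equality cannot be expected, since each image under T is a selected version.\<close>

lemma T_diff:
  assumes "f \<in> Lp_set M 2" "g \<in> Lp_set M 2"
  shows "AE x in M. T (\<lambda>x. f x - g x) x = T f x - T g x"
proof -
  have "part (\<lambda>x. f x - g x) = (\<lambda>N x. 1 * part f N x + (-1) * part g N x)"
    using Lp_set_2_mult[OF Phi_L2 assms(1)] Lp_set_2_mult[OF Phi_L2 assms(2)]
    by (simp add: fun_eq_iff part_def right_diff_distrib left_diff_distrib sum_subtractf)
  then have "L2_conv M (\<lambda>N x. 1 * part f N x + (-1) * part g N x) (T (\<lambda>x. f x - g x))"
    using part_conv[OF Lp_set_2_diff(1)[OF assms]] by simp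
  from L2_conv_unique[OF this L2_conv_lincomb[OF part_conv[OF assms(1)] part_conv[OF assms(2)]]]
  show ?thesis by simp
qed

lemma sobolev_norm_diff:
  assumes "f \<in> Lp_set M 2" "g \<in> Lp_set M 2"
  shows "sobolev_norm M lam \<Phi> s (\<lambda>x. f x - g x) = sqrt (\<integral>x. (T f x - T g x)\<^sup>2 \<partial>M)"
proof -
  have "(\<integral>x. (T (\<lambda>x. f x - g x) x)\<^sup>2 \<partial>M) = (\<integral>x. (T f x - T g x)\<^sup>2 \<partial>M)"
    using T_diff[OF assms] T_L2[OF assms(1)] T_L2[OF assms(2)] T_L2[OF Lp_set_2_diff(1)[OF assms]]
    by (intro integral_cong_AE borel_measurable_power borel_measurable_diff) (auto simp: Lp_set_2_iff)
  then show ?thesis by (simp add: sobolev_norm_def L2_norm_def)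
qed

text \<open>By linearity the Sobolev distance of two functions is the L2 distance of their images
  under T. Completeness of L2 then describes elements of the completion by limits of those images,
  and equivalent sequences by a common limit.\<close>

lemma sobolev_cauchy_iff:
  "\<phi> \<in> sobolev_cauchy M lam \<Phi> s \<longleftrightarrow> (\<forall>n. \<phi> n \<in> L2_zero M) \<and> (\<exists>g. L2_conv M (\<lambda>n. T (\<phi> n)) g)"
proof (cases "\<forall>n. \<phi> n \<in> L2_zero M")
  case True
  then have L: "\<phi> n \<in> Lp_set M 2" for n by (simp add: L2_zero_def)
  have "\<phi> \<in> sobolev_cauchy M lam \<Phi> s \<longleftrightarrow>
    (\<forall>e>0. \<exists>N. \<forall>m\<ge>N. \<forall>n\<ge>N. (\<integral>x. (T (\<phi> m) x - T (\<phi> n) x)\<^sup>2 \<partial>M) < e)"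
  proof
    assume A: "\<phi> \<in> sobolev_cauchy M lam \<Phi> s"
    show "\<forall>e>0. \<exists>N. \<forall>m\<ge>N. \<forall>n\<ge>N. (\<integral>x. (T (\<phi> m) x - T (\<phi> n) x)\<^sup>2 \<partial>M) < e"
    proof (intro allI impI)
      fix e :: real assume "e > 0"
      then obtain N where "\<forall>m\<ge>N. \<forall>n\<ge>N. sqrt (\<integral>x. (T (\<phi> m) x - T (\<phi> n) x)\<^sup>2 \<partial>M) < sqrt e"
        using A by (auto simp: sobolev_cauchy_def sobolev_norm_diff[OF L L] dest!: spec[of _ "sqrt e"])
      then show "\<exists>N. \<forall>m\<ge>N. \<forall>n\<ge>N. (\<integral>x. (T (\<phi> m) x - T (\<phi> n) x)\<^sup>2 \<partial>M) < e" by auto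
    qed
  next
    assume A: "\<forall>e>0. \<exists>N. \<forall>m\<ge>N. \<forall>n\<ge>N. (\<integral>x. (T (\<phi> m) x - T (\<phi> n) x)\<^sup>2 \<partial>M) < e"
    have "\<exists>N. \<forall>m\<ge>N. \<forall>n\<ge>N. sqrt (\<integral>x. (T (\<phi> m) x - T (\<phi> n) x)\<^sup>2 \<partial>M) < e" if e: "e > 0" for e
    proof -
      have "sqrt y < e" if "y < e\<^sup>2" for y using real_sqrt_less_mono[OF that] e by simp
      then show ?thesis using A e by (metis zero_less_power)
    qed
    then show "\<phi> \<in> sobolev_cauchy M lam \<Phi> s"
      using True L by (simp add: sobolev_cauchy_def sobolev_norm_diff)
  qed
  also have "\<dots> \<longleftrightarrow> (\<exists>g. L2_conv M (\<lambda>n. T (\<phi> n)) g)"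
    using L2_complete[of "\<lambda>n. T (\<phi> n)", OF T_L2[OF L]] L2_conv_Cauchy[of M "\<lambda>n. T (\<phi> n)"] by blast
  finally show ?thesis using True by simp
qed (auto simp: sobolev_cauchy_def)

lemma sobolev_rel_iff:
  "(\<phi>, \<psi>) \<in> sobolev_rel M lam \<Phi> s \<longleftrightarrow> (\<forall>n. \<phi> n \<in> L2_zero M) \<and> (\<forall>n. \<psi> n \<in> L2_zero M) \<and>
    (\<exists>g. L2_conv M (\<lambda>n. T (\<phi> n)) g \<and> L2_conv M (\<lambda>n. T (\<psi> n)) g)"
proof (cases "(\<forall>n. \<phi> n \<in> L2_zero M) \<and> (\<forall>n. \<psi> n \<in> L2_zero M)")
  case True
  then have L: "\<phi> n \<in> Lp_set M 2" "\<psi> n \<in> Lp_set M 2" for n by (auto simp: L2_zero_def)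
  have "(\<phi>, \<psi>) \<in> sobolev_rel M lam \<Phi> s \<longleftrightarrow> (\<exists>g. L2_conv M (\<lambda>n. T (\<phi> n)) g) \<and> (\<exists>g. L2_conv M (\<lambda>n. T (\<psi> n)) g) \<and>
      (\<lambda>n. \<integral>x. (T (\<phi> n) x - T (\<psi> n) x)\<^sup>2 \<partial>M) \<longlonglongrightarrow> 0"
    using True L by (simp add: sobolev_rel_def sobolev_cauchy_iff sobolev_norm_diff)
      (simp only: L2_norm_def[symmetric] L2_norm_tendsto_0_iff)
  also have "\<dots> \<longleftrightarrow> (\<exists>g. L2_conv M (\<lambda>n. T (\<phi> n)) g \<and> L2_conv M (\<lambda>n. T (\<psi> n)) g)"
  proof (intro iffI; elim conjE exE)
    fix g h assume A: "L2_conv M (\<lambda>n. T (\<phi> n)) g" "(\<lambda>n. \<integral>x. (T (\<phi> n) x - T (\<psi> n) x)\<^sup>2 \<partial>M) \<longlonglongrightarrow> 0"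
    from A(2) have "L2_conv M (\<lambda>n x. T (\<phi> n) x - T (\<psi> n) x) (\<lambda>_. 0)"
      using Lp_set_2_diff(1)[OF T_L2[OF L(1)] T_L2[OF L(2)]] by (simp add: L2_conv_def) (simp add: Lp_set_2_iff)
    from L2_conv_lincomb[OF A(1) this, of 1 "-1"] A(1)
    show "\<exists>g. L2_conv M (\<lambda>n. T (\<phi> n)) g \<and> L2_conv M (\<lambda>n. T (\<psi> n)) g" by auto
  next
    fix g assume A: "L2_conv M (\<lambda>n. T (\<phi> n)) g" "L2_conv M (\<lambda>n. T (\<psi> n)) g"
    from L2_conv_lincomb[OF this, of 1 "-1"] A
    show "(\<exists>g. L2_conv M (\<lambda>n. T (\<phi> n)) g) \<and> (\<exists>g. L2_conv M (\<lambda>n. T (\<psi> n)) g) \<and>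
      (\<lambda>n. \<integral>x. (T (\<phi> n) x - T (\<psi> n) x)\<^sup>2 \<partial>M) \<longlonglongrightarrow> 0" by (auto simp: L2_conv_def)
  qed
  finally show ?thesis using True by simp
qed (auto simp: sobolev_rel_def sobolev_cauchy_def)

text \<open>Equivalent sequences have images with a common limit, so the selected representative
  does not matter. The set f is only required to consist of sequences equivalent to
  \<open>\<phi>\<close>, which fits a pullback as well as a class of the completion.\<close>

lemma neg_power_ext_conv:
  assumes "f \<noteq> {}" "\<And>\<psi>. \<psi> \<in> f \<Longrightarrow> (\<phi>, \<psi>) \<in> sobolev_rel M lam \<Phi> s"
  shows "L2_conv M (\<lambda>n. T (\<phi> n)) (neg_power_ext M lam \<Phi> s f)"
proof -
  define \<psi> where "\<psi> = (SOME \<psi>. \<psi> \<in> f)"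
  have "\<psi> \<in> f" unfolding \<psi>_def using assms(1) by (simp add: some_in_eq)
  then obtain g where g: "L2_conv M (\<lambda>n. T (\<phi> n)) g" "L2_conv M (\<lambda>n. T (\<psi> n)) g"
    using assms(2)[OF \<open>\<psi> \<in> f\<close>] unfolding sobolev_rel_iff by blast
  define h where "h = neg_power_ext M lam \<Phi> s f"
  have h: "L2_conv M (\<lambda>n. T (\<psi> n)) h"
    using L2_conv_L2_lim[OF g(2)] by (simp add: h_def neg_power_ext_def \<psi>_def)
  have "(\<integral>x. (T (\<phi> n) x - g x)\<^sup>2 \<partial>M) = (\<integral>x. (T (\<phi> n) x - h x)\<^sup>2 \<partial>M)" for n
    using L2_conv_unique[OF g(2) h] g h
    by (intro integral_cong_AE borel_measurable_power borel_measurable_diff) (auto simp: L2_conv_def Lp_set_2_iff)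
  then show ?thesis using g h unfolding h_def[symmetric] by (simp add: L2_conv_def)
qed

end

section \<open>Eigenfunction expansion of the heat kernel\<close>

context gasket
begin

lemma continuous_on_K_bounded:
  fixes f :: "complex \<Rightarrow> real"
  assumes "continuous_on K f"
  obtains B where "\<And>x. x \<in> K \<Longrightarrow> \<bar>f x\<bar> \<le> B"
  using compact_imp_bounded[OF compact_continuous_image[OF assms compact_K]]
  unfolding bounded_iff by (auto simp: real_norm_def)

lemma continuous_on_L2:
  assumes "continuous_on K f"
  shows "f \<in> Lp_set \<mu> 2"
proof -
  obtain B where B: "\<And>x. x \<in> K \<Longrightarrow> \<bar>f x\<bar> \<le> B" using continuous_on_K_bounded[OF assms] by blast
  have "(f x)\<^sup>2 \<le> B\<^sup>2" if "x \<in> K" for x using B[OF that] power_mono[of "\<bar>f x\<bar>" B 2] by simp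
  then show ?thesis
    using continuous_on_measurable[OF assms] unfolding Lp_set_2_iff
    by (auto intro!: integrable_const_bound[where B="B\<^sup>2"] simp: space_mu)
qed

text \<open>The measure has full support: every point of K lies in cells of arbitrarily small
  diameter and of positive measure, and on a small enough one f - g would stay different from
  0.\<close>

lemma AE_eq_imp_eq_on_K:
  fixes f g :: "complex \<Rightarrow> real"
  assumes f: "continuous_on K f" and g: "continuous_on K g" and AE: "AE x in \<mu>. f x = g x" and x: "x \<in> K"
  shows "f x = g x"
proof (rule ccontr)
  assume ne: "f x \<noteq> g x"
  have "continuous_on K (\<lambda>y. f y - g y)" using f g by (intro continuous_intros)
  then have "\<forall>e>0. \<exists>d>0. \<forall>y\<in>K. dist y x < d \<longrightarrow> dist (f y - g y) (f x - g x) < e"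
    using x unfolding continuous_on_iff by blast
  moreover have "0 < \<bar>f x - g x\<bar>" using ne by simp
  ultimately obtain d where
    d: "d > 0" "\<And>y. y \<in> K \<Longrightarrow> dist y x < d \<Longrightarrow> dist (f y - g y) (f x - g x) < \<bar>f x - g x\<bar>" by blast
  obtain D where D: "\<And>x y. x \<in> K \<Longrightarrow> y \<in> K \<Longrightarrow> dist x y \<le> D"
    using compact_imp_bounded[OF compact_K, unfolded bounded_two_points] by blast
  have "(\<lambda>m. D / 2 ^ m) \<longlonglongrightarrow> 0" using LIMSEQ_divide_realpow_zero[of 2 D] by simp
  from order_tendstoD(2)[OF this d(1)] obtain m where m: "D / 2 ^ m < d"
    by (auto simp: eventually_sequentially)
  from x K_words[of m] have "x \<in> (\<Union>v\<in>sg_words m. sg_word_map v ` K)" by simp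
  then obtain v where v: "v \<in> sg_words m" "x \<in> sg_word_map v ` K" by auto
  then obtain a where a: "a \<in> K" "x = sg_word_map v a" by auto
  have ne': "f y \<noteq> g y" if y: "y \<in> sg_word_map v ` K" for y
  proof -
    obtain b where b: "b \<in> K" "y = sg_word_map v b" using y by auto
    have "dist y x = dist b a / 2 ^ m" using v(1) a b by (simp add: dist_sg_word_map sg_words_def)
    also have "\<dots> \<le> D / 2 ^ m" using D a b by (simp add: divide_right_mono)
    finally have "dist y x < d" using m by simp
    then have "dist (f y - g y) (f x - g x) < \<bar>f x - g x\<bar>" using d(2) cell_subset[OF v(1)] y by auto
    then show ?thesis by (auto simp: dist_real_def)
  qed
  from AE have "AE y in \<mu>. y \<notin> sg_word_map v ` K" by eventually_elim (use ne' in auto)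
  moreover have "{y \<in> space \<mu>. \<not> y \<notin> sg_word_map v ` K} = sg_word_map v ` K"
    using cell_subset[OF v(1)] by (auto simp: space_mu)
  ultimately have "emeasure \<mu> (sg_word_map v ` K) = 0"
    using AE_iff_measurable[OF cell_sets[OF v(1)], of "\<lambda>y. y \<notin> sg_word_map v ` K"] by blast
  then show False using measure_cell[OF v(1)] by (simp add: measure_def)
qed

text \<open>The variance of |f| is nonnegative. This passes from convergence of difference quotients
  in square mean to convergence in mean.\<close>

lemma integral_abs_square_le:
  assumes "f \<in> Lp_set \<mu> 2"
  shows "(\<integral>x. \<bar>f x\<bar> \<partial>\<mu>)\<^sup>2 \<le> (\<integral>x. (f x)\<^sup>2 \<partial>\<mu>)"
proof -
  have int: "integrable \<mu> (\<lambda>x. \<bar>f x\<bar>)" "integrable \<mu> (\<lambda>x. (f x)\<^sup>2)"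
    using Lp_set_2_integrable[OF assms] assms by (auto simp: Lp_set_2_iff)
  let ?m = "\<integral>x. \<bar>f x\<bar> \<partial>\<mu>"
  have "0 \<le> (\<integral>x. (\<bar>f x\<bar> - ?m)\<^sup>2 \<partial>\<mu>)" by simp
  also have "\<dots> = (\<integral>x. (f x)\<^sup>2 - 2 * ?m * \<bar>f x\<bar> + ?m\<^sup>2 \<partial>\<mu>)"
    by (intro Bochner_Integration.integral_cong) (auto simp: power2_diff)
  also have "\<dots> = (\<integral>x. (f x)\<^sup>2 \<partial>\<mu>) - ?m\<^sup>2"
    using int by (simp add: prob_space power2_eq_square)
  finally show ?thesis by simp
qed

end

section \<open>The heat semigroup: continuity, derivative in time, action on eigenfunctions\<close>

locale gasket_heat = gasket K \<mu> for K \<mu> +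
  fixes p :: "real \<Rightarrow> complex \<Rightarrow> complex \<Rightarrow> real"
  assumes heat: "is_heat_kernel K \<mu> p"
begin

abbreviation Pt :: "real \<Rightarrow> (complex \<Rightarrow> real) \<Rightarrow> complex \<Rightarrow> real" where
  "Pt \<equiv> kernel_op \<mu> p"

lemma p_cont: "continuous_on ({0<..} \<times> K \<times> K) (\<lambda>(t, x, y). p t x y)"
  using heat by (simp add: is_heat_kernel_def)

lemma p_bounded:
  assumes "0 < a"
  obtains C where "0 < C" "\<And>t x y. a \<le> t \<Longrightarrow> t \<le> b \<Longrightarrow> x \<in> K \<Longrightarrow> y \<in> K \<Longrightarrow> \<bar>p t x y\<bar> \<le> C"
proof -
  have "compact ({a..b} \<times> K \<times> K)" by (intro compact_Times compact_Icc compact_K)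
  moreover have "continuous_on ({a..b} \<times> K \<times> K) (\<lambda>(t, x, y). p t x y)"
    by (rule continuous_on_subset[OF p_cont]) (use assms in auto)
  ultimately have "bounded ((\<lambda>(t, x, y). p t x y) ` ({a..b} \<times> K \<times> K))"
    by (intro compact_imp_bounded compact_continuous_image)
  then obtain C where C: "0 < C" "\<forall>z\<in>(\<lambda>(t, x, y). p t x y) ` ({a..b} \<times> K \<times> K). norm z \<le> C"
    unfolding bounded_pos by blast
  show ?thesis
  proof (rule that[OF C(1)])
    fix t x y assume "a \<le> t" "t \<le> b" "x \<in> K" "y \<in> K"
    then have "p t x y \<in> (\<lambda>(t, x, y). p t x y) ` ({a..b} \<times> K \<times> K)"
      by (intro image_eqI[of _ _ "(t, x, y)"]) auto
    then show "\<bar>p t x y\<bar> \<le> C" using C(2) by auto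
  qed
qed

lemma p_section_cont:
  assumes "0 < t" "x \<in> K"
  shows "continuous_on K (p t x)"
proof -
  have "continuous_on K ((\<lambda>(t, x, y). p t x y) \<circ> (\<lambda>y. (t, x, y)))"
    using assms by (intro continuous_on_compose continuous_on_subset[OF p_cont] continuous_intros) auto
  then show ?thesis by (simp add: comp_def)
qed

lemma p_section_L2: "0 < t \<Longrightarrow> x \<in> K \<Longrightarrow> p t x \<in> Lp_set \<mu> 2"
  by (intro continuous_on_L2 p_section_cont)

lemma integrable_kernel: "0 < t \<Longrightarrow> x \<in> K \<Longrightarrow> f \<in> Lp_set \<mu> 2 \<Longrightarrow> integrable \<mu> (\<lambda>y. p t x y * f y)"
  by (intro Lp_set_2_mult p_section_L2)

text \<open>Away from time 0 the kernel is bounded, so dominated convergence applies. Continuity in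
  space later turns identities that hold almost everywhere into identities at every point;
  continuity in time serves the left derivative.\<close>

lemma Pt_continuous:
  assumes a: "0 < a" and f: "f \<in> Lp_set \<mu> 2"
  shows "continuous_on ({a..b} \<times> K) (\<lambda>(t, x). Pt t f x)"
  unfolding continuous_on_sequentially
proof (intro ballI allI impI, elim conjE)
  fix u :: "nat \<Rightarrow> real \<times> complex" and l
  assume u: "\<forall>n. u n \<in> {a..b} \<times> K" "u \<longlonglongrightarrow> l" and l: "l \<in> {a..b} \<times> K"
  obtain C where C: "\<And>t x y. a \<le> t \<Longrightarrow> t \<le> b \<Longrightarrow> x \<in> K \<Longrightarrow> y \<in> K \<Longrightarrow> \<bar>p t x y\<bar> \<le> C"
    using p_bounded[OF a] by metis
  have tx: "a \<le> fst (u n)" "fst (u n) \<le> b" "snd (u n) \<in> K" for n using u(1) by (auto simp: mem_Times_iff)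
  have l': "a \<le> fst l" "fst l \<le> b" "snd l \<in> K" using l by (auto simp: mem_Times_iff)
  have int: "integrable \<mu> f" by (rule Lp_set_2_integrable[OF f])
  have "(\<lambda>n. \<integral>y. p (fst (u n)) (snd (u n)) y * f y \<partial>\<mu>) \<longlonglongrightarrow> (\<integral>y. p (fst l) (snd l) y * f y \<partial>\<mu>)"
  proof (rule integral_dominated_convergence[where w = "\<lambda>y. C * \<bar>f y\<bar>"])
    show "(\<lambda>y. p (fst l) (snd l) y * f y) \<in> borel_measurable \<mu>"
      using integrable_kernel[of "fst l" "snd l" f] l' a f by auto
    show "(\<lambda>y. p (fst (u n)) (snd (u n)) y * f y) \<in> borel_measurable \<mu>" for n
      using integrable_kernel[of "fst (u n)" "snd (u n)" f] tx[of n] a f by auto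
    show "AE y in \<mu>. (\<lambda>n. p (fst (u n)) (snd (u n)) y * f y) \<longlonglongrightarrow> p (fst l) (snd l) y * f y"
    proof (rule AE_I2)
      fix y assume "y \<in> space \<mu>"
      then have y: "y \<in> K" by (simp add: space_mu)
      have "(\<lambda>n. (fst (u n), snd (u n), y)) \<longlonglongrightarrow> (fst l, snd l, y)"
        using u(2) by (intro tendsto_intros)
      with continuous_on_sequentially[THEN iffD1, OF p_cont] have
        "((\<lambda>(t, x, y). p t x y) \<circ> (\<lambda>n. (fst (u n), snd (u n), y))) \<longlonglongrightarrow> (\<lambda>(t, x, y). p t x y) (fst l, snd l, y)"
        using tx l' a y by (auto simp: less_le_trans)
      then show "(\<lambda>n. p (fst (u n)) (snd (u n)) y * f y) \<longlonglongrightarrow> p (fst l) (snd l) y * f y"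
        by (intro tendsto_intros) (simp add: comp_def)
    qed
    show "AE y in \<mu>. norm (p (fst (u n)) (snd (u n)) y * f y) \<le> C * \<bar>f y\<bar>" for n
      using C tx by (intro AE_I2) (auto simp: abs_mult space_mu intro!: mult_right_mono)
  qed (use int in auto)
  then show "((\<lambda>(t, x). Pt t f x) \<circ> u) \<longlonglongrightarrow> (\<lambda>(t, x). Pt t f x) l"
    by (simp add: kernel_op_def comp_def case_prod_beta)
qed

lemma Pt_continuous_space:
  assumes "0 < t" "f \<in> Lp_set \<mu> 2"
  shows "continuous_on K (Pt t f)"
proof -
  have "continuous_on K ((\<lambda>(t, x). Pt t f x) \<circ> (\<lambda>x. (t, x)))"
    using assms by (intro continuous_on_compose continuous_on_subset[OF Pt_continuous[of t f t]] continuous_intros) auto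
  then show ?thesis by (simp add: comp_def)
qed

lemma Pt_continuous_time:
  assumes "0 < t" "f \<in> Lp_set \<mu> 2" "x \<in> K"
  shows "isCont (\<lambda>t. Pt t f x) t"
proof -
  have "continuous_on {t/2..2*t} ((\<lambda>(t, x). Pt t f x) \<circ> (\<lambda>t. (t, x)))"
    using assms by (intro continuous_on_compose continuous_on_subset[OF Pt_continuous[of "t/2" f "2*t"]] continuous_intros) auto
  then have "continuous_on {t/2..2*t} (\<lambda>t. Pt t f x)" by (simp add: comp_def)
  then have "continuous_on {t/2<..<2*t} (\<lambda>t. Pt t f x)" by (rule continuous_on_subset) auto
  then show ?thesis using assms(1) by (subst (asm) continuous_on_eq_continuous_at) auto
qed

lemma Pt_L2: "0 < t \<Longrightarrow> f \<in> Lp_set \<mu> 2 \<Longrightarrow> Pt t f \<in> Lp_set \<mu> 2"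
  by (rule continuous_on_L2, rule Pt_continuous_space)

lemma Pt_semigroup:
  assumes "0 < r" "0 < t" "f \<in> Lp_set \<mu> 2" "x \<in> K"
  shows "Pt (r + t) f x = Pt r (Pt t f) x"
proof (rule AE_eq_imp_eq_on_K[OF _ _ _ assms(4)])
  show "AE x in \<mu>. Pt (r + t) f x = Pt r (Pt t f) x"
    using heat assms by (auto simp: is_heat_kernel_def)
qed (use assms in \<open>auto intro!: Pt_continuous_space Pt_L2\<close>)

lemma Pt_lincomb:
  assumes "0 < t" "x \<in> K" "f \<in> Lp_set \<mu> 2" "g \<in> Lp_set \<mu> 2"
  shows "Pt t (\<lambda>y. a * f y + b * g y) x = a * Pt t f x + b * Pt t g x"
  using integrable_kernel[OF assms(1,2,3)] integrable_kernel[OF assms(1,2,4)]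
  by (simp add: kernel_op_def distrib_left mult.left_commute[of _ a] mult.left_commute[of _ b])

lemma Pt_bound:
  assumes "0 < t" "x \<in> K" "f \<in> Lp_set \<mu> 2" and C: "\<And>y. y \<in> K \<Longrightarrow> \<bar>p t x y\<bar> \<le> C"
  shows "\<bar>Pt t f x\<bar> \<le> C * (\<integral>y. \<bar>f y\<bar> \<partial>\<mu>)"
proof -
  have "\<bar>Pt t f x\<bar> \<le> (\<integral>y. \<bar>p t x y * f y\<bar> \<partial>\<mu>)" unfolding kernel_op_def by (rule integral_abs_bound)
  also have "\<dots> \<le> (\<integral>y. C * \<bar>f y\<bar> \<partial>\<mu>)"
  proof (rule integral_mono)
    show "integrable \<mu> (\<lambda>y. \<bar>p t x y * f y\<bar>)" "integrable \<mu> (\<lambda>y. C * \<bar>f y\<bar>)"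
      using integrable_kernel[OF assms(1-3)] Lp_set_2_integrable[OF assms(3)] by auto
  qed (use C in \<open>auto simp: abs_mult space_mu intro!: mult_right_mono\<close>)
  finally show ?thesis by simp
qed

text \<open>The generator controls the difference quotient at time 0 only in square mean. Applying
  the semigroup for a positive time, at which the kernel is bounded, turns an error that is small in
  mean into one that is small at the single point x.\<close>

lemma Pt_has_derivative:
  assumes f: "f \<in> Lp_set \<mu> 2" and g: "g \<in> Lp_set \<mu> 2" and L: "neumann_laplacian K \<mu> f g"
    and t: "0 < t" and x: "x \<in> K"
  shows "((\<lambda>t. Pt t f x) has_field_derivative Pt t g x) (at t)"
proof -
  define h where "h r = (\<lambda>y. (Pt r f y - f y) / r - g y)" for r
  have h_eq: "h r = (\<lambda>y. 1 * ((1/r) * Pt r f y + (-1/r) * f y) + (-1) * g y)" for r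
    by (simp add: h_def fun_eq_iff diff_divide_distrib)
  have q: "(\<lambda>y. (1/r) * Pt r f y + (-1/r) * f y) \<in> Lp_set \<mu> 2" if "r > 0" for r
    by (intro Lp_set_2_lincomb Pt_L2 that f)
  have hL: "h r \<in> Lp_set \<mu> 2" if "r > 0" for r
    unfolding h_eq by (rule Lp_set_2_lincomb(1)[OF q[OF that] g])
  have "((\<lambda>r. L2_norm \<mu> (h r)) \<longlongrightarrow> 0) (at_right 0)"
    using heat f g L unfolding is_heat_kernel_def h_def by blast
  then have h0: "((\<lambda>r. \<integral>y. \<bar>h r y\<bar> \<partial>\<mu>) \<longlongrightarrow> 0) (at_right 0)"
  proof (rule Lim_null_comparison[rotated])
    show "\<forall>\<^sub>F r in at_right 0. norm (\<integral>y. \<bar>h r y\<bar> \<partial>\<mu>) \<le> L2_norm \<mu> (h r)"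
      using eventually_at_right_less[of "0::real"]
    proof eventually_elim
      case (elim r)
      from real_sqrt_le_mono[OF integral_abs_square_le[OF hL[OF elim]]] show ?case
        by (simp add: L2_norm_def)
    qed
  qed
  \<comment> \<open>By the semigroup law, the error at time 0 transported by time s is the error of
    the difference quotient at time s.\<close>
  have Ph: "Pt s (h r) x = (Pt (s + r) f x - Pt s f x) / r - Pt s g x" if "r > 0" "s > 0" for r s
  proof -
    have "Pt s (h r) x = 1 * Pt s (\<lambda>y. (1/r) * Pt r f y + (-1/r) * f y) x + (-1) * Pt s g x"
      unfolding h_eq by (rule Pt_lincomb[OF that(2) x q[OF that(1)] g])
    also have "Pt s (\<lambda>y. (1/r) * Pt r f y + (-1/r) * f y) x = (1/r) * Pt s (Pt r f) x + (-1/r) * Pt s f x"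
      by (rule Pt_lincomb[OF that(2) x Pt_L2[OF that(1) f] f])
    also have "Pt s (Pt r f) x = Pt (s + r) f x" by (rule Pt_semigroup[symmetric]) (use that f x in auto)
    finally show ?thesis by (simp add: diff_divide_distrib)
  qed
  obtain C where C: "\<And>s x y. t/2 \<le> s \<Longrightarrow> s \<le> t \<Longrightarrow> x \<in> K \<Longrightarrow> y \<in> K \<Longrightarrow> \<bar>p s x y\<bar> \<le> C"
    using p_bounded[of "t/2" t] t by (metis half_gt_zero)
  have C0: "((\<lambda>r. C * (\<integral>y. \<bar>h r y\<bar> \<partial>\<mu>)) \<longlongrightarrow> 0) (at_right 0)"
    using tendsto_mult_right_zero[OF h0] .
  have right: "((\<lambda>r. (Pt (t + r) f x - Pt t f x) / r) \<longlongrightarrow> Pt t g x) (at_right 0)"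
  proof (rule LIM_zero_cancel, rule Lim_null_comparison[OF _ C0])
    show "\<forall>\<^sub>F r in at_right 0. norm ((Pt (t + r) f x - Pt t f x) / r - Pt t g x) \<le> C * (\<integral>y. \<bar>h r y\<bar> \<partial>\<mu>)"
      using eventually_at_right_less[of "0::real"]
    proof eventually_elim
      case (elim r)
      then show ?case using Pt_bound[OF t x hL[OF elim] C[OF _ _ x]] Ph[OF elim t] t by simp
    qed
  qed
  \<comment> \<open>Here the error is transported by the time t - r, which stays in the range of the
    bound C for r < t/2; the target then moves with r and is brought back by continuity in
    time.\<close>
  have left: "((\<lambda>r. (Pt (t - r) f x - Pt t f x) / (- r)) \<longlongrightarrow> Pt t g x) (at_right 0)"
  proof -
    have ev: "\<forall>\<^sub>F r in at_right 0. 0 < r \<and> r < t / 2"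
      using eventually_at_right_less[of "0::real"] order_tendstoD(2)[OF tendsto_ident_at, of 0 "t/2" "{0<..}"] t
      by (auto intro: eventually_conj)
    have "((\<lambda>r. (Pt (t - r) f x - Pt t f x) / (- r) - Pt (t - r) g x) \<longlongrightarrow> 0) (at_right 0)"
    proof (rule Lim_null_comparison[OF _ C0])
      show "\<forall>\<^sub>F r in at_right 0. norm ((Pt (t - r) f x - Pt t f x) / (- r) - Pt (t - r) g x) \<le> C * (\<integral>y. \<bar>h r y\<bar> \<partial>\<mu>)"
        using ev
      proof eventually_elim
        case (elim r)
        have "(Pt (t - r) f x - Pt t f x) / (- r) - Pt (t - r) g x = Pt (t - r) (h r) x"
          using Ph[of r "t - r"] elim t by (simp add: minus_divide_right[symmetric] minus_divide_left)
        then show ?case using Pt_bound[of "t - r" x "h r" C] elim t x hL C[of "t - r" x] by simp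
      qed
    qed
    moreover have "((\<lambda>r. Pt (t - r) g x) \<longlongrightarrow> Pt t g x) (at_right 0)"
    proof (rule isCont_tendsto_compose[OF Pt_continuous_time[OF t g x]])
      have "((\<lambda>r. t - r) \<longlongrightarrow> t - 0) (at_right 0)" by (intro tendsto_intros)
      then show "((\<lambda>r. t - r) \<longlongrightarrow> t) (at_right 0)" by simp
    qed
    ultimately show ?thesis using tendsto_add by fastforce
  qed
  show ?thesis
    unfolding DERIV_def
  proof (rule filterlim_split_at)
    show "((\<lambda>h. (Pt (t + h) f x - Pt t f x) / h) \<longlongrightarrow> Pt t g x) (at_left 0)"
      using left by (subst filterlim_at_left_to_right) simp
  qed (rule right)
qed

text \<open>The product \<open>exp (c * t) * Pt t f y\<close> has derivative 0 in t and so equals a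
  value independent of t. Strong continuity at time 0 identifies this value with f almost
  everywhere, and continuity of both removes the null set.\<close>

lemma Pt_eigenfunction:
  assumes cont: "continuous_on K f" and L: "neumann_laplacian K \<mu> f (\<lambda>y. - c * f y)"
    and t: "0 < t" and x: "x \<in> K"
  shows "Pt t f x = exp (- c * t) * f x"
proof -
  have f: "f \<in> Lp_set \<mu> 2" by (rule continuous_on_L2[OF cont])
  have cf: "(\<lambda>y. - c * f y) \<in> Lp_set \<mu> 2"
    using Lp_set_2_lincomb(1)[OF f f, of "- c" 0] by simp
  \<comment> \<open>The value independent of t, read off at t = 1.\<close>
  define k where "k y = exp c * Pt 1 f y" for y
  have k: "continuous_on K k" unfolding k_def by (intro continuous_intros Pt_continuous_space f) simp
  have Pk: "Pt t f y = exp (- c * t) * k y" if "t > 0" "y \<in> K" for t y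
  proof -
    have "\<exists>b. \<forall>t\<in>{0<..}. exp (c * t) * Pt t f y = b"
    proof (rule has_field_derivative_zero_constant)
      fix t :: real assume "t \<in> {0<..}"
      then have t: "0 < t" by simp
      have Pc: "Pt t (\<lambda>y. - c * f y) y = - c * Pt t f y"
        using Pt_lincomb[OF t that(2) f f, of "- c" 0] by simp
      have "((\<lambda>t. exp (c * t) * Pt t f y) has_field_derivative
          exp (c * t) * (- c * Pt t f y) + c * exp (c * t) * Pt t f y) (at t)"
        using Pt_has_derivative[OF f cf L t that(2)] unfolding Pc by (auto intro!: derivative_eq_intros)
      then show "((\<lambda>t. exp (c * t) * Pt t f y) has_field_derivative 0) (at t within {0<..})"
        by (auto intro: has_field_derivative_at_within)
    qed auto
    then have "exp (c * t) * Pt t f y = exp (c * 1) * Pt 1 f y" using that(1) by (metis greaterThan_iff zero_less_one)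
    then show ?thesis by (simp add: k_def exp_minus field_simps)
  qed
  define \<tau> where "\<tau> n = 1 / real (Suc n)" for n
  have \<tau>: "\<And>n. \<tau> n > 0" "\<tau> \<longlonglongrightarrow> 0" unfolding \<tau>_def by (simp, rule LIMSEQ_Suc[OF lim_1_over_n])
  have "\<tau> n \<noteq> 0" for n using \<tau>(1)[of n] by simp
  with \<tau> have \<tau>': "filterlim \<tau> (at_right 0) sequentially"
    by (auto simp: filterlim_at intro!: always_eventually)
  have kL: "k \<in> Lp_set \<mu> 2" by (rule continuous_on_L2[OF k])
  have "L2_conv \<mu> (\<lambda>n. Pt (\<tau> n) f) f"
  proof -
    have "((\<lambda>t. L2_norm \<mu> (\<lambda>x. Pt t f x - f x)) \<longlongrightarrow> 0) (at_right 0)"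
      using heat f by (simp add: is_heat_kernel_def)
    from filterlim_compose[OF this \<tau>'] show ?thesis
      using \<tau>(1) f Pt_L2 by (auto simp: L2_conv_def L2_norm_tendsto_0_iff)
  qed
  moreover have "L2_conv \<mu> (\<lambda>n. Pt (\<tau> n) f) k"
  proof -
    have "(\<integral>y. (Pt (\<tau> n) f y - k y)\<^sup>2 \<partial>\<mu>) = (exp (- c * \<tau> n) - 1)\<^sup>2 * (\<integral>y. (k y)\<^sup>2 \<partial>\<mu>)" for n
    proof -
      have "(\<integral>y. (Pt (\<tau> n) f y - k y)\<^sup>2 \<partial>\<mu>) = (\<integral>y. (exp (- c * \<tau> n) - 1)\<^sup>2 * (k y)\<^sup>2 \<partial>\<mu>)"
        using Pk[OF \<tau>(1)] by (intro Bochner_Integration.integral_cong refl)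
          (simp add: space_mu left_diff_distrib flip: power_mult_distrib)
      then show ?thesis by simp
    qed
    moreover have "(\<lambda>n. (exp (- c * \<tau> n) - 1)\<^sup>2 * (\<integral>y. (k y)\<^sup>2 \<partial>\<mu>)) \<longlonglongrightarrow> (exp (- c * 0) - 1)\<^sup>2 * (\<integral>y. (k y)\<^sup>2 \<partial>\<mu>)"
      by (intro tendsto_intros \<tau>)
    ultimately show ?thesis using kL \<tau>(1) f Pt_L2 by (simp add: L2_conv_def)
  qed
  ultimately have "AE y in \<mu>. f y = k y" by (rule L2_conv_unique)
  then have "f x = k x" by (rule AE_eq_imp_eq_on_K[OF cont k _ x])
  then show ?thesis using Pk[OF t x] by simp
qed

text \<open>Constants have energy 0 against every function, so 1 is an eigenfunction for the
  eigenvalue 0.\<close>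

lemma Pt_one:
  assumes "0 < t" "x \<in> K"
  shows "(\<integral>y. p t x y \<partial>\<mu>) = 1"
proof -
  have e: "energy_level m (\<lambda>_. 1) g = 0" for m g by (simp add: energy_level_def)
  have "neumann_laplacian K \<mu> (\<lambda>_. 1) (\<lambda>y. - 0 * 1)"
    unfolding neumann_laplacian_def by (auto simp: energy_domain_def energy_def e Lp_set_2_iff convergent_const)
  from Pt_eigenfunction[OF _ this assms] show ?thesis by (simp add: kernel_op_def)
qed

end

section \<open>Spectral coefficients and pointwise expansion of the heat kernel\<close>

locale gasket_spectrum = gasket_heat K \<mu> p for K \<mu> p +
  fixes lam :: "nat \<Rightarrow> real" and \<Phi> :: "nat \<Rightarrow> complex \<Rightarrow> real"
  assumes eig: "is_neumann_eigenbasis K \<mu> lam \<Phi>"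

sublocale gasket_spectrum \<subseteq> orthonormal_system \<mu> \<Phi>
  using eig by unfold_locales (auto simp: is_neumann_eigenbasis_def L2_zero_def)

context gasket_spectrum
begin

lemma lam_pos: "0 < lam j"
  using eig by (simp add: is_neumann_eigenbasis_def)

lemma Phi_cont: "continuous_on K (\<Phi> j)"
  using eig by (auto simp: is_neumann_eigenbasis_def neumann_laplacian_def energy_domain_def)

lemma Phi_mean: "(\<integral>y. \<Phi> j y \<partial>\<mu>) = 0"
  using eig by (auto simp: is_neumann_eigenbasis_def L2_zero_def)

text \<open>Subtracting 1 gives the section of the kernel mean 0, as required for an expansion in
  the eigenbasis; the coefficients do not change, since each eigenfunction has mean 0.\<close>

lemma p_coefficient:
  assumes "0 < t" "x \<in> K"
  shows "(\<integral>y. \<Phi> j y * (p t x y - 1) \<partial>\<mu>) = exp (- lam j * t) * \<Phi> j x"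
proof -
  have "Pt t (\<Phi> j) x = exp (- lam j * t) * \<Phi> j x"
    by (rule Pt_eigenfunction[OF Phi_cont _ assms]) (use eig in \<open>auto simp: is_neumann_eigenbasis_def\<close>)
  moreover have "(\<integral>y. \<Phi> j y * (p t x y - 1) \<partial>\<mu>) = (\<integral>y. p t x y * \<Phi> j y - \<Phi> j y \<partial>\<mu>)"
    by (intro Bochner_Integration.integral_cong) (auto simp: algebra_simps)
  ultimately show ?thesis
    using integrable_kernel[OF assms Phi_L2] Lp_set_2_integrable[OF Phi_L2]
    by (simp add: kernel_op_def Phi_mean)
qed

text \<open>The expansion of a section of the kernel holds in square mean; Bessel's inequality at half the
  time makes it uniform, and continuity then removes the exceptional null set.\<close>

lemma heat_kernel_expansion:
  assumes t: "0 < t" and x: "x \<in> K" and y: "y \<in> K"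
  shows "(\<lambda>j. exp (- lam j * t) * \<Phi> j x * \<Phi> j y) sums (p t x y - 1)"
proof -
  let ?q = "\<lambda>x y. p (t/2) x y - 1"
  have qL: "?q z \<in> Lp_set \<mu> 2" if "z \<in> K" for z
    using t that by (intro continuous_on_L2 continuous_intros p_section_cont) auto
  obtain C where C: "\<And>x y. x \<in> K \<Longrightarrow> y \<in> K \<Longrightarrow> \<bar>p (t/2) x y\<bar> \<le> C"
    using p_bounded[of "t/2" "t/2"] t by (metis half_gt_zero order_refl)
  define B where "B = (C + 1)\<^sup>2"
  have Bx: "(\<integral>y. (?q z y)\<^sup>2 \<partial>\<mu>) \<le> B" if "z \<in> K" for z
  proof -
    have "(\<integral>y. (?q z y)\<^sup>2 \<partial>\<mu>) \<le> (\<integral>y. B \<partial>\<mu>)"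
    proof (rule integral_mono)
      show "(?q z y)\<^sup>2 \<le> B" if "y \<in> space \<mu>" for y
        using C[OF \<open>z \<in> K\<close>, of y] that power_mono[of "\<bar>?q z y\<bar>" "C + 1" 2] by (simp add: space_mu B_def)
    qed (use qL[OF that] in \<open>auto simp: Lp_set_2_iff\<close>)
    then show ?thesis by (simp add: prob_space)
  qed
  \<comment> \<open>Each of the two points receives half of the exponent:
    \<open>b x j * b z j\<close> is the term of the expansion at time t, while \<open>b z\<close> is
    the coefficient sequence of a section at time t/2.\<close>
  define b where "b z j = exp (- lam j * (t/2)) * \<Phi> j z" for z j
  have bessel_b: "(\<Sum>j\<in>A. (b z j)\<^sup>2) \<le> B" if "finite A" "z \<in> K" for A z
    using bessel[OF that(1) qL[OF that(2)]] Bx[OF that(2)] p_coefficient[of "t/2" z] t that(2)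
    by (simp add: b_def)
  have summ: "summable (\<lambda>j. (b z j)\<^sup>2)" if "z \<in> K" for z
    by (rule bounded_imp_summable[OF zero_le_power2 bessel_b[OF finite_atMost that]])
  define S where "S N z = (\<Sum>j<N. b x j * b z j)" for N z
  have S_eq: "S N z = (\<Sum>j<N. exp (- lam j * t) * \<Phi> j x * \<Phi> j z)" for N z
  proof -
    have "b x j * b z j = exp (- lam j * t) * \<Phi> j x * \<Phi> j z" for j
    proof -
      have "exp (- lam j * t) = exp (- lam j * (t/2)) * exp (- lam j * (t/2))"
        by (subst exp_add[symmetric]) (simp add: field_simps)
      then show ?thesis by (simp only: b_def mult_ac)
    qed
    then show ?thesis by (simp add: S_def)
  qed
  define R where "R N = (\<Sum>j. (b x j)\<^sup>2) - (\<Sum>j<N. (b x j)\<^sup>2)" for N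
  have R0: "R \<longlonglongrightarrow> 0"
    using tendsto_diff[OF tendsto_const summable_LIMSEQ[OF summ[OF x]], of "\<Sum>j. (b x j)\<^sup>2"] by (simp add: R_def[abs_def])
  \<comment> \<open>The Cauchy-Schwarz inequality separates the points: the tail \<open>R N\<close>
    belongs to the fixed x, and B bounds the other factor for all z at once.\<close>
  have SS: "(S M z - S N z)\<^sup>2 \<le> R N * B" if "N \<le> M" "z \<in> K" for M N z
  proof -
    have "S M z - S N z = (\<Sum>j\<in>{N..<M}. b x j * b z j)"
      using sum_diff_nat_ivl[of 0 N M "\<lambda>j. b x j * b z j"] that by (simp add: S_def atLeast0LessThan)
    then have "(S M z - S N z)\<^sup>2 \<le> (\<Sum>j\<in>{N..<M}. (b x j)\<^sup>2) * (\<Sum>j\<in>{N..<M}. (b z j)\<^sup>2)"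
      using Cauchy_Schwarz_ineq_sum by simp
    also have "\<dots> \<le> R N * B"
    proof (rule mult_mono)
      have "(\<Sum>j\<in>{N..<M}. (b x j)\<^sup>2) = (\<Sum>j<M. (b x j)\<^sup>2) - (\<Sum>j<N. (b x j)\<^sup>2)"
        using sum_diff_nat_ivl[of 0 N M "\<lambda>j. (b x j)\<^sup>2"] that by (simp add: atLeast0LessThan)
      also have "\<dots> \<le> R N" using sum_le_suminf[OF summ[OF x], of "{..<M}"] by (simp add: R_def)
      finally show "(\<Sum>j\<in>{N..<M}. (b x j)\<^sup>2) \<le> R N" .
      show "0 \<le> R N" using sum_le_suminf[OF summ[OF x], of "{..<N}"] by (simp add: R_def)
    qed (auto intro: bessel_b[OF _ that(2)] sum_nonneg)
    finally show ?thesis .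
  qed
  define g where "g z = (\<Sum>j. b x j * b z j)" for z
  have Sg: "(\<lambda>N. S N z) \<longlonglongrightarrow> g z" if "z \<in> K" for z
  proof -
    have "summable (\<lambda>j. b x j * b z j)"
    proof (rule summable_comparison_test'[OF summable_add[OF summ[OF x] summ[OF that]]])
      show "norm (b x j * b z j) \<le> (b x j)\<^sup>2 + (b z j)\<^sup>2" for j
      proof -
        have "2 * (\<bar>b x j\<bar> * \<bar>b z j\<bar>) \<le> (b x j)\<^sup>2 + (b z j)\<^sup>2"
          using sum_squares_bound[of "\<bar>b x j\<bar>" "\<bar>b z j\<bar>"] by simp
        moreover have "0 \<le> \<bar>b x j\<bar> * \<bar>b z j\<bar>" by simp
        ultimately show ?thesis unfolding real_norm_def abs_mult by linarith
      qed
    qed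
    then show ?thesis unfolding S_def g_def by (rule summable_LIMSEQ)
  qed
  have gS: "(g z - S N z)\<^sup>2 \<le> R N * B" if "z \<in> K" for z N
  proof (rule LIMSEQ_le_const2)
    show "(\<lambda>M. (S M z - S N z)\<^sup>2) \<longlonglongrightarrow> (g z - S N z)\<^sup>2" by (intro tendsto_intros Sg that)
    show "\<exists>M0. \<forall>M\<ge>M0. (S M z - S N z)\<^sup>2 \<le> R N * B" using SS that by blast
  qed
  have RB: "(\<lambda>N. R N * B) \<longlonglongrightarrow> 0" using tendsto_mult_left_zero[OF R0] .
  have S_cont: "continuous_on K (S N)" for N
    unfolding S_def b_def by (intro continuous_intros Phi_cont)
  have g_cont: "continuous_on K g"
  proof (rule uniform_limit_theorem)
    show "uniform_limit K S g sequentially"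
    proof (rule uniform_limitI)
      fix e :: real assume e: "e > 0"
      have "\<forall>\<^sub>F N in sequentially. R N * B < e\<^sup>2" using RB by (rule order_tendstoD) (use e in simp)
      then show "\<forall>\<^sub>F N in sequentially. \<forall>z\<in>K. dist (S N z) (g z) < e"
      proof eventually_elim
        case (elim N)
        show ?case
        proof
          fix z assume "z \<in> K"
          then have "\<bar>g z - S N z\<bar>\<^sup>2 < e\<^sup>2" using gS[of z N] elim by simp
          then show "dist (S N z) (g z) < e"
            using e power_less_imp_less_base[of "\<bar>g z - S N z\<bar>" 2 e] by (simp add: dist_real_def abs_minus_commute)
        qed
      qed
    qed
  qed (auto intro!: always_eventually S_cont)
  have pL: "(\<lambda>z. p t x z - 1) \<in> Lp_set \<mu> 2" "continuous_on K (\<lambda>z. p t x z - 1)"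
    using t x by (auto intro!: continuous_on_L2 continuous_intros p_section_cont)
  have "L2_conv \<mu> S (\<lambda>z. p t x z - 1)"
  proof -
    have "(\<integral>z. p t x z - 1 \<partial>\<mu>) = 0"
      using Pt_one[OF t x] Lp_set_2_integrable[OF p_section_L2[OF t x]] by (simp add: prob_space)
    then have "(\<lambda>z. p t x z - 1) \<in> L2_zero \<mu>" using pL by (simp add: L2_zero_def)
    then have "(\<lambda>N. L2_norm \<mu> (\<lambda>z. (\<Sum>j<N. (\<integral>y. \<Phi> j y * (p t x y - 1) \<partial>\<mu>) * \<Phi> j z) - (p t x z - 1))) \<longlonglongrightarrow> 0"
      using eig by (auto simp: is_neumann_eigenbasis_def)
    then show ?thesis
      using continuous_on_L2[OF S_cont] pL(1)
      by (simp add: L2_conv_def L2_norm_tendsto_0_iff S_eq[abs_def] p_coefficient[OF t x])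
  qed
  moreover have "L2_conv \<mu> S g"
  proof -
    have "(\<lambda>N. \<integral>z. (S N z - g z)\<^sup>2 \<partial>\<mu>) \<longlonglongrightarrow> 0"
    proof (rule squeeze_zero[OF _ _ RB])
      show "(\<integral>z. (S N z - g z)\<^sup>2 \<partial>\<mu>) \<le> R N * B" for N
      proof -
        have "(\<integral>z. (S N z - g z)\<^sup>2 \<partial>\<mu>) \<le> (\<integral>z. R N * B \<partial>\<mu>)"
        proof (rule integral_mono)
          show "integrable \<mu> (\<lambda>z. (S N z - g z)\<^sup>2)"
            using continuous_on_L2[OF continuous_on_diff[OF S_cont g_cont]] by (simp add: Lp_set_2_iff)
        qed (use gS in \<open>auto simp: space_mu power2_commute\<close>)
        then show ?thesis by (simp add: prob_space)
      qed
    qed simp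
    then show ?thesis using continuous_on_L2[OF S_cont] continuous_on_L2[OF g_cont] by (simp add: L2_conv_def)
  qed
  ultimately have "AE z in \<mu>. p t x z - 1 = g z" by (rule L2_conv_unique)
  then have "p t x y - 1 = g y" by (rule AE_eq_imp_eq_on_K[OF pL(2) g_cont _ y])
  then show ?thesis using Sg[OF y] by (simp add: sums_def S_eq)
qed

end

section \<open>Scaling of the fields\<close>

lemma powr_d_w: "2 powr d_w = 5" and powr_d_h: "2 powr d_h = 3"
  by (simp_all add: d_w_def d_h_def powr_def)

text \<open>The first term of the exponent contributes 5 powr (n * s); the second, rewritten as
  \<open>d_h / \<alpha> - d_h\<close>, contributes the powers of 3.\<close>

lemma scaling_exponent:
  fixes n :: nat and s \<alpha> :: real
  assumes "\<alpha> \<noteq> 0"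
  shows "2 powr (real n * (s * d_w - (\<alpha> - 1) * d_h / \<alpha>)) = 3 powr (real n / \<alpha>) * 5 powr (real n * s) / 3 ^ n"
proof -
  have "real n * (s * d_w - (\<alpha> - 1) * d_h / \<alpha>) = d_w * (real n * s) + d_h * (real n / \<alpha> - real n)"
    using assms by (simp add: field_simps)
  then have "2 powr (real n * (s * d_w - (\<alpha> - 1) * d_h / \<alpha>)) = 5 powr (real n * s) * 3 powr (real n / \<alpha> - real n)"
    by (simp add: powr_add powr_powr[symmetric] powr_d_w powr_d_h)
  then show ?thesis by (simp add: powr_diff powr_realpow)
qed

text \<open>Substituting u = c * t in the time integral produces c powr (- s). The substitution
  preserves the default value 0 of a divergent integral, so the identity persists on the
  diagonal.\<close>

lemma riesz_kernel_scaling: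
  assumes c: "0 < c" and q: "\<And>t. 0 < t \<Longrightarrow> q t x' y' - b * a = b * (p (c * t) x y - a)"
  shows "riesz_kernel (b * a) q s x' y' = b * c powr (- s) * riesz_kernel a p s x y"
proof -
  let ?f = "\<lambda>u. indicator {0<..} u *\<^sub>R (u powr (s - 1) * (p u x y - a))"
  have "(LINT t:{0<..}|lborel. t powr (s - 1) * (q t x' y' - b * a)) =
      (\<integral>t. b * c powr (1 - s) * ?f (0 + c * t) \<partial>lborel)"
    unfolding set_lebesgue_integral_def
  proof (intro Bochner_Integration.integral_cong refl)
    fix t :: real
    have "c powr (1 - s) * (c powr (s - 1) * z) = z" for z
      using c by (simp add: powr_add[symmetric] mult.assoc[symmetric])
    then show "indicator {0<..} t *\<^sub>R (t powr (s - 1) * (q t x' y' - b * a)) = b * c powr (1 - s) * ?f (0 + c * t)"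
      using c q[of t] by (cases "t > 0") (auto simp: indicator_def powr_mult zero_less_mult_iff mult_ac)
  qed
  also have "\<dots> = b * c powr (1 - s) * (\<integral>t. ?f (0 + c * t) \<partial>lborel)" by simp
  also have "(\<integral>t. ?f (0 + c * t) \<partial>lborel) = (\<integral>u. ?f u \<partial>lborel) / c"
    using lborel_integral_real_affine[of c ?f 0] c by simp
  also have "b * c powr (1 - s) * ((\<integral>u. ?f u \<partial>lborel) / c) = b * c powr (- s) * (\<integral>u. ?f u \<partial>lborel)"
    using c by (simp add: powr_diff powr_minus field_simps)
  finally show ?thesis by (simp add: riesz_kernel_def set_lebesgue_integral_def)
qed

section \<open>Comparison of integrands on a cell with integrands on the gasket\<close>

context gasket_cell
begin

lemma L2_conv_comp_F:
  assumes "L2_conv \<mu>w S g"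
  shows "L2_conv \<mu> (\<lambda>n x. S n (F x)) (\<lambda>x. g (F x))"
proof -
  have [measurable]: "S n \<in> borel_measurable \<mu>w" "g \<in> borel_measurable \<mu>w" for n
    using assms by (auto simp: L2_conv_def Lp_set_2_iff)
  have "(\<lambda>m. 3 ^ n * (\<integral>x. (S m x - g x)\<^sup>2 \<partial>\<mu>w)) \<longlonglongrightarrow> 0"
    using assms by (intro tendsto_mult_right_zero) (simp add: L2_conv_def)
  then have "(\<lambda>m. \<integral>x. (S m (F x) - g (F x))\<^sup>2 \<partial>\<mu>) \<longlonglongrightarrow> 0"
    using integral_comp_F[of "\<lambda>x. (S m x - g x)\<^sup>2" for m] by simp
  then show ?thesis using assms by (simp add: L2_conv_def Lp_set_comp_F_iff)
qed

lemma L2_zero_comp_F: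
  assumes "f \<in> L2_zero \<mu>w"
  shows "f \<circ> F \<in> L2_zero \<mu>"
proof -
  have f: "f \<in> Lp_set \<mu>w 2" "(\<integral>x. f x \<partial>\<mu>w) = 0" using assms by (auto simp: L2_zero_def)
  then have "f \<in> borel_measurable \<mu>w" by (simp add: Lp_set_2_iff)
  from integral_comp_F[OF this] f show ?thesis by (simp add: L2_zero_def comp_def Lp_set_comp_F_iff)
qed

text \<open>The constant \<^term>\<open>c\<close> absorbs both the factor by which the integrands scale and the total mass
  of the cell.\<close>

lemma same_fdd_scaled:
  fixes P :: "'v measure" and Pw :: "'w measure"
  assumes alpha: "0 < \<alpha>" and W: "is_stable_random_measure P \<mu> \<alpha> W" and Ww: "is_stable_random_measure Pw \<mu>w \<alpha> Ww"
    and \<kappa>: "0 < \<kappa>" and c: "c = 3 powr (real n / \<alpha>) * \<kappa>"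
    and Lp: "\<And>i. i \<in> I \<Longrightarrow> f i \<in> Lp_set \<mu>w \<alpha> \<longleftrightarrow> g i \<in> Lp_set \<mu> \<alpha>"
    and fg: "\<And>i. i \<in> I \<Longrightarrow> g i \<in> Lp_set \<mu> \<alpha> \<Longrightarrow> AE x in \<mu>. g i x = \<kappa> * f i (F x)"
  shows "same_fdd I Pw (\<lambda>i \<omega>. c * stable_integral Pw \<mu>w \<alpha> Ww (f i) \<omega>) P (\<lambda>i. stable_integral P \<mu> \<alpha> W (g i))"
proof (rule same_fdd_stable_integral)
  show "stable_random_measure P \<mu> \<alpha> W" "stable_random_measure Pw \<mu>w \<alpha> Ww"
    using W Ww alpha finite_measure_axioms cell.finite_measure_axioms
    by (auto simp: stable_random_measure_def stable_random_measure_axioms_def is_stable_random_measure_def)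
  fix J and u :: "_ \<Rightarrow> real"
  assume J: "finite J" "J \<subseteq> I" and fL: "\<And>j. j \<in> J \<Longrightarrow> f j \<in> Lp_set \<mu>w \<alpha>"
  then have gL: "\<And>j. j \<in> J \<Longrightarrow> g j \<in> Lp_set \<mu> \<alpha>" using Lp by auto
  have fm: "\<And>j. j \<in> J \<Longrightarrow> f j \<in> borel_measurable \<mu>w" and gm: "\<And>j. j \<in> J \<Longrightarrow> g j \<in> borel_measurable \<mu>"
    using fL gL by (auto simp: Lp_set_def)
  let ?S = "\<lambda>x. \<bar>\<Sum>j\<in>J. u j * f j x\<bar> powr \<alpha>"
  have Sm: "?S \<in> borel_measurable \<mu>w" using fm by measurable
  have "AE x in \<mu>. \<forall>j\<in>J. g j x = \<kappa> * f j (F x)"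
    using J gL fg by (intro AE_finite_allI) auto
  then have "AE x in \<mu>. \<bar>\<Sum>j\<in>J. u j * g j x\<bar> powr \<alpha> = \<kappa> powr \<alpha> * ?S (F x)"
  proof eventually_elim
    case (elim x)
    then have "(\<Sum>j\<in>J. u j * g j x) = \<kappa> * (\<Sum>j\<in>J. u j * f j (F x))"
      by (simp add: sum_distrib_left mult.left_commute)
    then show ?case using \<kappa> by (simp add: abs_mult powr_mult)
  qed
  then have "(\<integral>x. \<bar>\<Sum>j\<in>J. u j * g j x\<bar> powr \<alpha> \<partial>\<mu>) = (\<integral>x. \<kappa> powr \<alpha> * ?S (F x) \<partial>\<mu>)"
  proof (rule integral_cong_AE[rotated 2])
    show "(\<lambda>x. \<bar>\<Sum>j\<in>J. u j * g j x\<bar> powr \<alpha>) \<in> borel_measurable \<mu>" using gm by measurable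
    have "(\<lambda>x. ?S (F x)) \<in> borel_measurable \<mu>" using measurable_comp_F_iff[of ?S] Sm by blast
    then show "(\<lambda>x. \<kappa> powr \<alpha> * ?S (F x)) \<in> borel_measurable \<mu>" by (intro borel_measurable_times borel_measurable_const)
  qed
  also have "\<dots> = \<kappa> powr \<alpha> * 3 ^ n * (\<integral>x. ?S x \<partial>\<mu>w)"
    using integral_comp_F[OF Sm] by simp
  \<comment> \<open>The mass factor 3 ^ n enters c through its \<open>\<alpha>\<close>-th
    root.\<close>
  also have "\<kappa> powr \<alpha> * 3 ^ n = \<bar>c\<bar> powr \<alpha>"
    using \<kappa> alpha by (simp add: c abs_mult powr_mult powr_powr powr_realpow)
  finally show "\<bar>c\<bar> powr \<alpha> * (\<integral>x. ?S x \<partial>\<mu>w) = (\<integral>x. \<bar>\<Sum>j\<in>J. u j * g j x\<bar> powr \<alpha> \<partial>\<mu>)" by simp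
qed (rule Lp)

end

section \<open>Eigendata, kernels and potentials of a cell\<close>

locale gasket_cell_spectrum = gasket_cell K \<mu> w n + gasket_spectrum K \<mu> p lam \<Phi> for K \<mu> w n p lam \<Phi>
begin

abbreviation "\<Phi>w \<equiv> cell_eigenfunction \<Phi> w"
abbreviation "lamw \<equiv> cell_eigenvalue lam w"

lemma Phiw_F: "\<Phi>w j (F x) = 3 powr (real n / 2) * \<Phi> j x"
  by (simp add: cell_eigenfunction_def length_w)

lemma powr_half_square: "3 powr (real n / 2) * 3 powr (real n / 2) = (3 ^ n :: real)"
  by (simp add: powr_realpow flip: powr_add)

text \<open>The factor 5 ^ n of the eigenvalues moves into the time variable, the two normalisations
  3 powr (n / 2) combine to 3 ^ n, and the additive constant 3 ^ n restores the 1 subtracted in the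
  expansion.\<close>

lemma cell_heat_kernel_F:
  assumes "0 < t" "x \<in> K" "y \<in> K"
  shows "cell_heat_kernel lam \<Phi> w t (F x) (F y) = 3 ^ n * p (5 ^ n * t) x y"
proof -
  have "(\<lambda>j. 3 ^ n * (exp (- lam j * (5 ^ n * t)) * \<Phi> j x * \<Phi> j y)) sums (3 ^ n * (p (5 ^ n * t) x y - 1))"
    using assms by (intro sums_mult heat_kernel_expansion) auto
  moreover have "3 ^ n * (exp (- lam j * (5 ^ n * t)) * \<Phi> j x * \<Phi> j y) =
      exp (- lamw j * t) * \<Phi>w j (F x) * \<Phi>w j (F y)" for j
    by (simp add: Phiw_F cell_eigenvalue_def length_w mult_ac flip: powr_half_square)
  ultimately have "(\<Sum>j. exp (- lamw j * t) * \<Phi>w j (F x) * \<Phi>w j (F y)) = 3 ^ n * (p (5 ^ n * t) x y - 1)"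
    by (simp add: sums_iff)
  then show ?thesis by (simp add: cell_heat_kernel_def length_w algebra_simps)
qed

lemma riesz_kernel_F:
  assumes "x \<in> K" "y \<in> K"
  shows "riesz_kernel (3 ^ n) (cell_heat_kernel lam \<Phi> w) s (F x) (F y) =
    3 ^ n * (5 ^ n) powr (- s) * riesz_kernel 1 p s x y"
  using riesz_kernel_scaling[where a = 1 and b = "3 ^ n" and c = "5 ^ n" and q = "cell_heat_kernel lam \<Phi> w"
      and x' = "F x" and y' = "F y" and p = p and x = x and y = y] cell_heat_kernel_F assms
  by (simp add: algebra_simps)

lemma cell_integral_mult:
  fixes f g :: "complex \<Rightarrow> real"
  assumes "f \<in> borel_measurable \<mu>w" "g \<in> borel_measurable \<mu>w"
  shows "(\<integral>x. f x * g x \<partial>\<mu>w) = (\<integral>x. f (F x) * g (F x) \<partial>\<mu>) / 3 ^ n"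
  using integral_comp_F[of "\<lambda>x. f x * g x"] assms by simp

lemma Phiw_L2: "\<Phi>w j \<in> Lp_set \<mu>w 2"
  using Lp_set_2_lincomb(1)[OF Phi_L2[of j] Phi_L2[of j], of "3 powr (real n / 2)" 0]
    Lp_set_comp_F_iff[of "\<Phi>w j" 2] by (simp add: Phiw_F)

lemma cell_coefficient:
  assumes "f \<in> Lp_set \<mu>w 2"
  shows "(\<integral>x. \<Phi>w j x * f x \<partial>\<mu>w) = 3 powr (real n / 2) * (\<integral>x. \<Phi> j x * f (F x) \<partial>\<mu>) / 3 ^ n"
  using cell_integral_mult[of "\<Phi>w j" f] Phiw_L2[of j] assms by (simp add: Lp_set_2_iff Phiw_F mult.assoc)

end

sublocale gasket_cell_spectrum \<subseteq> cell: orthonormal_system \<mu>w \<Phi>w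
proof
  fix i j
  show "\<Phi>w j \<in> Lp_set \<mu>w 2" by (rule Phiw_L2)
  have "(\<integral>x. \<Phi> i x * (3 powr (real n / 2) * \<Phi> j x) \<partial>\<mu>) = 3 powr (real n / 2) * (if i = j then 1 else 0)"
    by (simp only: mult.left_commute[of "\<Phi> i _"] integral_mult_right_zero orthonormal)
  then show "(\<integral>x. \<Phi>w i x * \<Phi>w j x \<partial>\<mu>w) = (if i = j then 1 else 0)"
    using powr_half_square by (simp add: cell_coefficient[OF Phiw_L2] Phiw_F)
qed

locale gasket_cell_powers = gasket_cell_spectrum K \<mu> w n p lam \<Phi> for K \<mu> w n p lam \<Phi> +
  fixes s :: real
  assumes s: "0 < s"

sublocale gasket_cell_powers \<subseteq> big: negative_powers \<mu> \<Phi> lam "lam 0" s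
  using eig lam_pos s by unfold_locales (auto simp: is_neumann_eigenbasis_def incseq_def)

sublocale gasket_cell_powers \<subseteq> small: negative_powers \<mu>w \<Phi>w lamw "lam 0" s
proof
  show "lam 0 \<le> lamw j" for j
  proof -
    have "1 * lam 0 \<le> 5 ^ length w * lam j"
      using big.lam[of j] lam_pos[of 0] by (intro mult_mono) auto
    then show ?thesis by (simp add: cell_eigenvalue_def)
  qed
qed (use lam_pos s in auto)

context gasket_cell_powers
begin

text \<open>Term by term, the eigenvalues give 5 powr (- n * s), while the two normalisations 3 powr
  (n / 2), one in the coefficient and one in the eigenfunction, cancel against the mass factor 3 ^
  n.\<close>

lemma T_comp_F:
  assumes f: "f \<in> Lp_set \<mu>w 2"
  shows "AE x in \<mu>. big.T (f \<circ> F) x = 5 powr (real n * s) * small.T f (F x)"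
proof -
  have fF: "f \<circ> F \<in> Lp_set \<mu> 2" using f by (simp add: Lp_set_comp_F_iff comp_def)
  have l: "lamw j powr (- s) = 5 powr (- (real n * s)) * lam j powr (- s)" for j
    using lam_pos[of j] by (simp add: cell_eigenvalue_def length_w powr_mult powr_powr flip: powr_realpow)
  have c: "5 powr (real n * s) * small.part f N (F x) = big.part (f \<circ> F) N x" for N x
  proof -
    have "5 powr (real n * s) * (lamw j powr (- s) * (\<integral>z. \<Phi>w j z * f z \<partial>\<mu>w) * \<Phi>w j (F x)) =
        lam j powr (- s) * (\<integral>z. \<Phi> j z * (f \<circ> F) z \<partial>\<mu>) * \<Phi> j x" for j
    proof -
      have "5 powr (real n * s) * (lamw j powr (- s) * (\<integral>z. \<Phi>w j z * f z \<partial>\<mu>w) * \<Phi>w j (F x)) =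
          (5 powr (real n * s) * 5 powr (- (real n * s))) * (3 powr (real n / 2) * 3 powr (real n / 2) / 3 ^ n) *
          (lam j powr (- s) * (\<integral>z. \<Phi> j z * f (F z) \<partial>\<mu>) * \<Phi> j x)"
        unfolding l cell_coefficient[OF f] Phiw_F by (simp only: mult_ac times_divide_eq_right times_divide_eq_left)
      then show ?thesis unfolding powr_half_square by (simp flip: powr_add)
    qed
    then show ?thesis by (simp add: big.part_def small.part_def sum_distrib_left)
  qed
  have "L2_conv \<mu> (\<lambda>N x. small.part f N (F x)) (\<lambda>x. small.T f (F x))"
    by (rule L2_conv_comp_F[OF small.part_conv[OF f]])
  from L2_conv_lincomb[OF this this, of "5 powr (real n * s)" 0]
  have "L2_conv \<mu> (big.part (f \<circ> F)) (\<lambda>x. 5 powr (real n * s) * small.T f (F x))"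
    by (simp add: c)
  from L2_conv_unique[OF big.part_conv[OF fF] this] show ?thesis .
qed

text \<open>Together with \<open>sobolev_rel_iff\<close> this shows that composition with F
  preserves representing sequences and their equivalence, which is what the pullback to the
  completion rests on.\<close>

lemma T_conv_comp_F:
  assumes \<phi>: "\<And>k. \<phi> k \<in> L2_zero \<mu>w" and conv: "L2_conv \<mu>w (\<lambda>k. small.T (\<phi> k)) g"
  shows "L2_conv \<mu> (\<lambda>k. big.T (\<phi> k \<circ> F)) (\<lambda>x. 5 powr (real n * s) * g (F x))"
proof (rule L2_conv_cong)
  show "L2_conv \<mu> (\<lambda>k x. 5 powr (real n * s) * small.T (\<phi> k) (F x)) (\<lambda>x. 5 powr (real n * s) * g (F x))"
    using L2_conv_lincomb[OF L2_conv_comp_F[OF conv] L2_conv_comp_F[OF conv], of "5 powr (real n * s)" 0] by simp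
  fix k
  have L: "\<phi> k \<in> Lp_set \<mu>w 2" "\<phi> k \<circ> F \<in> Lp_set \<mu> 2"
    using \<phi>[of k] L2_zero_comp_F[OF \<phi>[of k]] by (auto simp: L2_zero_def)
  show "big.T (\<phi> k \<circ> F) \<in> Lp_set \<mu> 2" by (rule big.T_L2[OF L(2)])
  show "AE x in \<mu>. 5 powr (real n * s) * small.T (\<phi> k) (F x) = big.T (\<phi> k \<circ> F) x"
    using T_comp_F[OF L(1)] by eventually_elim simp
qed

text \<open>One representing sequence of f and its composition with F compute the potentials on both
  sides, whatever representatives are selected. The memberships are included to exclude the default
  value of the stochastic integral.\<close>

lemma neg_power_ext_pullback:
  assumes "f \<in> sobolev_neg \<mu>w lamw \<Phi>w s"
  defines "g \<equiv> sobolev_pullback \<mu> lam \<Phi> s F f"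
  shows "neg_power_ext \<mu>w lamw \<Phi>w s f \<in> Lp_set \<mu>w 2"
    and "neg_power_ext \<mu> lam \<Phi> s g \<in> Lp_set \<mu> 2"
    and "AE x in \<mu>. neg_power_ext \<mu> lam \<Phi> s g x = 5 powr (real n * s) * neg_power_ext \<mu>w lamw \<Phi>w s f (F x)"
proof -
  let ?rel = "sobolev_rel \<mu> lam \<Phi> s" and ?relw = "sobolev_rel \<mu>w lamw \<Phi>w s"
  obtain \<phi> where \<phi>: "\<phi> \<in> sobolev_cauchy \<mu>w lamw \<Phi>w s" and f: "f = ?relw `` {\<phi>}"
    using assms(1) by (auto simp: sobolev_neg_def elim: quotientE)
  have \<phi>0: "\<And>k. \<phi> k \<in> L2_zero \<mu>w" using \<phi> by (simp add: sobolev_cauchy_def)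
  have "(\<phi>, \<phi>) \<in> ?relw" using \<phi> unfolding small.sobolev_rel_iff small.sobolev_cauchy_iff by blast
  then have \<phi>f: "\<phi> \<in> f" by (simp add: f)
  have w: "L2_conv \<mu>w (\<lambda>k. small.T (\<phi> k)) (neg_power_ext \<mu>w lamw \<Phi>w s f)"
    by (rule small.neg_power_ext_conv) (use \<phi>f in \<open>auto simp: f\<close>)
  have pull: "((\<lambda>k. \<phi> k \<circ> F), (\<lambda>k. \<phi>' k \<circ> F)) \<in> ?rel" if "\<phi>' \<in> f" for \<phi>'
  proof -
    have "(\<phi>, \<phi>') \<in> ?relw" using that by (simp add: f)
    then obtain h where h: "L2_conv \<mu>w (\<lambda>k. small.T (\<phi> k)) h" "L2_conv \<mu>w (\<lambda>k. small.T (\<phi>' k)) h"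
      and \<phi>'0: "\<And>k. \<phi>' k \<in> L2_zero \<mu>w" unfolding small.sobolev_rel_iff by blast
    show ?thesis
      unfolding big.sobolev_rel_iff
      using T_conv_comp_F[OF \<phi>0 h(1)] T_conv_comp_F[OF \<phi>'0 h(2)] L2_zero_comp_F \<phi>0 \<phi>'0 by blast
  qed
  have "L2_conv \<mu> (\<lambda>k. big.T (\<phi> k \<circ> F)) (neg_power_ext \<mu> lam \<Phi> s g)"
  proof (rule big.neg_power_ext_conv)
    show "g \<noteq> {}" using pull[OF \<phi>f] \<phi>f by (auto simp: g_def sobolev_pullback_def)
    fix \<psi> assume "\<psi> \<in> g"
    then obtain \<phi>' where \<phi>': "\<phi>' \<in> f" "((\<lambda>k. \<phi>' k \<circ> F), \<psi>) \<in> ?rel" by (auto simp: g_def sobolev_pullback_def)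
    from \<phi>'(2) obtain h where h: "L2_conv \<mu> (\<lambda>k. big.T (\<phi>' k \<circ> F)) h" "L2_conv \<mu> (\<lambda>k. big.T (\<psi> k)) h"
      and \<psi>0: "\<And>k. \<psi> k \<in> L2_zero \<mu>" unfolding big.sobolev_rel_iff by blast
    from pull[OF \<phi>'(1)] obtain h' where h': "L2_conv \<mu> (\<lambda>k. big.T (\<phi> k \<circ> F)) h'" "L2_conv \<mu> (\<lambda>k. big.T (\<phi>' k \<circ> F)) h'"
      and \<phi>F: "\<And>k. \<phi> k \<circ> F \<in> L2_zero \<mu>" unfolding big.sobolev_rel_iff by blast
    \<comment> \<open>Transitivity of the equivalence: h and h' are both limits of the images for
      \<open>\<phi>'\<close>, hence equal almost everywhere, and h may replace h'.\<close>
    have "(\<integral>x. (big.T (\<phi> k \<circ> F) x - h' x)\<^sup>2 \<partial>\<mu>) = (\<integral>x. (big.T (\<phi> k \<circ> F) x - h x)\<^sup>2 \<partial>\<mu>)" for k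
      using L2_conv_unique[OF h'(2) h(1)] h h'
      by (intro integral_cong_AE borel_measurable_power borel_measurable_diff) (auto simp: L2_conv_def Lp_set_2_iff)
    then have "L2_conv \<mu> (\<lambda>k. big.T (\<phi> k \<circ> F)) h" using h'(1) h(1) by (simp add: L2_conv_def)
    then show "((\<lambda>k. \<phi> k \<circ> F), \<psi>) \<in> ?rel"
      unfolding big.sobolev_rel_iff using h(2) \<psi>0 \<phi>F by blast
  qed
  from L2_conv_unique[OF this T_conv_comp_F[OF \<phi>0 w]] this w
  show "neg_power_ext \<mu>w lamw \<Phi>w s f \<in> Lp_set \<mu>w 2" "neg_power_ext \<mu> lam \<Phi> s g \<in> Lp_set \<mu> 2"
    "AE x in \<mu>. neg_power_ext \<mu> lam \<Phi> s g x = 5 powr (real n * s) * neg_power_ext \<mu>w lamw \<Phi>w s f (F x)"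
    by (auto simp: L2_conv_def)
qed

end

theorem proposition3p17:
  fixes K :: "complex set" and \<mu> :: "complex measure"
    and lam :: "nat \<Rightarrow> real" and \<Phi> :: "nat \<Rightarrow> complex \<Rightarrow> real"
    and p :: "real \<Rightarrow> complex \<Rightarrow> complex \<Rightarrow> real"
    and n :: nat and w :: "nat list" and \<alpha> s H :: real
    and P :: "'v measure" and W :: "complex set \<Rightarrow> 'v \<Rightarrow> real"
    and Pw :: "'w measure" and Ww :: "complex set \<Rightarrow> 'w \<Rightarrow> real"
  defines "H \<equiv> s * d_w - (\<alpha> - 1) * d_h / \<alpha>"
    and "\<mu>w \<equiv> cell_measure K \<mu> w"
    and "lamw \<equiv> cell_eigenvalue lam w"
    and "\<Phi>w \<equiv> cell_eigenfunction \<Phi> w"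
    and "Fw \<equiv> sg_word_map w"
    and "G \<equiv> riesz_kernel 1 p s"
    and "Gw \<equiv> riesz_kernel (3 ^ n) (cell_heat_kernel lam \<Phi> w) s"
  assumes gasket: "is_sierpinski_gasket K" "is_gasket_measure K \<mu>"
    and eigenbasis: "is_neumann_eigenbasis K \<mu> lam \<Phi>"
    and heat_kernel: "is_heat_kernel K \<mu> p"
    and word: "w \<in> sg_words n"
    and alpha: "0 < \<alpha>" "\<alpha> \<le> 2"
    and s_pos: "0 < s"
    and W: "is_stable_random_measure P \<mu> \<alpha> W"
    and Ww: "is_stable_random_measure Pw \<mu>w \<alpha> Ww"
  shows "(\<forall>f \<in> Lp_set \<mu>w \<alpha>.
            f \<circ> Fw \<in> Lp_set \<mu> \<alpha> \<and>
            same_distribution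
              Pw (\<lambda>\<omega>. 3 powr (real n / \<alpha>) * stable_integral Pw \<mu>w \<alpha> Ww f \<omega>)
              P (stable_integral P \<mu> \<alpha> W (f \<circ> Fw)))
       \<and> same_fdd (sobolev_neg \<mu>w lamw \<Phi>w s)
           Pw (\<lambda>f \<omega>. 2 powr (real n * H) * 3 ^ n * stable_field Pw \<mu>w \<alpha> Ww lamw \<Phi>w s f \<omega>)
           P (\<lambda>f. stable_field P \<mu> \<alpha> W lam \<Phi> s (sobolev_pullback \<mu> lam \<Phi> s Fw f))
       \<and> (s > max ((\<alpha> - 1) * d_h / (\<alpha> * d_w)) 0 \<longrightarrow>
           same_fdd K
             Pw (\<lambda>x \<omega>. 2 powr (real n * H) * stable_density_field Pw \<mu>w \<alpha> Ww Gw (Fw x) \<omega>)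
             P (stable_density_field P \<mu> \<alpha> W G))"
proof -
  interpret gasket_cell_powers K \<mu> w n p lam \<Phi> s
    using gasket eigenbasis heat_kernel word s_pos by unfold_locales auto
  note defs = H_def \<mu>w_def lamw_def \<Phi>w_def Fw_def G_def Gw_def
  note Ww' = Ww[unfolded defs]
  have H: "2 powr (real n * H) = 3 powr (real n / \<alpha>) * 5 powr (real n * s) / 3 ^ n"
    unfolding H_def by (rule scaling_exponent) (use alpha in simp)
  have 1: "f \<circ> F \<in> Lp_set \<mu> \<alpha>"
    "same_distribution Pw (\<lambda>\<omega>. 3 powr (real n / \<alpha>) * stable_integral Pw (cell_measure K \<mu> w) \<alpha> Ww f \<omega>)
       P (stable_integral P \<mu> \<alpha> W (f \<circ> F))" if "f \<in> Lp_set (cell_measure K \<mu> w) \<alpha>" for f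
  proof -
    show fF: "f \<circ> F \<in> Lp_set \<mu> \<alpha>" using that by (simp add: comp_def Lp_set_comp_F_iff)
    \<comment> \<open>A single function is treated as a family over the one-point index
      type.\<close>
    have "same_fdd UNIV Pw (\<lambda>_::unit. \<lambda>\<omega>. 3 powr (real n / \<alpha>) * stable_integral Pw (cell_measure K \<mu> w) \<alpha> Ww f \<omega>)
       P (\<lambda>_. stable_integral P \<mu> \<alpha> W (f \<circ> F))"
      by (rule same_fdd_scaled[OF alpha(1) W Ww', where \<kappa> = 1]) (use that fF in auto)
    from same_fdd_imp_same_distribution[OF this UNIV_I]
    show "same_distribution Pw (\<lambda>\<omega>. 3 powr (real n / \<alpha>) * stable_integral Pw (cell_measure K \<mu> w) \<alpha> Ww f \<omega>)
       P (stable_integral P \<mu> \<alpha> W (f \<circ> F))" .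
  qed
  \<comment> \<open>Here \<open>\<kappa>\<close> is the scaling factor of the potentials;
    multiplying 2 powr (n * H) by 3 ^ n removes the denominator in \<open>H\<close>, which leaves
    the constant of \<open>same_fdd_scaled\<close>.\<close>
  have 2: "same_fdd (sobolev_neg (cell_measure K \<mu> w) (cell_eigenvalue lam w) (cell_eigenfunction \<Phi> w) s)
     Pw (\<lambda>f \<omega>. 2 powr (real n * H) * 3 ^ n *
       stable_field Pw (cell_measure K \<mu> w) \<alpha> Ww (cell_eigenvalue lam w) (cell_eigenfunction \<Phi> w) s f \<omega>)
     P (\<lambda>f. stable_field P \<mu> \<alpha> W lam \<Phi> s (sobolev_pullback \<mu> lam \<Phi> s F f))"
    unfolding stable_field_def
    by (rule same_fdd_scaled[OF alpha(1) W Ww', where \<kappa> = "5 powr (real n * s)"])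
      (auto simp: H neg_power_ext_pullback Lp_set_2_subset[OF alpha] cell.Lp_set_2_subset[OF alpha])
  have 3: "same_fdd K
     Pw (\<lambda>x \<omega>. 2 powr (real n * H) * stable_integral Pw (cell_measure K \<mu> w) \<alpha> Ww
       (riesz_kernel (3 ^ n) (cell_heat_kernel lam \<Phi> w) s (F x)) \<omega>)
     P (\<lambda>x. stable_integral P \<mu> \<alpha> W (riesz_kernel 1 p s x))"
  proof (rule same_fdd_scaled[OF alpha(1) W Ww', where \<kappa> = "5 powr (real n * s) / 3 ^ n"])
    fix x assume x: "x \<in> K"
    let ?g = "riesz_kernel (3 ^ n) (cell_heat_kernel lam \<Phi> w) s (F x)" and ?c = "3 ^ n * (5 ^ n) powr (- s) :: real"
    \<comment> \<open>\<open>\<kappa>\<close> is the reciprocal of the factor by which the Riesz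
      kernel of the cell scales.\<close>
    have c: "5 powr (real n * s) / 3 ^ n = 1 / ?c"
      by (simp add: powr_minus powr_powr field_simps flip: powr_realpow)
    have eq: "?g (F y) = ?c * riesz_kernel 1 p s x y" if "y \<in> space \<mu>" for y
      using riesz_kernel_F[OF x] that by (simp add: space_mu)
    \<comment> \<open>Membership is transferred in both directions, so that default values of the
      two integrals correspond to each other.\<close>
    have "?g \<in> Lp_set (cell_measure K \<mu> w) \<alpha> \<longleftrightarrow> (\<lambda>y. ?g (F y)) \<in> Lp_set \<mu> \<alpha>"
      by (rule Lp_set_comp_F_iff[symmetric])
    also have "\<dots> \<longleftrightarrow> (\<lambda>y. ?c * riesz_kernel 1 p s x y) \<in> Lp_set \<mu> \<alpha>"
      unfolding Lp_set_def mem_Collect_eq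
      by (intro conj_cong measurable_cong Bochner_Integration.integrable_cong refl) (simp_all only: eq)
    also have "\<dots> \<longleftrightarrow> riesz_kernel 1 p s x \<in> Lp_set \<mu> \<alpha>"
      by (rule Lp_set_cmult_iff) simp
    finally show "?g \<in> Lp_set (cell_measure K \<mu> w) \<alpha> \<longleftrightarrow> riesz_kernel 1 p s x \<in> Lp_set \<mu> \<alpha>" .
    show "AE y in \<mu>. riesz_kernel 1 p s x y = 5 powr (real n * s) / 3 ^ n * ?g (F y)"
      unfolding c by (rule AE_I2) (simp add: eq)
  qed (simp_all add: H)
  show ?thesis
    using 1 2 3 unfolding defs stable_density_field_def by simp
qed

end
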